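(* Consider the focusing cubic nonlinear half-wave equation $$i\partial_t u-|D|u=-|u|^2u,\qquad (t,x)\in\mathbb{R}\times\mathbb{R}.$$ There exists $\varepsilon_0>0$ such that for every $\varepsilon\in(0,\varepsilon_0)$ there exist global solutions $u_1^\varepsilon,u_2^\varepsilon\in C(\mathbb{R};H^{1/2}(\mathbb{R}))$ of this equation with $\|u_1^\varepsilon(0)\|_{L^2}\lesssim1$, $\|u_2^\varepsilon(0)\|_{L^2}\lesssim1$ uniformly in $\varepsilon$, $$\lim_{\varepsilon\to0}\|u_1^\varepsilon(0)-u_2^\varepsilon(0)\|_{L^2}=0,$$ and $$\liminf_{\varepsilon\to0}\|u_1^\varepsilon-u_2^\varepsilon\|_{L^\infty([0,T];L^2)}\gtrsim1\quad\text{for all }T>0.$$ In particular, the solution map of the focusing equation fails to be uniformly continuous on bounded subsets of $L^2(\mathbb{R})$.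
   Context: $|D|$ is the Fourier multiplier with symbol $|\xi|$, i.e. $\widehat{|D|f}(\xi)=|\xi|\widehat f(\xi)$. Implicit constants are independent of $\varepsilon$. *)

theory Defs
  imports "HOL-Analysis.Analysis"
begin

definition L2 :: "(real \<Rightarrow> complex) \<Rightarrow> bool" where
  "L2 f \<longleftrightarrow> f \<in> borel_measurable lebesgue \<and> integrable lebesgue (\<lambda>x. (cmod (f x))\<^sup>2)"

definition L2_norm :: "(real \<Rightarrow> complex) \<Rightarrow> real" where
  "L2_norm f = sqrt (integral\<^sup>L lebesgue (\<lambda>x. (cmod (f x))\<^sup>2))"

definition test_fun :: "(real \<Rightarrow> real) \<Rightarrow> bool" where
  "test_fun \<psi> \<longleftrightarrow> (\<forall>n x. (deriv ^^ n) \<psi> differentiable (at x)) \<and> bounded {x. \<psi> x \<noteq> 0}"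

definition fourier :: "(real \<Rightarrow> complex) \<Rightarrow> real \<Rightarrow> complex" where
  "fourier f \<xi> = integral\<^sup>L lebesgue (\<lambda>x. exp (- \<i> * of_real (x * \<xi>)) * f x)"

definition absD :: "(real \<Rightarrow> complex) \<Rightarrow> real \<Rightarrow> complex" where
  "absD f x = (1 / (2 * pi)) *
     integral\<^sup>L lebesgue (\<lambda>\<xi>. exp (\<i> * of_real (x * \<xi>)) * of_real \<bar>\<xi>\<bar> * fourier f \<xi>)"

definition is_fourier :: "(real \<Rightarrow> complex) \<Rightarrow> (real \<Rightarrow> complex) \<Rightarrow> bool" where
  "is_fourier f g \<longleftrightarrow> g \<in> borel_measurable lebesgue \<and>
     (\<forall>\<psi>. test_fun \<psi> \<longrightarrow>
        integrable lebesgue (\<lambda>\<xi>. g \<xi> * of_real (\<psi> \<xi>)) \<and>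
        integral\<^sup>L lebesgue (\<lambda>x. f x * fourier (\<lambda>y. of_real (\<psi> y)) x)
        = integral\<^sup>L lebesgue (\<lambda>\<xi>. g \<xi> * of_real (\<psi> \<xi>)))"

definition fourierL2 :: "(real \<Rightarrow> complex) \<Rightarrow> real \<Rightarrow> complex" where
  "fourierL2 f = (SOME g. is_fourier f g)"

definition H12 :: "(real \<Rightarrow> complex) \<Rightarrow> bool" where
  "H12 f \<longleftrightarrow> L2 f \<and> (\<exists>g. is_fourier f g \<and>
      integrable lebesgue (\<lambda>\<xi>. sqrt (1 + \<xi>\<^sup>2) * (cmod (g \<xi>))\<^sup>2))"

definition H12_norm :: "(real \<Rightarrow> complex) \<Rightarrow> real" where
  "H12_norm f = sqrt (integral\<^sup>L lebesgue
      (\<lambda>\<xi>. sqrt (1 + \<xi>\<^sup>2) * (cmod (fourierL2 f \<xi>))\<^sup>2))"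

text \<open>Global solution u in C(R; H^{1/2}(R)) of  i u_t - |D| u = - |u|^2 u,
  in the weak sense: for every test function psi and every time t,
  i d/dt <u(t),psi> = <u(t), |D|psi> - <|u(t)|^2 u(t), psi>,  with <f,g> = integral f g.\<close>
definition halfwave_solution :: "(real \<Rightarrow> real \<Rightarrow> complex) \<Rightarrow> bool" where
  "halfwave_solution (u :: real \<Rightarrow> real \<Rightarrow> complex) \<longleftrightarrow>
     (\<forall>t. H12 (u t)) \<and>
     (\<forall>t::real. ((\<lambda>s::real. H12_norm (\<lambda>x. u s x - u t x)) \<longlongrightarrow> 0) (at t)) \<and>
     (\<forall>\<psi> (t::real). test_fun \<psi> \<longrightarrow>
        ((\<lambda>s::real. integral\<^sup>L lebesgue (\<lambda>x. u s x * of_real (\<psi> x)))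
          has_vector_derivative
          (- \<i> * (integral\<^sup>L lebesgue (\<lambda>x. u t x * absD (\<lambda>y. of_real (\<psi> y)) x)
                 - integral\<^sup>L lebesgue (\<lambda>x. of_real ((cmod (u t x))\<^sup>2) * u t x * of_real (\<psi> x)))))
        (at t))"

end

theory Submission
  imports Defs "HOL-Library.Diagonal_Subsequence"
begin

text \<open>The equation is \<open>L\<^sup>2\<close>-critical: a solution \<open>R\<close> of \<open>|D| R + R = R\<^sup>3\<close> yields the standing waves
  \<open>e\<^sup>i\<^sup>l\<^sup>t l\<^sup>1\<^sup>/\<^sup>2 R(l x)\<close> for every \<open>l > 0\<close>, all of the same \<open>L\<^sup>2\<close> norm. Take \<open>l = \<epsilon>\<^sup>-\<^sup>2\<close> and \<open>l = \<epsilon>\<^sup>-\<^sup>2 + \<epsilon>\<^sup>-\<^sup>1\<close>.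
  The ratio of the two scales tends to 1, so the initial data merge, while the phases are opposite at time \<open>\<pi> \<epsilon>\<close>;
  since \<open>R \<ge> 0\<close>, the two waves are then at least \<open>\<parallel>R\<parallel>\<close> apart.

  The profile \<open>R\<close> comes from maximizing the quadratic form of \<open>(1 + |D|)\<^sup>-\<^sup>1\<close>, whose kernel is positive and decreasing in \<open>|x|\<close>,
  over the functions in the unit ball of \<open>L\<^sup>4\<^sup>/\<^sup>3\<close> that are nonnegative and decreasing in \<open>|x|\<close>. On this class the form is
  continuous under pointwise convergence, because an integrable majorant exists, and Helly's theorem gives compactness.\<close>

section \<open>Fourier transform on the line\<close>

text \<open>A maximizer over a restricted class usually satisfies only a variational inequality.
  Here the resolvent maps profiles decreasing in |x| to such profiles, so the Hoelder extremizer
  built from it stays in the class and the full Euler-Lagrange equation results. Profiles of this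
  class are centred at 0, which removes the loss of compactness by translation. The exponent 4/3 is
  dual to 4: with q = (1 + |D|)^-1 f, extremality makes f proportional to q^3, the cubic
  nonlinearity. Inverting 1 + |D| keeps the variational part inside positive integral operators; |D|
  itself returns only through the symbol equation for the finished profile. The notion of solution
  forces the Fourier part. It tests against |D| applied to a test function, which calls for
  inversion, and it measures H^(1/2) through an arbitrarily chosen distributional transform, which
  calls for almost everywhere uniqueness and hence for enough test functions. Poisson kernels carry
  both inversion and the resolvent.\<close>

lemma lebesgue_integral_lborel:
  fixes f :: "real \<Rightarrow> 'a::{banach, second_countable_topology}"
  assumes "f \<in> borel_measurable borel"
  shows "integral\<^sup>L lebesgue f = integral\<^sup>L lborel f"
  using assms by (intro integral_completion) simp

lemma fourier_lborel:
  assumes [measurable]: "f \<in> borel_measurable borel"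
  shows "fourier f \<xi> = (LINT x|lborel. exp (- \<i> * of_real (x * \<xi>)) * f x)"
  unfolding fourier_def by (rule lebesgue_integral_lborel) measurable

lemma norm_exp_i_real: "norm (exp (\<i> * complex_of_real x)) = 1" "norm (exp (- (\<i> * complex_of_real x))) = 1"
  by (simp_all add: norm_exp_eq_Re)

lemma fourier_measurable [measurable]:
  assumes [measurable]: "f \<in> borel_measurable borel"
  shows "fourier f \<in> borel_measurable borel"
proof -
  have "fourier f = (\<lambda>\<xi>. LINT x|lborel. exp (- \<i> * of_real (x * \<xi>)) * f x)"
    using fourier_lborel[OF assms] by auto
  also have "\<dots> \<in> borel_measurable borel" by measurable
  finally show ?thesis .
qed

lemma norm_fourier_le:
  assumes "integrable lborel f"
  shows "norm (fourier f \<xi>) \<le> (LINT x|lborel. norm (f x))"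
proof -
  have [measurable]: "f \<in> borel_measurable borel" using assms by auto
  have "norm (fourier f \<xi>) \<le> (LINT x|lborel. norm (exp (- \<i> * of_real (x * \<xi>)) * f x))"
    unfolding fourier_lborel[OF \<open>f \<in> _\<close>] by (rule integral_norm_bound)
  then show ?thesis by (simp add: norm_mult norm_exp_i_real del: of_real_mult)
qed

lemma integrable_pair_bounded:
  fixes \<Phi> :: "real \<times> real \<Rightarrow> 'a::{banach, second_countable_topology}"
    and f :: "real \<Rightarrow> 'b::{banach, second_countable_topology}"
    and g :: "real \<Rightarrow> 'c::{banach, second_countable_topology}"
  assumes [measurable]: "\<Phi> \<in> borel_measurable (borel \<Otimes>\<^sub>M borel)"
    and f: "integrable lborel f" and g: "integrable lborel g"
    and le: "\<And>x y. norm (\<Phi> (x, y)) \<le> norm (f x) * norm (g y)"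
  shows "integrable (lborel \<Otimes>\<^sub>M lborel) \<Phi>"
proof -
  have [measurable]: "f \<in> borel_measurable borel" "g \<in> borel_measurable borel" using f g by auto
  have "integrable (lborel \<Otimes>\<^sub>M lborel) (\<lambda>(x, y). norm (f x) * norm (g y))"
  proof (rule lborel_pair.Fubini_integrable)
    show "(\<lambda>(x, y). norm (f x) * norm (g y)) \<in> borel_measurable (lborel \<Otimes>\<^sub>M lborel)" by measurable
    show "integrable lborel (\<lambda>x. LINT y|lborel. norm (case (x, y) of (x, y) \<Rightarrow> norm (f x) * norm (g y)))"
      using f g by (auto simp: norm_mult)
    show "AE x in lborel. integrable lborel (\<lambda>y. case (x, y) of (x, y) \<Rightarrow> norm (f x) * norm (g y))"
      using g by auto
  qed
  then show ?thesis
    by (rule Bochner_Integration.integrable_bound) (use le in auto)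
qed

text \<open>Fubini for the symmetric kernel \<open>exp (- \<i> * x * \<xi>)\<close>. This one
  identity drives inversion, the L^2 bound and the weak form of |D| below.\<close>

lemma fourier_multiplication_formula:
  assumes f: "integrable lborel f" and g: "integrable lborel g"
  shows "(LINT x|lborel. f x * fourier g x) = (LINT \<xi>|lborel. fourier f \<xi> * g \<xi>)"
proof -
  have [measurable]: "f \<in> borel_measurable borel" "g \<in> borel_measurable borel" using f g by auto
  have "(LINT x|lborel. f x * fourier g x)
      = (LINT x|lborel. LINT \<xi>|lborel. exp (- \<i> * of_real (x * \<xi>)) * (f x * g \<xi>))"
    using g by (subst fourier_lborel) (auto simp: integral_mult_right_zero[symmetric] ac_simps
        simp del: integral_mult_right_zero)
  also have "\<dots> = (LINT \<xi>|lborel. LINT x|lborel. exp (- \<i> * of_real (x * \<xi>)) * (f x * g \<xi>))"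
  proof (rule lborel_pair.Fubini_integral[symmetric], rule integrable_pair_bounded[OF _ f g])
    show "(\<lambda>(x, \<xi>). exp (- \<i> * of_real (x * \<xi>)) * (f x * g \<xi>)) \<in> borel_measurable (borel \<Otimes>\<^sub>M borel)"
      by measurable
  qed (auto simp: norm_mult norm_exp_i_real simp del: of_real_mult)
  also have "\<dots> = (LINT \<xi>|lborel. fourier f \<xi> * g \<xi>)"
    by (simp add: fourier_lborel mult.assoc[symmetric])
  finally show ?thesis .
qed

section \<open>The Poisson kernel and Fourier inversion\<close>

lemma exp_halfline_integral:
  fixes a :: complex
  assumes a: "Re a > 0"
  shows "has_bochner_integral lborel (\<lambda>x. indicator {0<..} x *\<^sub>R exp (- a * of_real x)) (1 / a)"
proof -
  \<comment> \<open>The modulus of the integrand is \<open>exp (- Re a * x)\<close>. Its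
    integrability comes first, because the FTC used for the complex integrand presupposes
    integrability.\<close>
  have R: "set_integrable lborel (einterval 0 \<infinity>) (\<lambda>x. exp (- Re a * x))"
  proof (rule interval_integral_FTC_nonneg(1)[where F="\<lambda>x. - exp (- Re a * x) / Re a" and A = "- 1 / Re a" and B=0])
    show "((\<lambda>x. - exp (- Re a * x) / Re a) has_real_derivative exp (- Re a * x)) (at x)" for x
      using a by (auto intro!: derivative_eq_intros)
    have "((\<lambda>x. - exp (- Re a * x) / Re a) \<longlongrightarrow> - exp (- Re a * 0) / Re a) (at_right 0)"
      by (intro tendsto_intros) (use a in auto)
    then show "(((\<lambda>x. - exp (- Re a * x) / Re a) \<circ> real_of_ereal) \<longlongrightarrow> - 1 / Re a) (at_right 0)"
      unfolding zero_ereal_def ereal_tendsto_simps1 by simp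
    have "((\<lambda>x. - exp (- Re a * x) / Re a) \<longlongrightarrow> - 0 / Re a) at_top"
    proof (intro tendsto_intros)
      show "((\<lambda>x. exp (- Re a * x)) \<longlongrightarrow> 0) at_top"
        using a by (intro filterlim_compose[OF exp_at_bot] filterlim_tendsto_neg_mult_at_bot[OF tendsto_const])
          (auto simp: filterlim_ident)
    qed (use a in auto)
    then show "(((\<lambda>x. - exp (- Re a * x) / Re a) \<circ> real_of_ereal) \<longlongrightarrow> 0) (at_left \<infinity>)"
      unfolding ereal_tendsto_simps1 by simp
  qed auto
  have C: "set_integrable lborel (einterval 0 \<infinity>) (\<lambda>x. exp (- a * of_real x))"
    unfolding set_integrable_def
    by (rule Bochner_Integration.integrable_bound[OF R[unfolded set_integrable_def]])
      (auto simp: norm_exp_eq_Re)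
  have "(LBINT x=0..\<infinity>. exp (- a * of_real x)) = 0 - (- 1 / a)"
  proof (rule interval_integral_FTC_integrable[where F="\<lambda>x. - exp (- a * of_real x) / a", OF _ _ _ C])
    show "((\<lambda>x. - exp (- a * of_real x) / a) has_vector_derivative exp (- a * of_real x)) (at x)" for x
    proof -
      have "((\<lambda>z. - exp (- a * z) / a) has_field_derivative exp (- a * of_real x)) (at (of_real x))"
        using a by (auto intro!: derivative_eq_intros)
      then show ?thesis by (rule has_vector_derivative_real_field)
    qed
    have "((\<lambda>x. - exp (- a * of_real x) / a) \<longlongrightarrow> - exp (- a * of_real 0) / a) (at_right 0)"
      by (intro tendsto_intros) (use a in auto)
    then show "(((\<lambda>x. - exp (- a * of_real x) / a) \<circ> real_of_ereal) \<longlongrightarrow> - 1 / a) (at_right 0)"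
      unfolding zero_ereal_def ereal_tendsto_simps1 by simp
    have "((\<lambda>x. - exp (- a * of_real x) / a) \<longlongrightarrow> - 0 / a) at_top"
    proof (intro tendsto_intros)
      have "((\<lambda>x. norm (exp (- a * of_real x))) \<longlongrightarrow> 0) at_top"
        unfolding norm_exp_eq_Re
        using a by (intro filterlim_compose[OF exp_at_bot]) (auto intro!: filterlim_tendsto_pos_mult_at_top[OF tendsto_const]
          simp: filterlim_ident filterlim_uminus_at_bot)
      then show "((\<lambda>x. exp (- a * of_real x)) \<longlongrightarrow> 0) at_top" by (rule tendsto_norm_zero_cancel)
    qed (use a in auto)
    then show "(((\<lambda>x. - exp (- a * of_real x) / a) \<circ> real_of_ereal) \<longlongrightarrow> 0) (at_left \<infinity>)"
      unfolding ereal_tendsto_simps1 by simp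
  qed (auto intro!: continuous_intros)
  moreover have "einterval 0 \<infinity> = {0<..}" by (auto simp: einterval_def)
  ultimately show ?thesis
    using C by (simp add: has_bochner_integral_iff set_integrable_def interval_lebesgue_integral_def
        set_lebesgue_integral_def)
qed

text \<open>Splitting at 0 leaves two half-line integrals with exponents
  \<open>a = s + \<i> \<xi>\<close> and \<open>b = s - \<i> \<xi>\<close>, and 1/a + 1/b is the
  stated fraction.\<close>

lemma
  assumes "s > 0"
  shows integrable_exp_abs: "integrable lborel (\<lambda>x. exp (- s * \<bar>x\<bar>))"
    and fourier_exp_abs: "fourier (\<lambda>x. of_real (exp (- s * \<bar>x\<bar>))) \<xi> = of_real (2 * s / (s\<^sup>2 + \<xi>\<^sup>2))"
proof -
  define a b where "a = Complex s \<xi>" and "b = Complex s (- \<xi>)"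
  define h where "h a x = indicator {0<..} x *\<^sub>R exp (- a * complex_of_real x)" for a x
  have ab: "Re a > 0" "Re b > 0" using assms by (auto simp: a_def b_def)
  have ha: "has_bochner_integral lborel (h a) (1/a)"
    unfolding h_def by (rule exp_halfline_integral[OF ab(1)])
  have hb: "has_bochner_integral lborel (h b) (1/b)"
    unfolding h_def by (rule exp_halfline_integral[OF ab(2)])
  then have hb': "has_bochner_integral lborel (\<lambda>x. h b (- x)) (1/b)"
    using lborel_has_bochner_integral_real_affine_iff[of "-1" "h b" "1/b" 0] by simp
  have *: "has_bochner_integral lborel (\<lambda>x. h a x + h b (- x)) (1/a + 1/b)"
    by (rule has_bochner_integral_add[OF ha hb'])
  have [measurable]: "h a \<in> borel_measurable borel" "h b \<in> borel_measurable borel" for a unfolding h_def by measurable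
  \<comment> \<open>\<open>h\<close> vanishes at 0, where the exponential does not, hence equality
    only off that point.\<close>
  have ae: "AE x in lborel. h a x + h b (- x) = exp (- \<i> * of_real (x * \<xi>)) * of_real (exp (- s * \<bar>x\<bar>))"
  proof -
    have "h a x + h b (- x) = exp (- \<i> * of_real (x * \<xi>)) * of_real (exp (- s * \<bar>x\<bar>))" if "x \<noteq> 0" for x
    proof -
      have "exp (- \<i> * of_real (x * \<xi>)) * of_real (exp (- s * \<bar>x\<bar>)) = exp (- \<i> * of_real (x * \<xi>) + of_real (- s * \<bar>x\<bar>))"
        unfolding exp_add exp_of_real ..
      also have "\<dots> = h a x + h b (- x)"
      proof (cases "x > 0")
        case True
        then have "- \<i> * of_real (x * \<xi>) + of_real (- s * \<bar>x\<bar>) = - a * of_real x"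
          by (simp add: a_def complex_eq_iff)
        with True show ?thesis by (simp add: h_def)
      next
        case False
        with that have "x < 0" by simp
        then have "- \<i> * of_real (x * \<xi>) + of_real (- s * \<bar>x\<bar>) = - b * of_real (- x)"
          by (simp add: b_def complex_eq_iff)
        with \<open>x < 0\<close> show ?thesis by (simp add: h_def)
      qed
      finally show ?thesis ..
    qed
    moreover have "AE x in lborel. x \<noteq> (0::real)" by (rule AE_lborel_singleton)
    ultimately show ?thesis by auto
  qed
  have hb: "has_bochner_integral lborel (\<lambda>x. exp (- \<i> * of_real (x * \<xi>)) * of_real (exp (- s * \<bar>x\<bar>))) (1/a + 1/b)"
    using * by (subst has_bochner_integral_cong_AE[OF _ _ ae, symmetric]) measurable
  have "1/a + 1/b = of_real (2 * s / (s\<^sup>2 + \<xi>\<^sup>2))"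
    using assms by (auto simp: a_def b_def complex_eq_iff power2_eq_square add_divide_distrib[symmetric] Re_divide Im_divide)
  then show "fourier (\<lambda>x. of_real (exp (- s * \<bar>x\<bar>))) \<xi> = of_real (2 * s / (s\<^sup>2 + \<xi>\<^sup>2))"
    using hb by (subst fourier_lborel) (auto simp: has_bochner_integral_iff)
  have "integrable lborel (\<lambda>x. norm (exp (- \<i> * of_real (x * \<xi>)) * of_real (exp (- s * \<bar>x\<bar>))))"
    using hb by (auto simp: has_bochner_integral_iff simp del: of_real_mult)
  then show "integrable lborel (\<lambda>x. exp (- s * \<bar>x\<bar>))"
    by (simp add: norm_mult norm_exp_i_real del: of_real_mult)
qed

text \<open>The kernel of exp(-s|D|), of mass 1 for s > 0. It is the approximate identity in the
  inversion theorem and, averaged over s, the resolvent kernel.\<close>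

definition poisson :: "real \<Rightarrow> real \<Rightarrow> real" where
  "poisson s x = s / (s\<^sup>2 + x\<^sup>2) / pi"

lemma poisson_measurable [measurable (raw)]:
  assumes [measurable]: "f \<in> borel_measurable M" "g \<in> borel_measurable M"
  shows "(\<lambda>x. poisson (f x) (g x)) \<in> borel_measurable M"
  unfolding poisson_def by measurable

lemma poisson_nonneg: "s \<ge> 0 \<Longrightarrow> poisson s x \<ge> 0"
  by (simp add: poisson_def)

lemma poisson_le: "s > 0 \<Longrightarrow> poisson s x \<le> 1 / (pi * s)"
  using frac_le[of s s "s\<^sup>2" "s\<^sup>2 + x\<^sup>2"]
  by (simp add: poisson_def power2_eq_square divide_right_mono mult.commute[of pi] flip: divide_divide_eq_left)

lemma poisson_has_integral:
  assumes s: "s > 0"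
  shows "has_bochner_integral lborel (poisson s) 1"
proof -
  let ?F = "\<lambda>x. arctan (x / s) / pi"
  have "filterlim (\<lambda>x. inverse s * x) at_top at_top" "filterlim (\<lambda>x. inverse s * x) at_bot at_bot"
    using s by (auto intro!: filterlim_tendsto_pos_mult_at_top[OF tendsto_const] filterlim_tendsto_pos_mult_at_bot[OF tendsto_const]
        filterlim_ident)
  then have "filterlim (\<lambda>x. x / s) at_top at_top" "filterlim (\<lambda>x. x / s) at_bot at_bot"
    by (simp_all add: field_class.field_divide_inverse mult.commute)
  then have lim: "(?F \<longlongrightarrow> (pi/2) / pi) at_top" "(?F \<longlongrightarrow> (- (pi/2)) / pi) at_bot"
    by (intro tendsto_divide[OF _ tendsto_const] filterlim_compose[OF tendsto_arctan_at_top]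
        filterlim_compose[OF tendsto_arctan_at_bot]; simp)+
  have *: "set_integrable lborel (einterval (-\<infinity>) \<infinity>) (poisson s)" "(LBINT x=-\<infinity>..\<infinity>. poisson s x) = (pi/2) / pi - (- (pi/2)) / pi"
  proof -
    have F: "(?F has_real_derivative poisson s x) (at x)" for x
    proof -
      have "(?F has_real_derivative inverse (1 + (x / s)\<^sup>2) * (1 / s) / pi) (at x)"
        by (intro DERIV_cdivide DERIV_chain2[OF DERIV_arctan] DERIV_ident)
      moreover have "1 + (x / s)\<^sup>2 = (s\<^sup>2 + x\<^sup>2) / s\<^sup>2"
        using s by (simp add: field_simps)
      ultimately show ?thesis using s by (simp add: poisson_def power2_eq_square)
    qed
    have c: "isCont (poisson s) x" for x
      unfolding poisson_def using s by (intro continuous_intros) (auto simp: sum_power2_eq_zero_iff)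
    have A: "((?F \<circ> real_of_ereal) \<longlongrightarrow> (- (pi/2)) / pi) (at_right (-\<infinity>))" "((?F \<circ> real_of_ereal) \<longlongrightarrow> (pi/2) / pi) (at_left \<infinity>)"
      unfolding ereal_tendsto_simps1 using lim by auto
    show "set_integrable lborel (einterval (-\<infinity>) \<infinity>) (poisson s)"
      by (rule interval_integral_FTC_nonneg(1)[OF _ F c _ A]) (use s in \<open>auto simp: poisson_nonneg\<close>)
    show "(LBINT x=-\<infinity>..\<infinity>. poisson s x) = (pi/2) / pi - (- (pi/2)) / pi"
      by (rule interval_integral_FTC_nonneg(2)[OF _ F c _ A]) (use s in \<open>auto simp: poisson_nonneg\<close>)
  qed
  then show ?thesis
    by (simp add: has_bochner_integral_iff set_integrable_def interval_lebesgue_integral_def set_lebesgue_integral_def)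
qed

text \<open>Substituting \<open>x + s * y\<close> moves the shrinking width into the argument of f,
  against the fixed density \<open>poisson 1\<close>. Boundedness of f gives the dominating
  function, continuity at x the pointwise limit.\<close>

lemma poisson_integral_limit:
  fixes f :: "real \<Rightarrow> complex"
  assumes [measurable]: "f \<in> borel_measurable borel" and cont: "isCont f x" and bd: "\<And>y. norm (f y) \<le> B"
  shows "((\<lambda>n. LINT y|lborel. of_real (poisson (1 / Suc n) (y - x)) * f y) \<longlonglongrightarrow> f x)"
proof -
  have sub: "(LINT y|lborel. of_real (poisson s (y - x)) * f y) = (LINT y|lborel. of_real (poisson 1 y) * f (x + s * y))"
    if "s > 0" for s
  proof -
    have *: "poisson 1 y = s * poisson s (s * y)" for y
    proof -
      have "s\<^sup>2 + (s * y)\<^sup>2 = s\<^sup>2 * (1 + y\<^sup>2)" by (simp add: algebra_simps power_mult_distrib)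
      moreover have "1 + y\<^sup>2 > 0" by (simp add: add_pos_nonneg)
      ultimately show ?thesis
        using that by (simp add: poisson_def power2_eq_square)
    qed
    have "(LINT y|lborel. of_real (poisson s (y - x)) * f y)
        = s *\<^sub>R (LINT y|lborel. of_real (poisson s (s * y)) * f (x + s * y))"
      using that by (subst lborel_integral_real_affine[where c=s and t=x]) auto
    also have "\<dots> = (LINT y|lborel. s *\<^sub>R (of_real (poisson s (s * y)) * f (x + s * y)))"
      by simp
    finally show ?thesis by (simp add: * scaleR_conv_of_real mult.assoc)
  qed
  have int1: "integrable lborel (poisson 1)" "(LINT y|lborel. poisson 1 y) = 1"
    using poisson_has_integral[of 1] by (auto simp: has_bochner_integral_iff)
  have B: "B \<ge> 0" using norm_ge_zero[of "f 0"] bd[of 0] by linarith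
  have "(\<lambda>n. LINT y|lborel. of_real (poisson 1 y) * f (x + (1 / Suc n) * y)) \<longlonglongrightarrow> (LINT y|lborel. of_real (poisson 1 y) * f x)"
  proof (rule integral_dominated_convergence[where w="\<lambda>y. poisson 1 y * B"])
    show "integrable lborel (\<lambda>y. poisson 1 y * B)" using int1 by auto
    show "AE y in lborel. (\<lambda>n. of_real (poisson 1 y) * f (x + (1 / Suc n) * y)) \<longlonglongrightarrow> of_real (poisson 1 y) * f x"
    proof (intro always_eventually allI tendsto_intros isCont_tendsto_compose[OF cont])
      fix y show "(\<lambda>n. x + 1 / real (Suc n) * y) \<longlonglongrightarrow> x"
        using tendsto_add[OF tendsto_const tendsto_mult_right[OF LIMSEQ_Suc[OF lim_1_over_n]], of x y] by simp
    qed
    show "AE y in lborel. norm (of_real (poisson 1 y) * f (x + (1 / Suc n) * y)) \<le> poisson 1 y * B" for n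
      using bd by (auto simp: norm_mult poisson_nonneg intro!: mult_left_mono)
  qed auto
  then show ?thesis using int1(2) by (simp add: sub)
qed

lemma fourier_modulated_exp_abs:
  assumes "s > 0"
  shows "fourier (\<lambda>\<xi>. exp (\<i> * of_real (x * \<xi>)) * of_real (exp (- s * \<bar>\<xi>\<bar>))) y = of_real (2 * pi * poisson s (y - x))"
proof -
  have "fourier (\<lambda>\<xi>. exp (\<i> * of_real (x * \<xi>)) * of_real (exp (- s * \<bar>\<xi>\<bar>))) y
      = fourier (\<lambda>x. of_real (exp (- s * \<bar>x\<bar>))) (y - x)"
  proof -
    have "exp (- \<i> * of_real (z * y)) * exp (\<i> * of_real (x * z)) = exp (- \<i> * of_real (z * (y - x)))" for z
      unfolding exp_add[symmetric] by (simp add: algebra_simps)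
    then show ?thesis
      unfolding fourier_def by (simp only: mult.assoc[symmetric])
  qed
  then show ?thesis unfolding fourier_exp_abs[OF assms] by (simp add: poisson_def)
qed

text \<open>Abel summation of the inversion integral: the damping factor makes the multiplier
  integrable, so the multiplication formula turns the damped integral into a Poisson average of
  f.\<close>

lemma poisson_fourier:
  fixes f :: "real \<Rightarrow> complex"
  assumes f: "integrable lborel f" and s: "s > 0"
  shows "(LINT \<xi>|lborel. exp (\<i> * of_real (x * \<xi>)) * of_real (exp (- s * \<bar>\<xi>\<bar>)) * fourier f \<xi>)
    = 2 * pi * (LINT y|lborel. of_real (poisson s (y - x)) * f y)"
proof -
  let ?g = "\<lambda>\<xi>. exp (\<i> * of_real (x * \<xi>)) * complex_of_real (exp (- s * \<bar>\<xi>\<bar>))"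
  have g: "integrable lborel ?g"
    by (rule Bochner_Integration.integrable_bound[OF integrable_exp_abs[OF s]])
      (auto simp: norm_mult norm_exp_i_real simp del: of_real_mult)
  have "(LINT \<xi>|lborel. exp (\<i> * of_real (x * \<xi>)) * of_real (exp (- s * \<bar>\<xi>\<bar>)) * fourier f \<xi>)
    = (LINT y|lborel. f y * fourier ?g y)"
    unfolding fourier_multiplication_formula[OF f g] by (simp only: ac_simps)
  also have "\<dots> = (LINT y|lborel. 2 * pi * (of_real (poisson s (y - x)) * f y))"
    unfolding fourier_modulated_exp_abs[OF s] by (simp add: ac_simps)
  finally show ?thesis by simp
qed

text \<open>Both sides of \<open>poisson_fourier\<close> for s = 1/(n+1): the Poisson averages tend
  to f x, and the damped integrals tend to the undamped one, dominated by the modulus of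
  \<open>fourier f\<close>.\<close>

theorem fourier_inversion:
  fixes f :: "real \<Rightarrow> complex"
  assumes f: "integrable lborel f" and ff: "integrable lborel (fourier f)"
    and cont: "isCont f x" and bd: "\<And>y. norm (f y) \<le> B"
  shows "(LINT \<xi>|lborel. exp (\<i> * of_real (x * \<xi>)) * fourier f \<xi>) = 2 * pi * f x"
proof -
  have [measurable]: "f \<in> borel_measurable borel" using f by auto
  have "(\<lambda>n. LINT \<xi>|lborel. exp (\<i> * of_real (x * \<xi>)) * of_real (exp (- (1 / Suc n) * \<bar>\<xi>\<bar>)) * fourier f \<xi>)
     \<longlonglongrightarrow> 2 * pi * f x"
    unfolding poisson_fourier[OF f zero_less_divide_1_iff[THEN iffD2, OF of_nat_0_less_iff[THEN iffD2, OF zero_less_Suc]]]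
    by (intro tendsto_intros poisson_integral_limit[OF _ cont bd]) auto
  moreover have "(\<lambda>n. LINT \<xi>|lborel. exp (\<i> * of_real (x * \<xi>)) * of_real (exp (- (1 / Suc n) * \<bar>\<xi>\<bar>)) * fourier f \<xi>)
     \<longlonglongrightarrow> (LINT \<xi>|lborel. exp (\<i> * of_real (x * \<xi>)) * of_real (exp (- 0 * \<bar>\<xi>\<bar>)) * fourier f \<xi>)"
  proof (rule integral_dominated_convergence[where w="\<lambda>y. norm (fourier f y)"])
    show "AE \<xi> in lborel. (\<lambda>n. exp (\<i> * of_real (x * \<xi>)) * of_real (exp (- (1 / Suc n) * \<bar>\<xi>\<bar>)) * fourier f \<xi>)
       \<longlonglongrightarrow> exp (\<i> * of_real (x * \<xi>)) * of_real (exp (- 0 * \<bar>\<xi>\<bar>)) * fourier f \<xi>"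
      using LIMSEQ_Suc[OF lim_1_over_n[where 'a=real]] by (intro always_eventually allI tendsto_intros) auto
    show "AE \<xi> in lborel. norm (exp (\<i> * of_real (x * \<xi>)) * of_real (exp (- (1 / Suc n) * \<bar>\<xi>\<bar>)) * fourier f \<xi>) \<le> norm (fourier f \<xi>)" for n
    proof (intro always_eventually allI)
      fix \<xi> :: real
      have "exp (- (1 / Suc n) * \<bar>\<xi>\<bar>) \<le> 1" by simp
      from mult_right_mono[OF this norm_ge_zero]
      show "norm (exp (\<i> * of_real (x * \<xi>)) * of_real (exp (- (1 / Suc n) * \<bar>\<xi>\<bar>)) * fourier f \<xi>) \<le> norm (fourier f \<xi>)"
        by (simp only: norm_mult norm_exp_i_real norm_of_real abs_exp_cancel mult_1)
    qed
  qed (use ff in auto)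
  ultimately have "2 * pi * f x = (LINT \<xi>|lborel. exp (\<i> * of_real (x * \<xi>)) * of_real (exp (- 0 * \<bar>\<xi>\<bar>)) * fourier f \<xi>)"
    by (rule LIMSEQ_unique)
  then show ?thesis by simp
qed

text \<open>Inversion applied to \<open>fourier_exp_abs\<close>, whose right-hand side is 2 pi times
  the Poisson kernel. Evaluation at -\<xi> turns the inverse transform into the forward one.\<close>

lemma fourier_poisson:
  assumes s: "s > 0"
  shows "fourier (\<lambda>x. of_real (poisson s x)) \<xi> = of_real (exp (- s * \<bar>\<xi>\<bar>))"
proof -
  let ?e = "\<lambda>x. complex_of_real (exp (- s * \<bar>x\<bar>))"
  have p: "integrable lborel (poisson s)" using poisson_has_integral[OF s] by (auto simp: has_bochner_integral_iff)
  have fe: "fourier ?e = (\<lambda>x. complex_of_real (2 * pi * poisson s x))"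
    by (rule ext) (simp only: fourier_exp_abs[OF s] poisson_def, simp)
  have "(LINT x|lborel. exp (\<i> * of_real ((-\<xi>) * x)) * fourier ?e x) = 2 * pi * ?e (-\<xi>)"
  proof (rule fourier_inversion)
    show "integrable lborel ?e" using integrable_exp_abs[OF s] by (intro integrable_of_real)
    show "integrable lborel (fourier ?e)" unfolding fe using p by (intro integrable_of_real) auto
    show "isCont ?e (-\<xi>)" by (intro continuous_intros)
    show "norm (?e y) \<le> 1" for y using s by simp
  qed
  also have "(LINT x|lborel. exp (\<i> * of_real ((-\<xi>) * x)) * fourier ?e x)
     = (LINT x|lborel. (2 * pi) * (exp (- \<i> * of_real (x * \<xi>)) * of_real (poisson s x)))"
    unfolding fe by (simp add: ac_simps)
  also have "\<dots> = 2 * pi * fourier (\<lambda>x. of_real (poisson s x)) \<xi>"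
    by (simp add: fourier_lborel del: of_real_mult)
  finally show ?thesis by simp
qed

lemma cnj_measurable [measurable]: "cnj \<in> borel_measurable borel"
  by (intro borel_measurable_continuous_onI continuous_intros)

text \<open>The part of Plancherel that the H^(1/2) bound uses. Damping by exp(-s|\<xi>|) turns the
  square integral into a quadratic form of the Poisson kernel, bounded uniformly in s because both
  marginals of the kernel have mass 1; Fatou then removes the damping.\<close>

lemma fourier_square_integrable:
  fixes f :: "real \<Rightarrow> complex"
  assumes f: "integrable lborel f" and f2: "integrable lborel (\<lambda>x. (norm (f x))\<^sup>2)"
  shows "integrable lborel (\<lambda>\<xi>. (norm (fourier f \<xi>))\<^sup>2)"
proof -
  have [measurable]: "f \<in> borel_measurable borel" using f by auto
  define C where "C = (LINT x|lborel. (norm (f x))\<^sup>2)"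
  define B where "B = (LINT x|lborel. norm (f x))"
  have B: "norm (fourier f \<xi>) \<le> B" for \<xi> using norm_fourier_le[OF f] by (simp add: B_def)
  have B0: "B \<ge> 0" using order_trans[OF norm_ge_zero B] .
  have bound: "(\<integral>\<^sup>+\<xi>. ennreal (exp (- s * \<bar>\<xi>\<bar>) * (norm (fourier f \<xi>))\<^sup>2) \<partial>lborel) \<le> ennreal (2 * pi * C)" if s: "s > 0" for s
  proof -
    let ?e = "\<lambda>\<xi>. exp (- s * \<bar>\<xi>\<bar>)"
    \<comment> \<open>Chosen so that \<open>fourier f \<xi> * ?g \<xi>\<close> is the damped square
      of the modulus.\<close>
    let ?g = "\<lambda>\<xi>. complex_of_real (?e \<xi>) * cnj (fourier f \<xi>)"
    have p: "integrable lborel (poisson s)" "(LINT y|lborel. poisson s y) = 1"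
      using poisson_has_integral[OF s] by (auto simp: has_bochner_integral_iff)
    have p': "integrable lborel (\<lambda>y. poisson s (y - x))" "(LINT y|lborel. poisson s (y - x)) = 1" for x
      using p lborel_integrable_real_affine[OF p(1), of 1 "-x"] lborel_integral_real_affine[of 1 "poisson s" "-x"] by auto
    have g: "integrable lborel ?g"
      by (rule Bochner_Integration.integrable_bound[where f="\<lambda>\<xi>. ?e \<xi> * B"])
        (use integrable_exp_abs[OF s] B B0 in \<open>auto simp: norm_mult\<close>)
    have fg: "fourier ?g x = 2 * pi * cnj (LINT y|lborel. of_real (poisson s (y - x)) * f y)" for x
    proof -
      have "fourier ?g x = (LINT \<xi>|lborel. cnj (exp (\<i> * of_real (x * \<xi>)) * of_real (?e \<xi>) * fourier f \<xi>))"
        by (subst fourier_lborel) (auto simp: exp_cnj ac_simps)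
      also have "\<dots> = cnj (2 * pi * (LINT y|lborel. of_real (poisson s (y - x)) * f y))"
        unfolding poisson_fourier[OF f s, symmetric] by (rule Bochner_Integration.integral_cnj)
      finally show ?thesis by simp
    qed
    have fp: "integrable lborel (\<lambda>y. poisson s (y - x) * norm (f y))" for x
    proof (rule Bochner_Integration.integrable_bound[where f="\<lambda>y. (1 / (pi * s)) * norm (f y)"])
      show "AE y in lborel. norm (poisson s (y - x) * norm (f y)) \<le> norm (1 / (pi * s) * norm (f y))"
        using s poisson_le[OF s] by (auto simp: poisson_nonneg abs_mult intro!: mult_right_mono simp del: times_divide_eq_left)
    qed (use f in auto)
    have e2: "integrable lborel (\<lambda>\<xi>. ?e \<xi> * (norm (fourier f \<xi>))\<^sup>2)"
      by (rule Bochner_Integration.integrable_bound[where f="\<lambda>\<xi>. ?e \<xi> * B\<^sup>2"])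
        (use integrable_exp_abs[OF s] B B0 in \<open>auto intro!: power_mono\<close>)
    have "(LINT \<xi>|lborel. complex_of_real (?e \<xi> * (norm (fourier f \<xi>))\<^sup>2)) = (LINT \<xi>|lborel. fourier f \<xi> * ?g \<xi>)"
      by (intro Bochner_Integration.integral_cong) (auto simp: complex_norm_square[symmetric] ac_simps simp del: of_real_power)
    also have "\<dots> = (LINT x|lborel. f x * fourier ?g x)"
      by (rule fourier_multiplication_formula[OF f g, symmetric])
    finally have eq: "complex_of_real (LINT \<xi>|lborel. ?e \<xi> * (norm (fourier f \<xi>))\<^sup>2) = (LINT x|lborel. f x * fourier ?g x)"
      unfolding integral_complex_of_real .
    have fi: "integrable lborel (\<lambda>x. f x * fourier ?g x)"
      by (rule Bochner_Integration.integrable_bound[where f="\<lambda>x. f x * of_real (LINT \<xi>|lborel. norm (?g \<xi>))"])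
        (use f norm_fourier_le[OF g] in \<open>auto simp: norm_mult intro!: mult_left_mono\<close>)
    have "(LINT \<xi>|lborel. ?e \<xi> * (norm (fourier f \<xi>))\<^sup>2) \<le> norm (LINT x|lborel. f x * fourier ?g x)"
      unfolding eq[symmetric] norm_of_real by (rule abs_ge_self)
    then have "ennreal (LINT \<xi>|lborel. ?e \<xi> * (norm (fourier f \<xi>))\<^sup>2) \<le> (\<integral>\<^sup>+x. norm (f x * fourier ?g x) \<partial>lborel)"
      using integral_norm_bound_ennreal[OF fi] by (meson ennreal_leI order_trans)
    also have "\<dots> \<le> (\<integral>\<^sup>+x. \<integral>\<^sup>+y. ennreal (pi * poisson s (y - x) * ((norm (f x))\<^sup>2 + (norm (f y))\<^sup>2)) \<partial>lborel \<partial>lborel)"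
    proof (rule nn_integral_mono)
      fix x
      have "norm (f x * fourier ?g x) \<le> norm (f x) * (2 * pi * (LINT y|lborel. poisson s (y - x) * norm (f y)))"
        unfolding fg using integral_norm_bound[of lborel "\<lambda>y. of_real (poisson s (y - x)) * f y"] s
        by (auto simp: norm_mult poisson_nonneg intro!: mult_left_mono)
      also have "\<dots> = (LINT y|lborel. norm (f x) * (2 * pi * (poisson s (y - x) * norm (f y))))" by simp
      finally have "ennreal (norm (f x * fourier ?g x)) \<le> (\<integral>\<^sup>+y. norm (f x) * (2 * pi * (poisson s (y - x) * norm (f y))) \<partial>lborel)"
        using fp s by (subst nn_integral_eq_integral) (auto simp: poisson_nonneg intro!: ennreal_leI)
      also have "\<dots> \<le> (\<integral>\<^sup>+y. ennreal (pi * poisson s (y - x) * ((norm (f x))\<^sup>2 + (norm (f y))\<^sup>2)) \<partial>lborel)"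
      proof (intro nn_integral_mono ennreal_leI)
        fix y
        \<comment> \<open>AM-GM separates the variables; by symmetry of the kernel in x and y, both
          halves contribute \<open>pi * C\<close>.\<close>
        have "pi * poisson s (y - x) * (2 * norm (f x) * norm (f y)) \<le> pi * poisson s (y - x) * ((norm (f x))\<^sup>2 + (norm (f y))\<^sup>2)"
          using s by (intro mult_left_mono sum_squares_bound mult_nonneg_nonneg poisson_nonneg) auto
        then show "norm (f x) * (2 * pi * (poisson s (y - x) * norm (f y))) \<le> pi * poisson s (y - x) * ((norm (f x))\<^sup>2 + (norm (f y))\<^sup>2)"
          by (simp add: ac_simps)
      qed
      finally show "ennreal (norm (f x * fourier ?g x)) \<le> (\<integral>\<^sup>+y. ennreal (pi * poisson s (y - x) * ((norm (f x))\<^sup>2 + (norm (f y))\<^sup>2)) \<partial>lborel)" .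
    qed
    also have "\<dots> = (\<integral>\<^sup>+x. \<integral>\<^sup>+y. ennreal (pi * poisson s (y - x) * (norm (f x))\<^sup>2) \<partial>lborel \<partial>lborel)
        + (\<integral>\<^sup>+x. \<integral>\<^sup>+y. ennreal (pi * poisson s (y - x) * (norm (f y))\<^sup>2) \<partial>lborel \<partial>lborel)"
      using s by (simp add: distrib_left ennreal_plus poisson_nonneg nn_integral_add)
    also have "(\<integral>\<^sup>+x. \<integral>\<^sup>+y. ennreal (pi * poisson s (y - x) * (norm (f y))\<^sup>2) \<partial>lborel \<partial>lborel)
        = (\<integral>\<^sup>+y. \<integral>\<^sup>+x. ennreal (pi * poisson s (y - x) * (norm (f y))\<^sup>2) \<partial>lborel \<partial>lborel)"
      by (rule lborel_pair.Fubini') measurable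
    also have "\<dots> = (\<integral>\<^sup>+x. \<integral>\<^sup>+y. ennreal (pi * poisson s (y - x) * (norm (f x))\<^sup>2) \<partial>lborel \<partial>lborel)"
      by (simp add: poisson_def power2_commute)
    also have "(\<integral>\<^sup>+x. \<integral>\<^sup>+y. ennreal (pi * poisson s (y - x) * (norm (f x))\<^sup>2) \<partial>lborel \<partial>lborel)
        = (\<integral>\<^sup>+x. ennreal (pi * (norm (f x))\<^sup>2) \<partial>lborel)"
      using p' s by (intro nn_integral_cong, subst nn_integral_eq_integral) (auto simp: poisson_nonneg)
    also have "\<dots> = ennreal (pi * C)"
      using f2 by (subst nn_integral_eq_integral) (auto simp: C_def)
    also have "ennreal (pi * C) + ennreal (pi * C) = ennreal (2 * pi * C)"
      by (subst ennreal_plus[symmetric]) (auto simp: C_def)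
    finally show ?thesis
      using e2 by (subst nn_integral_eq_integral) auto
  qed
  have "(\<integral>\<^sup>+\<xi>. ennreal ((norm (fourier f \<xi>))\<^sup>2) \<partial>lborel)
      = (\<integral>\<^sup>+\<xi>. liminf (\<lambda>n. ennreal (exp (- (1 / Suc n) * \<bar>\<xi>\<bar>) * (norm (fourier f \<xi>))\<^sup>2)) \<partial>lborel)"
  proof (rule nn_integral_cong)
    fix \<xi> :: real
    have "(\<lambda>n. exp (- (1 / Suc n) * \<bar>\<xi>\<bar>) * (norm (fourier f \<xi>))\<^sup>2) \<longlonglongrightarrow> exp (- 0 * \<bar>\<xi>\<bar>) * (norm (fourier f \<xi>))\<^sup>2"
      using LIMSEQ_Suc[OF lim_1_over_n[where 'a=real]] by (intro tendsto_intros) auto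
    then have "(\<lambda>n. ennreal (exp (- (1 / Suc n) * \<bar>\<xi>\<bar>) * (norm (fourier f \<xi>))\<^sup>2)) \<longlonglongrightarrow> ennreal ((norm (fourier f \<xi>))\<^sup>2)"
      by (intro tendsto_ennrealI) simp
    then show "ennreal ((norm (fourier f \<xi>))\<^sup>2) = liminf (\<lambda>n. ennreal (exp (- (1 / Suc n) * \<bar>\<xi>\<bar>) * (norm (fourier f \<xi>))\<^sup>2))"
      by (rule lim_imp_Liminf[OF sequentially_bot, symmetric])
  qed
  also have "\<dots> \<le> liminf (\<lambda>n. \<integral>\<^sup>+\<xi>. ennreal (exp (- (1 / Suc n) * \<bar>\<xi>\<bar>) * (norm (fourier f \<xi>))\<^sup>2) \<partial>lborel)"
    by (rule nn_integral_liminf) measurable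
  also have "\<dots> \<le> liminf (\<lambda>n. ennreal (2 * pi * C))"
    by (intro Liminf_mono always_eventually allI bound) simp
  also have "\<dots> < \<infinity>" by (simp add: Liminf_const)
  finally show ?thesis by (intro integrableI_bounded) auto
qed

section \<open>Test functions\<close>

lemma test_fun_has_derivative:
  assumes "test_fun \<psi>"
  shows "(\<psi> has_real_derivative deriv \<psi> x) (at x)"
proof -
  have "(deriv ^^ 0) \<psi> differentiable (at x)" using assms unfolding test_fun_def by blast
  then show ?thesis by (simp add: DERIV_deriv_iff_real_differentiable)
qed

lemma test_fun_continuous: "test_fun \<psi> \<Longrightarrow> isCont \<psi> x"
  using test_fun_has_derivative DERIV_isCont by blast

lemma test_fun_vanishes:
  assumes "test_fun \<psi>"
  shows "\<exists>a>0. \<forall>x. \<bar>x\<bar> \<ge> a \<longrightarrow> \<psi> x = 0"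
proof -
  obtain a where "a > 0" and a: "\<And>x. \<psi> x \<noteq> 0 \<Longrightarrow> \<bar>x\<bar> \<le> a"
    using assms unfolding test_fun_def bounded_pos by auto
  have "\<psi> x = 0" if "a + 1 \<le> \<bar>x\<bar>" for x using a[of x] that by linarith
  then show ?thesis using \<open>a > 0\<close> by (intro exI[of _ "a + 1"]) auto
qed

lemma test_fun_deriv:
  assumes "test_fun \<psi>"
  shows "test_fun (deriv \<psi>)"
proof -
  obtain a where a: "a > 0" "\<And>x. \<bar>x\<bar> \<ge> a \<Longrightarrow> \<psi> x = 0" using test_fun_vanishes[OF assms] by blast
  have "deriv \<psi> x = 0" if "\<bar>x\<bar> > a" for x
  proof -
    have ev: "eventually (\<lambda>y. \<psi> y = 0) (nhds x)"
    proof (rule eventually_nhds_in_open[THEN eventually_mono])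
      show "open {y. \<bar>y\<bar> > a}" by (intro open_Collect_less continuous_intros)
    qed (use that a in auto)
    then have "(\<psi> has_real_derivative 0) (at x)"
      by (subst DERIV_cong_ev[OF refl ev refl]) simp
    then show ?thesis by (rule DERIV_imp_deriv)
  qed
  then have "{x. deriv \<psi> x \<noteq> 0} \<subseteq> {-a..a}" by force
  then have "bounded {x. deriv \<psi> x \<noteq> 0}" using bounded_closed_interval bounded_subset by blast
  moreover have "(deriv ^^ n) (deriv \<psi>) differentiable (at x)" for n x
    using assms unfolding test_fun_def by (metis funpow.simps(2) funpow_swap1 o_apply)
  ultimately show ?thesis unfolding test_fun_def by blast
qed

lemma test_fun_integrable:
  assumes "test_fun \<psi>"
  shows "\<psi> \<in> borel_measurable borel" "integrable lborel \<psi>" "\<exists>B. \<forall>x. \<bar>\<psi> x\<bar> \<le> B"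
proof -
  obtain a where a: "a > 0" "\<And>x. \<bar>x\<bar> \<ge> a \<Longrightarrow> \<psi> x = 0" using test_fun_vanishes[OF assms] by blast
  have cont: "continuous_on S \<psi>" for S
    using test_fun_continuous[OF assms] by (intro continuous_at_imp_continuous_on) auto
  show "\<psi> \<in> borel_measurable borel" using cont by (rule borel_measurable_continuous_onI)
  have "integrable lborel (\<lambda>x. indicator {-a..a} x *\<^sub>R \<psi> x)"
    using borel_integrable_atLeastAtMost'[OF cont] unfolding set_integrable_def .
  moreover have "(\<lambda>x. indicator {-a..a} x *\<^sub>R \<psi> x) = \<psi>"
  proof
    fix x show "indicator {-a..a} x *\<^sub>R \<psi> x = \<psi> x"
      using a(2)[of x] by (cases "\<bar>x\<bar> \<ge> a") (auto simp: indicator_def)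
  qed
  ultimately show "integrable lborel \<psi>" by simp
  have "bounded (\<psi> ` {-a..a})" by (intro compact_imp_bounded compact_continuous_image cont) simp
  then obtain B where B: "B > 0" "\<And>x. x \<in> {-a..a} \<Longrightarrow> \<bar>\<psi> x\<bar> \<le> B" by (force simp: bounded_pos)
  have "\<bar>\<psi> x\<bar> \<le> B" for x
  proof (cases "\<bar>x\<bar> \<ge> a")
    case False
    then have "x \<in> {-a..a}" by auto
    then show ?thesis by (rule B(2))
  qed (use a B in simp)
  then show "\<exists>B. \<forall>x. \<bar>\<psi> x\<bar> \<le> B" by blast
qed

text \<open>Integration by parts: \<open>f\<close> below is the derivative of \<open>F\<close>, the
  exponential times \<psi>, which vanishes at both ends of [-b, b], so the integral of
  \<open>f\<close> is 0.\<close>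

lemma fourier_test_fun_deriv:
  assumes "test_fun \<psi>"
  shows "fourier (\<lambda>x. of_real (deriv \<psi> x)) \<xi> = \<i> * of_real \<xi> * fourier (\<lambda>x. of_real (\<psi> x)) \<xi>"
proof -
  let ?e = "\<lambda>x. exp (- \<i> * of_real (x * \<xi>))"
  have t': "test_fun (deriv \<psi>)" using assms by (rule test_fun_deriv)
  note int = test_fun_integrable[OF assms] test_fun_integrable[OF t']
  have [measurable]: "\<psi> \<in> borel_measurable borel" "deriv \<psi> \<in> borel_measurable borel" using int by auto
  obtain a where a: "a > 0" "\<And>x. \<bar>x\<bar> \<ge> a \<Longrightarrow> \<psi> x = 0" using test_fun_vanishes[OF assms] by blast
  obtain a' where a': "a' > 0" "\<And>x. \<bar>x\<bar> \<ge> a' \<Longrightarrow> deriv \<psi> x = 0" using test_fun_vanishes[OF t'] by blast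
  define b where "b = max a a'"
  have b: "b > 0" "\<And>x. \<bar>x\<bar> \<ge> b \<Longrightarrow> \<psi> x = 0" "\<And>x. \<bar>x\<bar> \<ge> b \<Longrightarrow> deriv \<psi> x = 0"
    using a a' by (auto simp: b_def)
  define F where "F x = ?e x * of_real (\<psi> x)" for x
  define f where "f x = ?e x * of_real (deriv \<psi> x) - \<i> * of_real \<xi> * (?e x * of_real (\<psi> x))" for x
  have F: "(F has_vector_derivative f x) (at x within S)" for x S
  proof -
    have "((\<lambda>z. exp (- \<i> * (z * of_real \<xi>))) has_field_derivative - \<i> * of_real \<xi> * exp (- \<i> * (of_real x * of_real \<xi>))) (at (of_real x))"
      by (auto intro!: derivative_eq_intros)
    from has_vector_derivative_real_field[OF this]
    have 1: "(?e has_vector_derivative - \<i> * of_real \<xi> * ?e x) (at x within S)" by simp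
    have 2: "((\<lambda>x. complex_of_real (\<psi> x)) has_vector_derivative of_real (deriv \<psi> x)) (at x within S)"
      using test_fun_has_derivative[OF assms] by (intro has_vector_derivative_of_real) (simp add: DERIV_subset[OF _ subset_UNIV])
    from has_vector_derivative_mult[OF 1 2] show ?thesis
      unfolding F_def f_def by (simp add: algebra_simps)
  qed
  have cont: "continuous_on S \<psi>" "continuous_on S (deriv \<psi>)" for S
    using test_fun_continuous[OF assms] test_fun_continuous[OF t'] by (auto intro: continuous_at_imp_continuous_on)
  have "(LINT x|lborel. indicator {-b..b} x *\<^sub>R f x) = F b - F (-b)"
    by (rule integral_FTC_atLeastAtMost) (use b F cont in \<open>auto simp: f_def intro!: continuous_intros\<close>)
  also have "\<dots> = 0" using b by (simp add: F_def)
  also have "(\<lambda>x. indicator {-b..b} x *\<^sub>R f x) = f"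
  proof
    fix x show "indicator {-b..b} x *\<^sub>R f x = f x"
      using b(2,3)[of x] by (cases "\<bar>x\<bar> \<ge> b") (auto simp: indicator_def f_def)
  qed
  finally have "(LINT x|lborel. f x) = 0" .
  moreover have "(LINT x|lborel. f x) = fourier (\<lambda>x. of_real (deriv \<psi> x)) \<xi> - \<i> * of_real \<xi> * fourier (\<lambda>x. of_real (\<psi> x)) \<xi>"
  proof -
    have i: "integrable lborel (\<lambda>x. ?e x * of_real (g x))" if "integrable lborel g" for g :: "real \<Rightarrow> real"
      using that by (intro Bochner_Integration.integrable_bound[OF that]) (auto simp: norm_mult norm_exp_i_real simp del: of_real_mult)
    show ?thesis
      unfolding f_def using i[OF int(2)] i[OF int(5)]
      by (subst Bochner_Integration.integral_diff) (auto simp: fourier_lborel simp del: of_real_mult)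
  qed
  ultimately show ?thesis by simp
qed

lemma fourier_test_fun_integrable:
  assumes "test_fun \<psi>"
  shows "integrable lborel (\<lambda>\<xi>. of_real (1 + \<bar>\<xi>\<bar>) * fourier (\<lambda>x. of_real (\<psi> x)) \<xi>)"
proof -
  let ?F = "\<lambda>n. fourier (\<lambda>x. complex_of_real ((deriv ^^ n) \<psi> x))"
  have t: "test_fun ((deriv ^^ n) \<psi>)" for n
    by (induction n) (auto simp: assms test_fun_deriv)
  have [measurable]: "(deriv ^^ n) \<psi> \<in> borel_measurable borel" for n using test_fun_integrable(1)[OF t] .
  have F: "norm (?F n \<xi>) = \<bar>\<xi>\<bar> ^ n * norm (?F 0 \<xi>)" for n \<xi>
  proof (induction n)
    case (Suc n)
    then show ?case using fourier_test_fun_deriv[OF t, of n \<xi>] by (simp add: norm_mult)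
  qed simp
  define C where "C n = (LINT x|lborel. norm (complex_of_real ((deriv ^^ n) \<psi> x)))" for n
  have C: "norm (?F n \<xi>) \<le> C n" for n \<xi>
    unfolding C_def by (intro norm_fourier_le integrable_of_real test_fun_integrable t)
  \<comment> \<open>Three derivatives are taken because \<open>(1 + |\<xi>|) * (1 + \<xi>^2)\<close>
    expands into the powers 0 to 3; the factor \<open>1 / (1 + \<xi>^2)\<close> that remains is a
    multiple of the Poisson kernel.\<close>
  define D where "D = C 0 + C 1 + C 2 + C 3"
  have D: "(1 + \<bar>\<xi>\<bar>) * norm (?F 0 \<xi>) \<le> D * pi * poisson 1 \<xi>" for \<xi>
  proof -
    have "(1 + \<bar>\<xi>\<bar> + \<bar>\<xi>\<bar>^2 + \<bar>\<xi>\<bar>^3) * norm (?F 0 \<xi>) \<le> D"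
      unfolding D_def using C[of 0 \<xi>] C[of 1 \<xi>] C[of 2 \<xi>] C[of 3 \<xi>] unfolding F[of 1] F[of 2] F[of 3]
      by (simp add: algebra_simps)
    moreover have "1 + \<bar>\<xi>\<bar> + \<bar>\<xi>\<bar>^2 + \<bar>\<xi>\<bar>^3 = (1 + \<bar>\<xi>\<bar>) * (1 + \<xi>\<^sup>2)"
      by (simp add: algebra_simps power2_eq_square power3_eq_cube abs_mult[symmetric])
    moreover have "1 + \<xi>\<^sup>2 > 0" by (simp add: add_pos_nonneg)
    ultimately show ?thesis
      by (simp add: poisson_def pos_le_divide_eq mult.commute mult.left_commute)
  qed
  have "integrable lborel (\<lambda>\<xi>. D * pi * poisson 1 \<xi>)"
    using poisson_has_integral[of 1] by (auto simp: has_bochner_integral_iff)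
  then show ?thesis
  proof (rule Bochner_Integration.integrable_bound)
    show "AE \<xi> in lborel. norm (of_real (1 + \<bar>\<xi>\<bar>) * fourier (\<lambda>x. of_real (\<psi> x)) \<xi>) \<le> norm (D * pi * poisson 1 \<xi>)"
      using D by (intro always_eventually allI) (force simp: norm_mult simp del: of_real_add intro: order_trans[OF _ abs_ge_self])
  qed (use test_fun_integrable(1)[OF assms] in measurable)
qed

lemma fourier_reflect:
  assumes [measurable]: "g \<in> borel_measurable borel"
  shows "(LINT \<xi>|lborel. exp (\<i> * of_real (x * \<xi>)) * g \<xi>) = fourier (\<lambda>\<xi>. g (- \<xi>)) x"
  by (subst lborel_integral_real_affine[where c="-1" and t=0]) (auto simp: fourier_lborel mult.commute)

text \<open>\<open>absD\<close> of \<psi> is itself a Fourier transform, of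
  \<open>|\<xi>| * h (- \<xi>)\<close> over 2 pi, so the multiplication formula moves |\<xi>| onto
  the transform of Q. There the symbol equation trades it for f minus \<omega> Q, and the formula is
  run backwards with \<open>inv\<close>.\<close>

lemma absD_weak:
  assumes Q: "integrable lborel Q" and f: "integrable lborel f"
    and eq: "\<And>\<xi>. of_real (\<omega> + \<bar>\<xi>\<bar>) * fourier Q \<xi> = fourier f \<xi>" and t: "test_fun \<psi>"
  shows "(LINT x|lborel. Q x * absD (\<lambda>y. of_real (\<psi> y)) x)
    = (LINT x|lborel. f x * of_real (\<psi> x)) - of_real \<omega> * (LINT x|lborel. Q x * of_real (\<psi> x))"
proof -
  let ?\<psi> = "\<lambda>x. complex_of_real (\<psi> x)"
  define h where "h = fourier ?\<psi>"
  have [measurable]: "\<psi> \<in> borel_measurable borel" using test_fun_integrable[OF t] by auto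
  have [measurable]: "h \<in> borel_measurable borel" unfolding h_def by measurable
  have hi: "integrable lborel (\<lambda>\<xi>. of_real (1 + \<bar>\<xi>\<bar>) * h \<xi>)"
    unfolding h_def by (rule fourier_test_fun_integrable[OF t])
  have h1: "integrable lborel h" and h2: "integrable lborel (\<lambda>\<xi>. of_real \<bar>\<xi>\<bar> * h \<xi>)"
    by (rule Bochner_Integration.integrable_bound[OF hi]; auto simp: norm_mult algebra_simps simp del: of_real_add)+
  have h1': "integrable lborel (\<lambda>\<xi>. h (-\<xi>))" and h2': "integrable lborel (\<lambda>\<xi>. of_real \<bar>\<xi>\<bar> * h (-\<xi>))"
    using lborel_integrable_real_affine[OF h1, of "-1" 0] lborel_integrable_real_affine[OF h2, of "-1" 0] by auto
  obtain B where B: "\<And>x. \<bar>\<psi> x\<bar> \<le> B" using test_fun_integrable[OF t] by auto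
  have inv: "fourier (\<lambda>\<xi>. h (-\<xi>)) x = 2 * pi * ?\<psi> x" for x
  proof -
    have "(LINT \<xi>|lborel. exp (\<i> * of_real (x * \<xi>)) * h \<xi>) = 2 * pi * ?\<psi> x"
      unfolding h_def
      by (rule fourier_inversion[where B=B])
        (use h1 B test_fun_integrable[OF t] test_fun_continuous[OF t] in \<open>auto simp: h_def intro!: continuous_intros\<close>)
    then show ?thesis by (simp only: fourier_reflect[OF \<open>h \<in> _\<close>])
  qed
  have aD: "absD ?\<psi> x = (1 / (2 * pi)) * fourier (\<lambda>\<xi>. of_real \<bar>\<xi>\<bar> * h (-\<xi>)) x" for x
    using fourier_reflect[of "\<lambda>\<xi>. of_real \<bar>\<xi>\<bar> * h \<xi>" x]
    by (simp add: absD_def h_def[symmetric] lebesgue_integral_lborel mult.assoc)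
  have bd: "integrable lborel (\<lambda>\<xi>. fourier Q \<xi> * g \<xi>)" if g: "integrable lborel g" for g
  proof (rule Bochner_Integration.integrable_bound[where f="\<lambda>\<xi>. of_real (LINT x|lborel. norm (Q x)) * g \<xi>"])
    show "(\<lambda>\<xi>. fourier Q \<xi> * g \<xi>) \<in> borel_measurable lborel" using Q g by measurable
  qed (use g norm_fourier_le[OF Q] in \<open>auto simp: norm_mult intro!: mult_right_mono\<close>)
  have "2 * pi * (LINT x|lborel. Q x * absD ?\<psi> x) = (LINT x|lborel. Q x * fourier (\<lambda>\<xi>. of_real \<bar>\<xi>\<bar> * h (-\<xi>)) x)"
    unfolding aD by (subst integral_mult_right_zero[symmetric]) (simp add: field_simps)
  also have "\<dots> = (LINT \<xi>|lborel. fourier Q \<xi> * (of_real \<bar>\<xi>\<bar> * h (-\<xi>)))"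
    by (rule fourier_multiplication_formula[OF Q h2'])
  also have "\<dots> = (LINT \<xi>|lborel. fourier f \<xi> * h (-\<xi>) - of_real \<omega> * (fourier Q \<xi> * h (-\<xi>)))"
    unfolding eq[symmetric] by (simp add: algebra_simps)
  also have "\<dots> = (LINT \<xi>|lborel. fourier f \<xi> * h (-\<xi>)) - of_real \<omega> * (LINT \<xi>|lborel. fourier Q \<xi> * h (-\<xi>))"
  proof -
    have "integrable lborel (\<lambda>\<xi>. fourier f \<xi> * h (-\<xi>))"
      unfolding eq[symmetric] using bd[OF h2'] bd[OF h1']
      by (auto simp: distrib_left distrib_right mult.assoc mult.left_commute[of "of_real \<bar>_\<bar>"])
    then show ?thesis using bd[OF h1'] by simp
  qed
  also have "\<dots> = 2 * pi * ((LINT x|lborel. f x * ?\<psi> x) - of_real \<omega> * (LINT x|lborel. Q x * ?\<psi> x))"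
  proof -
    have *: "(LINT x|lborel. g x * (2 * pi * ?\<psi> x)) = 2 * pi * (LINT x|lborel. g x * ?\<psi> x)" for g
      by (subst integral_mult_right_zero[symmetric]) (simp only: ac_simps)
    show ?thesis
      unfolding fourier_multiplication_formula[OF Q h1', symmetric] fourier_multiplication_formula[OF f h1', symmetric] inv *
      by (simp add: right_diff_distrib mult.left_commute)
  qed
  finally show ?thesis by simp
qed

lemma is_fourier_fourier:
  assumes f: "integrable lborel f"
  shows "is_fourier f (fourier f)"
  unfolding is_fourier_def
proof (intro conjI allI impI)
  have [measurable]: "f \<in> borel_measurable borel" using f by auto
  show "fourier f \<in> borel_measurable lebesgue" by (intro measurable_completion) simp
  fix \<psi> assume t: "test_fun \<psi>"
  have [measurable]: "\<psi> \<in> borel_measurable borel" using test_fun_integrable[OF t] by auto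
  have \<psi>: "integrable lborel (\<lambda>x. complex_of_real (\<psi> x))" using test_fun_integrable[OF t] by auto
  have "integrable lborel (\<lambda>\<xi>. fourier f \<xi> * of_real (\<psi> \<xi>))"
    by (rule Bochner_Integration.integrable_bound[where f="\<lambda>\<xi>. of_real (LINT x|lborel. norm (f x)) * complex_of_real (\<psi> \<xi>)"])
      (use \<psi> norm_fourier_le[OF f] in \<open>auto simp: norm_mult intro!: mult_right_mono\<close>)
  then show "integrable lebesgue (\<lambda>\<xi>. fourier f \<xi> * of_real (\<psi> \<xi>))"
    by (subst integrable_completion) auto
  show "(LINT x|lebesgue. f x * fourier (\<lambda>y. of_real (\<psi> y)) x) = (LINT \<xi>|lebesgue. fourier f \<xi> * of_real (\<psi> \<xi>))"
    using fourier_multiplication_formula[OF f \<psi>] by (simp add: lebesgue_integral_lborel)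
qed

section \<open>Smooth bump functions and uniqueness of the distributional Fourier transform\<close>

definition flat_exp :: "nat \<Rightarrow> real \<Rightarrow> real" where
  "flat_exp k x = (if x \<le> 0 then 0 else (1 / x) ^ k * exp (- (1 / x)))"

lemma flat_exp_tendsto_0: "(flat_exp k \<longlongrightarrow> 0) (at 0)"
proof -
  have "((\<lambda>y. y ^ k / exp y) \<longlongrightarrow> 0) (at_top :: real filter)" by (rule tendsto_power_div_exp_0)
  then have "((\<lambda>x. (inverse x) ^ k / exp (inverse x)) \<longlongrightarrow> 0) (at_right (0::real))"
    by (rule filterlim_compose[OF _ filterlim_inverse_at_top_right])
  then have "(flat_exp k \<longlongrightarrow> 0) (at_right 0)"
    by (rule Lim_transform_eventually)
      (auto simp: eventually_at_filter flat_exp_def exp_minus field_simps)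
  moreover have "(flat_exp k \<longlongrightarrow> 0) (at_left 0)"
    by (rule tendsto_eventually) (auto simp: eventually_at_filter flat_exp_def)
  ultimately show ?thesis by (rule filterlim_split_at[rotated])
qed

text \<open>The exponent \<open>k\<close> is carried so that the family spans a space closed under
  differentiation. At 0 the difference quotient is \<open>flat_exp (Suc k)\<close>, which again
  tends to 0.\<close>

lemma flat_exp_has_derivative:
  "(flat_exp k has_real_derivative flat_exp (k + 2) x - k * flat_exp (k + 1) x) (at x)"
proof (cases x "0::real" rule: linorder_cases)
  case less
  have ev: "eventually (\<lambda>y. flat_exp k y = 0) (nhds x)"
    using eventually_nhds_in_open[of "{..<0}" x] less by (auto elim!: eventually_mono simp: flat_exp_def)
  show ?thesis using less by (subst DERIV_cong_ev[OF refl ev refl]) (simp add: flat_exp_def)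
next
  case equal
  have "((\<lambda>h. (flat_exp k (0 + h) - flat_exp k 0) / h) \<longlongrightarrow> 0) (at 0)"
    by (rule Lim_transform_eventually[OF flat_exp_tendsto_0[of "Suc k"]])
      (auto simp: eventually_at_filter flat_exp_def)
  then show ?thesis using equal by (simp add: DERIV_def flat_exp_def)
next
  case greater
  have ev: "eventually (\<lambda>y. flat_exp k y = (1 / y) ^ k * exp (- (1 / y))) (nhds x)"
    using eventually_nhds_in_open[of "{0<..}" x] greater by (auto elim!: eventually_mono simp: flat_exp_def)
  have "((\<lambda>y. (1 / y) ^ k * exp (- (1 / y))) has_real_derivative
      ((1 / x) ^ (k + 2) * exp (- (1 / x)) - k * ((1 / x) ^ (k + 1) * exp (- (1 / x))))) (at x)"
  proof -
    have 1: "((\<lambda>y. 1 / y) has_real_derivative (- ((1 / x)^2))) (at x)"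
      using greater by (auto intro!: derivative_eq_intros simp: power2_eq_square)
    have 2: "((\<lambda>y. exp (- (1 / y))) has_real_derivative exp (- (1 / x)) * (1 / x)^2) (at x)"
      using DERIV_fun_exp[OF DERIV_minus[OF 1]] by simp
    have 3: "((\<lambda>y. (1 / y)^k) has_real_derivative (real k * (1 / x)^(k - Suc 0) * (- ((1 / x)^2)))) (at x)"
      using DERIV_power[OF 1, of k] by (simp add: ac_simps)
    \<comment> \<open>For \<open>k = 0\<close> the truncated exponent \<open>k - Suc 0\<close> is
      harmless, since the factor \<open>k\<close> vanishes.\<close>
    have 4: "real k * y^(k - Suc 0) * (- (y^2)) = - real k * y^(k+1)" for y :: real
      by (cases k) (simp_all add: power2_eq_square algebra_simps)
    show ?thesis
      using DERIV_mult[OF 3[unfolded 4] 2] by (simp add: algebra_simps power2_eq_square)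
  qed
  then show ?thesis using greater by (subst DERIV_cong_ev[OF refl ev refl]) (simp add: flat_exp_def)
qed

text \<open>Closure under differentiation is all that smoothness requires: every iterated derivative
  of a bump stays in this span, and no explicit formula for it is computed.\<close>

inductive_set bump_span :: "real \<Rightarrow> real \<Rightarrow> real \<Rightarrow> (real \<Rightarrow> real) set" for c a b where
  prod: "(\<lambda>x. flat_exp j (c * (x - a)) * flat_exp k (c * (b - x))) \<in> bump_span c a b"
| add: "f \<in> bump_span c a b \<Longrightarrow> g \<in> bump_span c a b \<Longrightarrow> (\<lambda>x. f x + g x) \<in> bump_span c a b"
| scale: "f \<in> bump_span c a b \<Longrightarrow> (\<lambda>x. r * f x) \<in> bump_span c a b"

lemma bump_span_derivative:
  assumes "f \<in> bump_span c a b"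
  shows "\<exists>f'\<in>bump_span c a b. \<forall>x. (f has_real_derivative f' x) (at x)"
  using assms
proof induction
  case (prod j k)
  let ?P = "\<lambda>j k x. flat_exp j (c * (x - a)) * flat_exp k (c * (b - x))"
  define f' where "f' x = (c * ?P (j + 2) k x + (- c * j) * ?P (j + 1) k x)
      + ((- c) * ?P j (k + 2) x + (c * k) * ?P j (k + 1) x)" for x
  have "f' \<in> bump_span c a b"
    unfolding f'_def by (intro bump_span.intros)
  moreover have "(?P j k has_real_derivative f' x) (at x)" for x
  proof -
    have 1: "((\<lambda>x. flat_exp j (c * (x - a))) has_real_derivative
        (flat_exp (j + 2) (c * (x - a)) - j * flat_exp (j + 1) (c * (x - a))) * c) (at x)"
      by (rule DERIV_chain2[OF flat_exp_has_derivative]) (auto intro!: derivative_eq_intros)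
    have 2: "((\<lambda>x. flat_exp k (c * (b - x))) has_real_derivative
        (flat_exp (k + 2) (c * (b - x)) - k * flat_exp (k + 1) (c * (b - x))) * (- c)) (at x)"
      by (rule DERIV_chain2[OF flat_exp_has_derivative]) (auto intro!: derivative_eq_intros)
    show ?thesis using DERIV_mult[OF 1 2] by (simp add: f'_def algebra_simps)
  qed
  ultimately show ?case by blast
next
  case (add f g)
  then obtain f' g' where "f' \<in> bump_span c a b" "\<And>x. (f has_real_derivative f' x) (at x)"
    "g' \<in> bump_span c a b" "\<And>x. (g has_real_derivative g' x) (at x)" by blast
  then show ?case by (intro bexI[of _ "\<lambda>x. f' x + g' x"]) (auto intro: bump_span.add DERIV_add)
next
  case (scale f r)
  then obtain f' where "f' \<in> bump_span c a b" "\<And>x. (f has_real_derivative f' x) (at x)" by blast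
  then show ?case by (intro bexI[of _ "\<lambda>x. r * f' x"]) (auto intro: bump_span.scale DERIV_cmult)
qed

text \<open>For c > 0 this is a sharpness parameter: the support stays within [a, b], and as c grows
  the bump tends to the indicator of the open interval.\<close>

definition bump :: "real \<Rightarrow> real \<Rightarrow> real \<Rightarrow> real \<Rightarrow> real" where
  "bump c a b x = flat_exp 0 (c * (x - a)) * flat_exp 0 (c * (b - x))"

lemma bump_test_fun:
  assumes "c > 0"
  shows "test_fun (bump c a b)"
proof -
  have "(deriv ^^ n) (bump c a b) \<in> bump_span c a b" for n
  proof (induction n)
    case 0
    show ?case using bump_span.prod[of 0 c a 0 b] by (simp add: bump_def[abs_def])
  next
    case (Suc n)
    then obtain f' where f': "f' \<in> bump_span c a b" "\<And>x. ((deriv ^^ n) (bump c a b) has_real_derivative f' x) (at x)"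
      using bump_span_derivative by blast
    then have "deriv ((deriv ^^ n) (bump c a b)) = f'" by (auto intro: DERIV_imp_deriv)
    then show ?case using f' by simp
  qed
  then have "(deriv ^^ n) (bump c a b) differentiable (at x)" for n x
    using bump_span_derivative real_differentiable_def by blast
  moreover have "{x. bump c a b x \<noteq> 0} \<subseteq> {a..b}"
    using assms by (auto simp: bump_def flat_exp_def mult_le_0_iff not_le)
  then have "bounded {x. bump c a b x \<noteq> 0}" using bounded_closed_interval bounded_subset by blast
  ultimately show ?thesis unfolding test_fun_def by blast
qed

lemma bump_bounds: "0 \<le> bump c a b x" "bump c a b x \<le> 1"
proof -
  have "0 \<le> flat_exp 0 y \<and> flat_exp 0 y \<le> 1" for y by (auto simp: flat_exp_def)
  then show "0 \<le> bump c a b x" "bump c a b x \<le> 1" unfolding bump_def by (auto intro: mult_le_one)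
qed

lemma bump_eq_0: "c > 0 \<Longrightarrow> x \<notin> {a<..<b} \<Longrightarrow> bump c a b x = 0"
  by (auto simp: bump_def flat_exp_def mult_le_0_iff not_less)

lemma bump_tendsto_indicator: "(\<lambda>n. bump (real (Suc n)) a b x) \<longlonglongrightarrow> indicator {a<..<b} x"
proof (cases "x \<in> {a<..<b}")
  case True
  have *: "(\<lambda>n. flat_exp 0 (real (Suc n) * y)) \<longlonglongrightarrow> 1" if "y > 0" for y
  proof -
    have "(\<lambda>n. exp (- ((1 / real (Suc n)) * (1 / y)))) \<longlonglongrightarrow> exp (- (0 * (1 / y)))"
      using LIMSEQ_Suc[OF lim_1_over_n[where 'a=real]] by (intro tendsto_intros) auto
    then show ?thesis using that by (simp add: flat_exp_def mult_le_0_iff)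
  qed
  have "(\<lambda>n. bump (real (Suc n)) a b x) \<longlonglongrightarrow> 1 * 1"
    unfolding bump_def using True by (intro tendsto_mult *) auto
  then show ?thesis using True by simp
next
  case False
  then show ?thesis using bump_eq_0[of "real (Suc n)" x a b for n] by (simp del: of_nat_Suc)
qed

text \<open>The densities \<open>max 0 (e y)\<close> and \<open>max 0 (- e y)\<close> define
  measures that are finite and equal on all half-lines, hence equal. So the positive and negative
  parts of e coincide almost everywhere, and at each point one of them is 0.\<close>

lemma AE_zero_of_tail_integrals:
  fixes e :: "real \<Rightarrow> real"
  assumes e: "integrable lborel e" and z: "\<And>x. (LINT y|lborel. indicator {x<..} y * e y) = 0"
  shows "AE x in lborel. e x = 0"
proof -
  have [measurable]: "e \<in> borel_measurable borel" using e by auto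
  have ep: "integrable lborel (\<lambda>y. max 0 (e y))" "integrable lborel (\<lambda>y. max 0 (- e y))"
    using e by auto
  have i: "integrable lborel (\<lambda>y. indicator {x<..} y * max 0 (e y))" "integrable lborel (\<lambda>y. indicator {x<..} y * max 0 (- e y))" for x
    using integrable_mult_indicator[OF _ ep(1), of "{x<..}"] integrable_mult_indicator[OF _ ep(2), of "{x<..}"] by auto
  have em: "emeasure (density lborel (\<lambda>y. ennreal (max 0 (g y)))) {x<..} = ennreal (LINT y|lborel. indicator {x<..} y * max 0 (g y))"
    if [measurable]: "g \<in> borel_measurable borel" and "integrable lborel (\<lambda>y. indicator {x<..} y * max 0 (g y))" for g and x :: real
    using that by (subst emeasure_density, simp, simp, subst nn_integral_eq_integral[symmetric])
      (auto simp: ennreal_mult'' ennreal_indicator mult.commute)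
  have "density lborel (\<lambda>y. ennreal (max 0 (e y))) = density lborel (\<lambda>y. ennreal (max 0 (- e y)))"
  proof (rule measure_eqI_lessThan)
    fix x :: real
    show "emeasure (density lborel (\<lambda>y. ennreal (max 0 (e y)))) {x<..} < \<infinity>"
      using em[OF _ i(1)] by simp
    have "(LINT y|lborel. indicator {x<..} y * max 0 (e y)) - (LINT y|lborel. indicator {x<..} y * max 0 (- e y))
       = (LINT y|lborel. indicator {x<..} y * max 0 (e y) - indicator {x<..} y * max 0 (- e y))"
      using i by simp
    also have "\<dots> = (LINT y|lborel. indicator {x<..} y * e y)"
      by (intro Bochner_Integration.integral_cong) (auto simp: max_def indicator_def)
    finally show "emeasure (density lborel (\<lambda>y. ennreal (max 0 (e y)))) {x<..} = emeasure (density lborel (\<lambda>y. ennreal (max 0 (- e y)))) {x<..}"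
      using z em[OF _ i(1)] em[OF _ i(2)] by simp
  qed auto
  then have "AE y in lborel. ennreal (max 0 (e y)) = ennreal (max 0 (- e y))"
    by (subst (asm) sigma_finite_measure.density_unique_iff[OF lborel.sigma_finite_measure_axioms]) auto
  then show ?thesis by eventually_elim (auto simp: max_def split: if_splits)
qed

text \<open>The fundamental lemma of the calculus of variations. A wide bump bounded below gives
  integrability of d on intervals, sharpening bumps give zero integrals over intervals, and tail
  integrals of the cut-off real and imaginary parts reduce to these.\<close>

lemma AE_zero_of_test_integrals:
  fixes d :: "real \<Rightarrow> complex"
  assumes dm: "d \<in> borel_measurable lebesgue"
    and di: "\<And>\<psi>. test_fun \<psi> \<Longrightarrow> integrable lebesgue (\<lambda>x. d x * of_real (\<psi> x))"
    and dz: "\<And>\<psi>. test_fun \<psi> \<Longrightarrow> (LINT x|lebesgue. d x * of_real (\<psi> x)) = 0"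
  shows "AE x in lebesgue. d x = 0"
proof -
  have loc: "integrable lebesgue (\<lambda>x. indicator {a<..<b} x *\<^sub>R d x)"
    and zero: "(LINT x|lebesgue. indicator {a<..<b} x *\<^sub>R d x) = 0" for a b :: real
  proof -
    \<comment> \<open>Widened by 1 on each side so that both arguments of \<open>flat_exp 0\<close>
      are at least 1 on \<open>{a<..<b}\<close>, where the bump is then at least the square of
      \<open>exp (-1)\<close>.\<close>
    let ?\<psi> = "bump 1 (a - 1) (b + 1)"
    define m where "m = (exp (-1::real))\<^sup>2"
    have m: "m > 0" by (simp add: m_def)
    have "flat_exp 0 y \<ge> exp (-1)" if "y \<ge> 1" for y using that by (simp add: flat_exp_def)
    then have \<psi>: "?\<psi> x \<ge> m" if "x \<in> {a<..<b}" for x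
      using that unfolding m_def power2_eq_square bump_def by (intro mult_mono) (auto simp: flat_exp_def)
    show i: "integrable lebesgue (\<lambda>x. indicator {a<..<b} x *\<^sub>R d x)"
    proof (rule Bochner_Integration.integrable_bound[where f="\<lambda>x. (1 / m) *\<^sub>R (d x * of_real (?\<psi> x))"])
      show "integrable lebesgue (\<lambda>x. (1 / m) *\<^sub>R (d x * of_real (?\<psi> x)))"
        by (intro integrable_scaleR_right di bump_test_fun) simp
      show "(\<lambda>x. indicator {a<..<b} x *\<^sub>R d x) \<in> borel_measurable lebesgue"
        using dm by (intro borel_measurable_scaleR borel_measurable_indicator) auto
      have "norm (indicator {a<..<b} x *\<^sub>R d x) \<le> norm ((1 / m) *\<^sub>R (d x * of_real (?\<psi> x)))" for x
      proof (cases "x \<in> {a<..<b}")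
        case True
        then have "1 \<le> ?\<psi> x / m" using \<psi> m by (simp add: pos_le_divide_eq)
        from mult_left_mono[OF this norm_ge_zero[of "d x"]] show ?thesis
          using True m bump_bounds(1)[of 1 "a - 1" "b + 1" x] by (simp add: norm_mult)
      qed simp
      then show "AE x in lebesgue. norm (indicator {a<..<b} x *\<^sub>R d x) \<le> norm ((1 / m) *\<^sub>R (d x * of_real (?\<psi> x)))" by simp
    qed
    have "(\<lambda>n. LINT x|lebesgue. d x * of_real (bump (real (Suc n)) a b x)) \<longlonglongrightarrow> (LINT x|lebesgue. indicator {a<..<b} x *\<^sub>R d x)"
    proof (rule integral_dominated_convergence[where w="\<lambda>x. norm (indicator {a<..<b} x *\<^sub>R d x)"])
      show "(\<lambda>x. d x * of_real (bump (real (Suc n)) a b x)) \<in> borel_measurable lebesgue" for n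
        using di[OF bump_test_fun, of "real (Suc n)" a b] by auto
      show "AE x in lebesgue. (\<lambda>n. d x * of_real (bump (real (Suc n)) a b x)) \<longlonglongrightarrow> indicator {a<..<b} x *\<^sub>R d x"
      proof (intro always_eventually allI)
        fix x
        have "(\<lambda>n. d x * of_real (bump (real (Suc n)) a b x)) \<longlonglongrightarrow> d x * of_real (indicator {a<..<b} x)"
          by (intro tendsto_intros bump_tendsto_indicator)
        then show "(\<lambda>n. d x * of_real (bump (real (Suc n)) a b x)) \<longlonglongrightarrow> indicator {a<..<b} x *\<^sub>R d x"
          by (simp only: scaleR_conv_of_real mult.commute)
      qed
      show "AE x in lebesgue. norm (d x * of_real (bump (real (Suc n)) a b x)) \<le> norm (indicator {a<..<b} x *\<^sub>R d x)" for n
      proof (intro always_eventually allI)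
        fix x
        show "norm (d x * of_real (bump (real (Suc n)) a b x)) \<le> norm (indicator {a<..<b} x *\<^sub>R d x)"
          using bump_eq_0[of "real (Suc n)" x a b] bump_bounds[of "real (Suc n)" a b x]
          by (cases "x \<in> {a<..<b}") (auto simp: norm_mult intro: mult_left_le simp del: of_nat_Suc)
      qed
      show "integrable lebesgue (\<lambda>x. norm (indicator {a<..<b} x *\<^sub>R d x))" using i by (rule integrable_norm)
    qed (use i in auto)
    moreover have "(LINT x|lebesgue. d x * of_real (bump (real (Suc n)) a b x)) = 0" for n
      by (intro dz bump_test_fun) simp
    ultimately show "(LINT x|lebesgue. indicator {a<..<b} x *\<^sub>R d x) = 0"
      by (simp add: LIMSEQ_const_iff)
  qed
  have AEz: "AE x in lborel. indicator {-real N<..<real N} x * p (d x) = 0"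
    if p: "bounded_linear p" for N and p :: "complex \<Rightarrow> real"
  proof -
    interpret p: bounded_linear p by (rule p)
    let ?e = "\<lambda>x. indicator {-real N<..<real N} x * p (d x)"
    have eq: "?e = (\<lambda>x. p (indicator {-real N<..<real N} x *\<^sub>R d x))" by (simp add: p.scaleR)
    have ei: "integrable lebesgue ?e" unfolding eq by (rule integrable_bounded_linear[OF p loc])
    \<comment> \<open>The tail lemma works over \<open>lborel\<close>, so the Lebesgue measurable
      function is replaced by a Borel one equal to it almost everywhere.\<close>
    obtain e' where e': "e' \<in> borel_measurable lborel" "AE x in lborel. ?e x = e' x"
      using completion_ex_borel_measurable_real[of ?e lborel] ei by auto
    have ae: "AE x in lebesgue. ?e x = e' x" using e'(2) by (rule AE_completion)
    have ml: "e' \<in> borel_measurable lebesgue" using e'(1) by (rule measurable_completion)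
    have "integrable lebesgue e'" using ei integrable_cong_AE[OF _ ml ae] by auto
    then have e'i: "integrable lborel e'" using e'(1) by (simp add: integrable_completion)
    have "AE x in lborel. e' x = 0"
    proof (rule AE_zero_of_tail_integrals[OF e'i])
      fix x :: real
      have "(LINT y|lborel. indicator {x<..} y * e' y) = (LINT y|lebesgue. indicator {x<..} y * e' y)"
        using e'(1) by (intro integral_completion[symmetric]) auto
      also have "\<dots> = (LINT y|lebesgue. indicator {x<..} y * ?e y)"
      proof (rule integral_cong_AE)
        show "(\<lambda>y. indicator {x<..} y * ?e y) \<in> borel_measurable lebesgue"
          by (rule borel_measurable_times[OF borel_measurable_indicator borel_measurable_integrable[OF ei]]) auto
        show "(\<lambda>y. indicator {x<..} y * e' y) \<in> borel_measurable lebesgue"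
          by (rule borel_measurable_times[OF borel_measurable_indicator ml]) auto
      qed (use ae in auto)
      also have "\<dots> = (LINT y|lebesgue. p (indicator {max x (- real N)<..<real N} y *\<^sub>R d y))"
        by (intro Bochner_Integration.integral_cong) (auto simp: p.scaleR indicator_def)
      also have "\<dots> = 0"
        using integral_bounded_linear[OF p loc] zero by (simp add: p.zero)
      finally show "(LINT y|lborel. indicator {x<..} y * e' y) = 0" .
    qed
    with e'(2) show ?thesis by eventually_elim simp
  qed
  have "AE x in lborel. \<forall>N. indicator {-real N<..<real N} x * Re (d x) = 0 \<and> indicator {-real N<..<real N} x * Im (d x) = 0"
    unfolding AE_all_countable using AEz[OF bounded_linear_Re] AEz[OF bounded_linear_Im] by auto
  then have "AE x in lborel. d x = 0"
  proof eventually_elim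
    fix x assume *: "\<forall>N. indicator {-real N<..<real N} x * Re (d x) = 0 \<and> indicator {-real N<..<real N} x * Im (d x) = 0"
    obtain N where "\<bar>x\<bar> < real N" using reals_Archimedean2 by blast
    then have "x \<in> {-real N<..<real N}" by auto
    with *[rule_format, of N] show "d x = 0" by (simp add: complex_eq_iff)
  qed
  then show ?thesis by (rule AE_completion)
qed

lemma is_fourier_unique:
  assumes "is_fourier f g" "is_fourier f h"
  shows "AE \<xi> in lebesgue. g \<xi> = h \<xi>"
proof -
  have "AE \<xi> in lebesgue. g \<xi> - h \<xi> = 0"
    by (rule AE_zero_of_test_integrals)
      (use assms in \<open>auto simp: is_fourier_def left_diff_distrib\<close>)
  then show ?thesis by simp
qed

text \<open>\<open>fourierL2\<close> is an arbitrary choice among all distributional transforms;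
  their almost everywhere uniqueness makes the norm computable from any one of them.\<close>

lemma H12_norm_eq:
  assumes g: "is_fourier f g"
  shows "H12_norm f = sqrt (LINT \<xi>|lebesgue. sqrt (1 + \<xi>\<^sup>2) * (cmod (g \<xi>))\<^sup>2)"
proof -
  have F: "is_fourier f (fourierL2 f)" unfolding fourierL2_def using someI[of "is_fourier f", OF g] .
  then have m: "fourierL2 f \<in> borel_measurable lebesgue" "g \<in> borel_measurable lebesgue"
    using g by (auto simp: is_fourier_def)
  have "(LINT \<xi>|lebesgue. sqrt (1 + \<xi>\<^sup>2) * (cmod (fourierL2 f \<xi>))\<^sup>2) = (LINT \<xi>|lebesgue. sqrt (1 + \<xi>\<^sup>2) * (cmod (g \<xi>))\<^sup>2)"
  proof (rule integral_cong_AE)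
    have [measurable]: "(\<lambda>\<xi>. sqrt (1 + \<xi>\<^sup>2)) \<in> borel_measurable lebesgue" by (intro measurable_completion) simp
    show "(\<lambda>\<xi>. sqrt (1 + \<xi>\<^sup>2) * (cmod (fourierL2 f \<xi>))\<^sup>2) \<in> borel_measurable lebesgue"
      "(\<lambda>\<xi>. sqrt (1 + \<xi>\<^sup>2) * (cmod (g \<xi>))\<^sup>2) \<in> borel_measurable lebesgue" using m by measurable
    show "AE \<xi> in lebesgue. sqrt (1 + \<xi>\<^sup>2) * (cmod (fourierL2 f \<xi>))\<^sup>2 = sqrt (1 + \<xi>\<^sup>2) * (cmod (g \<xi>))\<^sup>2"
      using is_fourier_unique[OF F g] by eventually_elim simp
  qed
  then show ?thesis by (simp add: H12_norm_def)
qed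

section \<open>The resolvent of |D|\<close>

text \<open>\<open>res_kernel\<close> is the convolution kernel of \<open>(1 + |D|)\<^sup>-\<^sup>1\<close>, written as a superposition of Poisson kernels through
  \<open>1 / (1 + |\<xi>|) = \<integral>\<^sub>0\<^sup>\<infinity> e\<^sup>-\<^sup>s e\<^sup>-\<^sup>s\<^sup>|\<^sup>\<xi>\<^sup>| ds\<close>; its value at 0 is infinite.\<close>

definition res_kernel :: "real \<Rightarrow> ennreal" where
  "res_kernel x = (\<integral>\<^sup>+s. indicator {0<..} s * ennreal (exp (- s) * poisson s x) \<partial>lborel)"

text \<open>Values in \<open>ennreal\<close> let Tonelli and monotonicity apply without
  integrability conditions and accommodate the infinite kernel value at 0.\<close>

definition resolvent :: "(real \<Rightarrow> ennreal) \<Rightarrow> real \<Rightarrow> ennreal" where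
  "resolvent f x = (\<integral>\<^sup>+y. res_kernel (x - y) * f y \<partial>lborel)"

lemma res_kernel_measurable [measurable]: "res_kernel \<in> borel_measurable borel"
  unfolding res_kernel_def[abs_def] by measurable

lemma resolvent_measurable [measurable]:
  assumes [measurable]: "f \<in> borel_measurable borel"
  shows "resolvent f \<in> borel_measurable borel"
  unfolding resolvent_def[abs_def] by measurable

lemma poisson_minus: "poisson s (- x) = poisson s x"
  by (simp add: poisson_def)

lemma res_kernel_minus: "res_kernel (- x) = res_kernel x"
  by (simp add: res_kernel_def poisson_minus)

lemma res_kernel_commute: "res_kernel (x - y) = res_kernel (y - x)"
  using res_kernel_minus[of "x - y"] by simp

lemma res_kernel_antimono:
  assumes "\<bar>x\<bar> \<le> \<bar>y\<bar>"
  shows "res_kernel y \<le> res_kernel x"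
  unfolding res_kernel_def
proof (intro nn_integral_mono)
  fix s :: real
  have "x\<^sup>2 \<le> y\<^sup>2" using assms by (simp add: abs_le_square_iff)
  then have "s > 0 \<Longrightarrow> poisson s y \<le> poisson s x"
    unfolding poisson_def by (intro divide_right_mono divide_left_mono) (auto intro!: mult_pos_pos add_pos_nonneg)
  then show "indicator {0<..} s * ennreal (exp (- s) * poisson s y) \<le> indicator {0<..} s * ennreal (exp (- s) * poisson s x)"
    by (auto simp: indicator_def intro!: ennreal_leI)
qed

lemma nn_integral_Gamma:
  assumes "p > 0"
  shows "(\<integral>\<^sup>+s. indicator {0<..} s * ennreal (exp (- s) * s powr (p - 1)) \<partial>lborel) = ennreal (Gamma p)"
proof -
  have "ennreal (indicator {0..} s * s powr (p - 1) / exp s) = indicator {0<..} s * ennreal (exp (- s) * s powr (p - 1))" for s :: real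
    by (cases s "0::real" rule: linorder_cases) (auto simp: exp_minus field_simps)
  then show ?thesis using Gamma_conv_nn_integral_real[OF assms] by simp
qed

lemma nn_integral_exp: "(\<integral>\<^sup>+s. indicator {0<..} s * ennreal (exp (- s)) \<partial>lborel) = 1"
proof -
  have "(\<integral>\<^sup>+s. indicator {0<..} s * ennreal (exp (- s) * s powr (1 - 1)) \<partial>lborel) = (\<integral>\<^sup>+s. indicator {0<..} s * ennreal (exp (- s)) \<partial>lborel)"
    by (intro nn_integral_cong) (auto simp: indicator_def)
  then show ?thesis using nn_integral_Gamma[of 1] by simp
qed

lemma nn_integral_poisson: "s > 0 \<Longrightarrow> (\<integral>\<^sup>+x. ennreal (poisson s x) \<partial>lborel) = 1"
  using poisson_has_integral[of s] by (subst nn_integral_eq_integral) (auto simp: has_bochner_integral_iff poisson_nonneg)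

lemma nn_integral_res_kernel_mult:
  assumes [measurable]: "g \<in> borel_measurable borel"
  shows "(\<integral>\<^sup>+x. res_kernel x * g x \<partial>lborel)
    = (\<integral>\<^sup>+s. indicator {0<..} s * (ennreal (exp (- s)) * (\<integral>\<^sup>+x. ennreal (poisson s x) * g x \<partial>lborel)) \<partial>lborel)"
proof -
  have "(\<integral>\<^sup>+x. res_kernel x * g x \<partial>lborel)
      = (\<integral>\<^sup>+x. \<integral>\<^sup>+s. indicator {0<..} s * ennreal (exp (- s) * poisson s x) * g x \<partial>lborel \<partial>lborel)"
    unfolding res_kernel_def by (subst nn_integral_multc[symmetric]) auto
  also have "\<dots> = (\<integral>\<^sup>+s. \<integral>\<^sup>+x. indicator {0<..} s * ennreal (exp (- s) * poisson s x) * g x \<partial>lborel \<partial>lborel)"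
    by (rule lborel_pair.Fubini') measurable
  also have "\<dots> = (\<integral>\<^sup>+s. indicator {0<..} s * (ennreal (exp (- s)) * (\<integral>\<^sup>+x. ennreal (poisson s x) * g x \<partial>lborel)) \<partial>lborel)"
  proof (intro nn_integral_cong)
    fix s :: real
    show "(\<integral>\<^sup>+x. indicator {0<..} s * ennreal (exp (- s) * poisson s x) * g x \<partial>lborel)
       = indicator {0<..} s * (ennreal (exp (- s)) * (\<integral>\<^sup>+x. ennreal (poisson s x) * g x \<partial>lborel))"
      by (subst nn_integral_cmult[symmetric], simp)+ (auto intro!: nn_integral_cong simp: indicator_def ennreal_mult poisson_nonneg mult.assoc)
  qed
  finally show ?thesis .
qed

lemma nn_integral_res_kernel: "(\<integral>\<^sup>+x. res_kernel x \<partial>lborel) = 1"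
proof -
  have "(\<integral>\<^sup>+x. res_kernel x \<partial>lborel) = (\<integral>\<^sup>+s. indicator {0<..} s * (ennreal (exp (- s)) * (\<integral>\<^sup>+x. ennreal (poisson s x) * 1 \<partial>lborel)) \<partial>lborel)"
    using nn_integral_res_kernel_mult[of "\<lambda>_. 1"] by simp
  also have "\<dots> = (\<integral>\<^sup>+s. indicator {0<..} s * ennreal (exp (- s)) \<partial>lborel)"
    by (intro nn_integral_cong) (auto simp: indicator_def nn_integral_poisson)
  finally show ?thesis by (simp add: nn_integral_exp)
qed

text \<open>By monotonicity the kernel is at least its value at x on an interval of length |x|,
  while its total mass is 1.\<close>

lemma res_kernel_finite:
  assumes "x \<noteq> 0"
  shows "res_kernel x < \<infinity>"
proof -
  have "res_kernel x * ennreal \<bar>x\<bar> = (\<integral>\<^sup>+y. res_kernel x * indicator {0<..\<bar>x\<bar>} y \<partial>lborel)"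
    by (subst nn_integral_cmult) auto
  also have "\<dots> \<le> (\<integral>\<^sup>+y. res_kernel y \<partial>lborel)"
    by (intro nn_integral_mono) (auto simp: indicator_def intro!: res_kernel_antimono)
  finally have "res_kernel x * ennreal \<bar>x\<bar> \<le> 1" by (simp add: nn_integral_res_kernel)
  then show ?thesis
    using assms by (cases "res_kernel x") (auto simp: ennreal_top_mult top_unique)
qed

lemma nn_integral_res_kernel_shift: "(\<integral>\<^sup>+y. res_kernel (x - y) \<partial>lborel) = 1"
  using nn_integral_real_affine[of res_kernel "-1" x] by (simp add: nn_integral_res_kernel)

lemma resolvent_mono: "(\<And>x. f x \<le> g x) \<Longrightarrow> resolvent f x \<le> resolvent g x"
  unfolding resolvent_def by (intro nn_integral_mono mult_left_mono) auto

lemma resolvent_mono_AE: "(AE x in lborel. f x \<le> g x) \<Longrightarrow> resolvent f x \<le> resolvent g x"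
  unfolding resolvent_def by (intro nn_integral_mono_AE) (auto elim!: eventually_mono intro: mult_left_mono)

lemma resolvent_cong_AE: "(AE x in lborel. f x = g x) \<Longrightarrow> resolvent f x = resolvent g x"
  unfolding resolvent_def by (intro nn_integral_cong_AE) auto

lemma resolvent_add:
  assumes [measurable]: "f \<in> borel_measurable borel" "g \<in> borel_measurable borel"
  shows "resolvent (\<lambda>x. f x + g x) x = resolvent f x + resolvent g x"
  unfolding resolvent_def by (simp add: distrib_left nn_integral_add)

lemma resolvent_cmult:
  assumes [measurable]: "f \<in> borel_measurable borel"
  shows "resolvent (\<lambda>x. c * f x) x = c * resolvent f x"
  unfolding resolvent_def by (simp add: mult.left_commute nn_integral_cmult)

lemma nn_integral_mult_resolvent:
  assumes [measurable]: "f \<in> borel_measurable borel" "g \<in> borel_measurable borel"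
  shows "(\<integral>\<^sup>+x. f x * resolvent g x \<partial>lborel) = (\<integral>\<^sup>+x. g x * resolvent f x \<partial>lborel)"
proof -
  have "(\<integral>\<^sup>+x. f x * resolvent g x \<partial>lborel) = (\<integral>\<^sup>+x. \<integral>\<^sup>+y. f x * (res_kernel (x - y) * g y) \<partial>lborel \<partial>lborel)"
    unfolding resolvent_def by (simp add: nn_integral_cmult)
  also have "\<dots> = (\<integral>\<^sup>+y. \<integral>\<^sup>+x. f x * (res_kernel (x - y) * g y) \<partial>lborel \<partial>lborel)"
    by (rule lborel_pair.Fubini') measurable
  also have "\<dots> = (\<integral>\<^sup>+y. \<integral>\<^sup>+x. g y * (res_kernel (y - x) * f x) \<partial>lborel \<partial>lborel)"
    by (simp only: res_kernel_commute[of x y for x y] mult.commute mult.left_commute)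
  also have "\<dots> = (\<integral>\<^sup>+x. g x * resolvent f x \<partial>lborel)"
    unfolding resolvent_def by (simp add: nn_integral_cmult)
  finally show ?thesis .
qed

text \<open>Symmetry against the constant 1, which the resolvent fixes.\<close>

lemma nn_integral_resolvent:
  assumes [measurable]: "g \<in> borel_measurable borel"
  shows "(\<integral>\<^sup>+x. resolvent g x \<partial>lborel) = (\<integral>\<^sup>+x. g x \<partial>lborel)"
proof -
  have "resolvent (\<lambda>_. 1) x = 1" for x by (simp add: resolvent_def nn_integral_res_kernel_shift)
  then show ?thesis using nn_integral_mult_resolvent[of "\<lambda>_. 1" g] by simp
qed

text \<open>Two-point rearrangement. Additive differences \<open>a'\<close> and \<open>c'\<close>
  take the place of subtraction, and the two sides differ by \<open>a' * c'\<close>.\<close>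

lemma ennreal_rearrangement:
  fixes a b c d :: ennreal
  assumes "b \<le> a" "d \<le> c"
  shows "a * d + b * c \<le> a * c + b * d"
proof -
  obtain a' c' where "a = b + a'" "c = d + c'" using assms by (auto simp: le_iff_add)
  then show ?thesis by (simp add: algebra_simps)
qed

lemma resolvent_reflect:
  assumes [measurable]: "f \<in> borel_measurable borel" and even: "\<And>y. f (- y) = f y"
  shows "resolvent f (- x) = resolvent f x"
proof -
  have "resolvent f (- x) = (\<integral>\<^sup>+y. res_kernel (- x - - y) * f (- y) \<partial>lborel)"
    unfolding resolvent_def
    using nn_integral_real_affine[of "\<lambda>y. res_kernel (- x - y) * f y" "-1" 0] by simp
  then show ?thesis using res_kernel_minus[of "x - y" for y] by (simp add: resolvent_def even)
qed

text \<open>The comparison reflects the integral at the midpoint of \<open>x\<close> and \<open>y\<close>, which exchanges the two kernels.\<close>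

lemma resolvent_antimono:
  assumes [measurable]: "f \<in> borel_measurable borel"
    and dec: "\<And>x y. x \<noteq> 0 \<Longrightarrow> \<bar>x\<bar> \<le> \<bar>y\<bar> \<Longrightarrow> f y \<le> f x"
    and "\<bar>x\<bar> \<le> \<bar>y\<bar>"
  shows "resolvent f y \<le> resolvent f x"
proof -
  have even: "f (- z) = f z" for z
    using dec[of z "- z"] dec[of "- z" z] by (cases "z = 0") auto
  have abs: "resolvent f \<bar>z\<bar> = resolvent f z" for z
    using resolvent_reflect[of f, OF _ even, of z] by (auto simp: abs_if)
  define u v m where "u = \<bar>x\<bar>" and "v = \<bar>y\<bar>" and "m = (u + v) / 2"
  have uv: "0 \<le> u" "u \<le> v" using assms by (auto simp: u_def v_def)
  have refl: "(\<integral>\<^sup>+z. indicator {m<..} z * (res_kernel (w - z) * f z) \<partial>lborel)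
      = (\<integral>\<^sup>+z. indicator {..<m} z * (res_kernel (2 * m - w - z) * f (2 * m - z)) \<partial>lborel)" for w
  proof -
    have "res_kernel (w - (2 * m - z)) = res_kernel (2 * m - w - z)" for z
      using res_kernel_minus[of "2 * m - w - z"] by (simp add: algebra_simps)
    moreover have "indicator {m<..} (2 * m - z) = (indicator {..<m} z :: ennreal)" for z
      by (auto simp: indicator_def)
    ultimately show ?thesis
      by (subst nn_integral_real_affine[where c="-1" and t="2 * m"]) auto
  qed
  have split: "resolvent f w = (\<integral>\<^sup>+z. indicator {..<m} z * (res_kernel (w - z) * f z + res_kernel (2 * m - w - z) * f (2 * m - z)) \<partial>lborel)" for w
  proof -
    have "resolvent f w = (\<integral>\<^sup>+z. indicator {..<m} z * (res_kernel (w - z) * f z) + indicator {m<..} z * (res_kernel (w - z) * f z) \<partial>lborel)"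
      unfolding resolvent_def
    proof (rule nn_integral_cong_AE)
      have "AE z in lborel. z \<noteq> m" by (rule AE_lborel_singleton)
      then show "AE z in lborel. res_kernel (w - z) * f z = indicator {..<m} z * (res_kernel (w - z) * f z) + indicator {m<..} z * (res_kernel (w - z) * f z)"
        by eventually_elim (auto simp: indicator_def)
    qed
    also have "\<dots> = (\<integral>\<^sup>+z. indicator {..<m} z * (res_kernel (w - z) * f z) \<partial>lborel) + (\<integral>\<^sup>+z. indicator {m<..} z * (res_kernel (w - z) * f z) \<partial>lborel)"
      by (rule nn_integral_add) measurable
    also have "\<dots> = (\<integral>\<^sup>+z. indicator {..<m} z * (res_kernel (w - z) * f z) + indicator {..<m} z * (res_kernel (2 * m - w - z) * f (2 * m - z)) \<partial>lborel)"
      unfolding refl by (rule nn_integral_add[symmetric]) measurable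
    finally show ?thesis by (simp add: distrib_left)
  qed
  have "resolvent f v \<le> resolvent f u"
    unfolding split[of v] split[of u]
  proof (rule nn_integral_mono_AE)
    \<comment> \<open>\<open>dec\<close> does not compare the value at 0 with the others, so that
      point is discarded.\<close>
    have "AE z in lborel. z \<noteq> (0::real)" by (rule AE_lborel_singleton)
    then show "AE z in lborel. indicator {..<m} z * (res_kernel (v - z) * f z + res_kernel (2 * m - v - z) * f (2 * m - z))
        \<le> indicator {..<m} z * (res_kernel (u - z) * f z + res_kernel (2 * m - u - z) * f (2 * m - z))"
    proof eventually_elim
      fix z :: real assume z: "z \<noteq> 0"
      show "indicator {..<m} z * (res_kernel (v - z) * f z + res_kernel (2 * m - v - z) * f (2 * m - z))
        \<le> indicator {..<m} z * (res_kernel (u - z) * f z + res_kernel (2 * m - u - z) * f (2 * m - z))"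
      proof (cases "z < m")
        case True
        \<comment> \<open>Reflection swaps u and v, so left of m both integrands contain the same
          two kernel values, paired with \<open>f z\<close> and \<open>f (2 * m - z)\<close> in
          opposite orders.\<close>
        have m2: "2 * m - v = u" "2 * m - u = v" by (simp_all add: m_def add_divide_distrib)
        have "\<bar>u - z\<bar> \<le> \<bar>v - z\<bar>" using True uv by (auto simp: m_def)
        then have "res_kernel (v - z) \<le> res_kernel (u - z)" by (rule res_kernel_antimono)
        moreover have "\<bar>z\<bar> \<le> \<bar>2 * m - z\<bar>" using True uv m2 by linarith
        then have "f (2 * m - z) \<le> f z" using z dec by blast
        ultimately have "res_kernel (u - z) * f (2 * m - z) + res_kernel (v - z) * f z
            \<le> res_kernel (u - z) * f z + res_kernel (v - z) * f (2 * m - z)"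
          by (rule ennreal_rearrangement)
        then show ?thesis using True by (simp add: m2 add.commute)
      qed simp
    qed
  qed
  then show ?thesis by (simp add: u_def v_def abs)
qed

text \<open>\<open>2 * a * f y \<le> a^2 + (f y)^2\<close> averaged against the resolvent kernel, a
  probability density. It takes the place of Cauchy-Schwarz in the L^2 estimates below.\<close>

lemma resolvent_young:
  fixes f :: "real \<Rightarrow> real"
  assumes [measurable]: "f \<in> borel_measurable borel" and f: "\<And>x. 0 \<le> f x" and a: "0 \<le> a"
  shows "2 * (ennreal a * resolvent (\<lambda>y. ennreal (f y)) x) \<le> ennreal (a\<^sup>2) + resolvent (\<lambda>y. ennreal ((f y)\<^sup>2)) x"
proof -
  have "2 * (ennreal a * resolvent (\<lambda>y. ennreal (f y)) x) = resolvent (\<lambda>y. ennreal (2 * a) * ennreal (f y)) x"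
    using a by (subst resolvent_cmult) (auto simp: ennreal_mult mult.assoc)
  also have "\<dots> \<le> resolvent (\<lambda>y. ennreal (a\<^sup>2) + ennreal ((f y)\<^sup>2)) x"
    using a f sum_squares_bound[of a "f y" for y]
    by (intro resolvent_mono) (auto simp: ennreal_mult[symmetric] ennreal_plus[symmetric] simp del: ennreal_plus intro!: ennreal_leI)
  also have "\<dots> = resolvent (\<lambda>y. ennreal (a\<^sup>2)) x + resolvent (\<lambda>y. ennreal ((f y)\<^sup>2)) x"
    by (rule resolvent_add) auto
  also have "resolvent (\<lambda>y. ennreal (a\<^sup>2)) x = ennreal (a\<^sup>2)"
    by (simp add: resolvent_def nn_integral_multc nn_integral_res_kernel_shift)
  finally show ?thesis .
qed

text \<open>If \<open>f \<ge> 0\<close> decreases in \<open>|x|\<close>, then \<open>|x| f(x)\<^sup>4\<^sup>/\<^sup>3 \<le> \<integral> f\<^sup>4\<^sup>/\<^sup>3\<close>; this bounds the unit ball pointwise.\<close>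

definition majorant :: "real \<Rightarrow> ennreal" where
  "majorant x = ennreal (\<bar>x\<bar> powr (- 3 / 4))"

lemma majorant_measurable [measurable]: "majorant \<in> borel_measurable borel"
  unfolding majorant_def[abs_def] by measurable

lemma majorant_antimono: "x \<noteq> 0 \<Longrightarrow> \<bar>x\<bar> \<le> \<bar>y\<bar> \<Longrightarrow> majorant y \<le> majorant x"
  unfolding majorant_def by (intro ennreal_leI powr_mono2') auto

lemma nn_integral_even_le:
  fixes f :: "real \<Rightarrow> ennreal"
  assumes [measurable]: "f \<in> borel_measurable borel" and even: "\<And>x. f (- x) = f x"
  shows "(\<integral>\<^sup>+x. f x \<partial>lborel) \<le> 2 * (\<integral>\<^sup>+x. indicator {0..} x * f x \<partial>lborel)"
proof -
  have "(\<integral>\<^sup>+x. f x \<partial>lborel) \<le> (\<integral>\<^sup>+x. indicator {0..} x * f x + indicator {0..} (- x) * f (- x) \<partial>lborel)"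
    by (intro nn_integral_mono) (auto simp: indicator_def even)
  also have "\<dots> = (\<integral>\<^sup>+x. indicator {0..} x * f x \<partial>lborel) + (\<integral>\<^sup>+x. indicator {0..} (- x) * f (- x) \<partial>lborel)"
    by (rule nn_integral_add) measurable
  also have "(\<integral>\<^sup>+x. indicator {0..} (- x) * f (- x) \<partial>lborel) = (\<integral>\<^sup>+x. indicator {0..} x * f x \<partial>lborel)"
    using nn_integral_real_affine[of "\<lambda>x. indicator {0..} x * f x" "-1" 0] by simp
  finally show ?thesis by (simp add: mult_2)
qed

lemma nn_integral_majorant_ball:
  assumes "s > 0"
  shows "(\<integral>\<^sup>+x. indicator {-s..s} x * majorant x \<partial>lborel) \<le> ennreal (8 * s powr (1 / 4))"
proof -
  have "(\<integral>\<^sup>+x. indicator {0..} x * (indicator {-s..s} x * majorant x) \<partial>lborel) = (\<integral>\<^sup>+x. ennreal (indicator {0..s} x * x powr (- 3 / 4)) \<partial>lborel)"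
    using assms by (intro nn_integral_cong) (auto simp: indicator_def majorant_def)
  \<comment> \<open>The integral over [0, s] is \<open>4 * s powr (1 / 4)\<close>; doubling it gives
    the 8.\<close>
  also have "\<dots> = ennreal (s powr (- 3 / 4 + 1) / (- 3 / 4 + 1))"
    by (rule nn_integral_has_integral_lebesgue[OF _ has_integral_powr_from_0]) (use assms in auto)
  also have "2 * \<dots> = ennreal (8 * s powr (1 / 4))"
    by (simp add: ennreal_mult[symmetric] flip: ennreal_numeral)
  finally show ?thesis
    using nn_integral_even_le[of "\<lambda>x. indicator {-s..s} x * majorant x"] by (force simp: indicator_def majorant_def)
qed

text \<open>For each s the Poisson average of the majorant is split at |x| = s: inside,
  \<open>poisson s\<close> is at most 1/(pi s); outside, the majorant is at most
  \<open>s powr (- 3 / 4)\<close>. Both parts are of size \<open>s powr (1 / 4 - 1)\<close>, and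
  integration against exp(-s) yields \<open>Gamma (1 / 4)\<close>.\<close>

lemma resolvent_majorant_finite: "resolvent majorant 0 < \<infinity>"
proof -
  have "resolvent majorant 0 = (\<integral>\<^sup>+y. res_kernel y * majorant y \<partial>lborel)"
    by (simp add: resolvent_def res_kernel_minus)
  also have "\<dots> = (\<integral>\<^sup>+s. indicator {0<..} s * (ennreal (exp (- s)) * (\<integral>\<^sup>+x. ennreal (poisson s x) * majorant x \<partial>lborel)) \<partial>lborel)"
    by (rule nn_integral_res_kernel_mult) measurable
  also have "\<dots> \<le> (\<integral>\<^sup>+s. ennreal (8 / pi + 1) * (indicator {0<..} s * ennreal (exp (- s) * s powr (1 / 4 - 1))) \<partial>lborel)"
  proof (rule nn_integral_mono)
    fix s :: real
    show "indicator {0<..} s * (ennreal (exp (- s)) * (\<integral>\<^sup>+x. ennreal (poisson s x) * majorant x \<partial>lborel))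
       \<le> ennreal (8 / pi + 1) * (indicator {0<..} s * ennreal (exp (- s) * s powr (1 / 4 - 1)))"
    proof (cases "s > 0")
      case True
      have pw: "ennreal (poisson s x) * majorant x \<le> ennreal (1 / (pi * s)) * (indicator {-s..s} x * majorant x) + ennreal (s powr (- 3 / 4)) * ennreal (poisson s x)" for x
      proof (cases "\<bar>x\<bar> \<le> s")
        case t: True
        then have "indicator {-s..s} x = (1::ennreal)" by (auto simp: indicator_def)
        then show ?thesis using poisson_le[OF True, of x] by (auto intro!: add_increasing2 mult_right_mono ennreal_leI)
      next
        case False
        then have "majorant x \<le> ennreal (s powr (- 3 / 4))"
          using majorant_antimono[of s x] True by (simp add: majorant_def)
        from mult_left_mono[OF this, of "ennreal (poisson s x)"] show ?thesis
          by (auto intro!: add_increasing simp: mult.commute)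
      qed
      have "(\<integral>\<^sup>+x. ennreal (poisson s x) * majorant x \<partial>lborel)
        \<le> (\<integral>\<^sup>+x. ennreal (1 / (pi * s)) * (indicator {-s..s} x * majorant x) + ennreal (s powr (- 3 / 4)) * ennreal (poisson s x) \<partial>lborel)"
        by (intro nn_integral_mono pw)
      also have "\<dots> = ennreal (1 / (pi * s)) * (\<integral>\<^sup>+x. indicator {-s..s} x * majorant x \<partial>lborel) + ennreal (s powr (- 3 / 4))"
        by (simp add: nn_integral_add nn_integral_cmult nn_integral_poisson True)
      also have "\<dots> \<le> ennreal (1 / (pi * s)) * ennreal (8 * s powr (1 / 4)) + ennreal (s powr (- 3 / 4))"
        by (intro add_right_mono mult_left_mono nn_integral_majorant_ball True) simp
      also have "\<dots> = ennreal ((8 / pi + 1) * s powr (1 / 4 - 1))"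
      proof -
        have "s powr (1 / 4 - 1) = s powr (1 / 4) / s" using True powr_diff[of s "1/4" 1] by simp
        then have "1 / (pi * s) * (8 * s powr (1 / 4)) + s powr (- 3 / 4) = (8 / pi + 1) * s powr (1 / 4 - 1)"
          using True by (simp add: field_simps)
        moreover have "ennreal (1 / (pi * s)) * ennreal (8 * s powr (1 / 4)) + ennreal (s powr (- 3 / 4))
            = ennreal (1 / (pi * s) * (8 * s powr (1 / 4)) + s powr (- 3 / 4))"
          using True by (subst ennreal_mult[symmetric], simp, simp, subst ennreal_plus[symmetric]) auto
        ultimately show ?thesis by simp
      qed
      finally have "ennreal (exp (- s)) * (\<integral>\<^sup>+x. ennreal (poisson s x) * majorant x \<partial>lborel) \<le> ennreal (exp (- s)) * ennreal ((8 / pi + 1) * s powr (1 / 4 - 1))"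
        by (rule mult_left_mono) simp
      also have "\<dots> = ennreal (8 / pi + 1) * ennreal (exp (- s) * s powr (1 / 4 - 1))"
        by (simp add: ennreal_mult'[symmetric] ac_simps add_nonneg_nonneg del: ennreal_plus)
      finally show ?thesis using True by simp
    qed simp
  qed
  also have "\<dots> = ennreal (8 / pi + 1) * ennreal (Gamma (1 / 4))"
    using nn_integral_Gamma[of "1 / 4"] by (simp add: nn_integral_cmult)
  also have "\<dots> < \<infinity>" by (simp add: ennreal_mult_less_top)
  finally show ?thesis .
qed

lemma resolvent_majorant_le: "resolvent majorant x \<le> resolvent majorant 0"
  by (rule resolvent_antimono) (auto intro: majorant_antimono)

text \<open>The majorant is integrable near 0 and square integrable at infinity, but not the other
  way round, so it is cut at 1. The near part is integrated against a bounded resolvent, the far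
  part meets itself through \<open>resolvent_young\<close>, and symmetry reduces the cross term to
  the bounded case.\<close>

lemma nn_integral_majorant_resolvent: "(\<integral>\<^sup>+x. majorant x * resolvent majorant x \<partial>lborel) < \<infinity>"
proof -
  define ga where "ga x = indicator {-1..1} x * majorant x" for x
  define hb where "hb x = (if \<bar>x\<bar> \<le> 1 then 0 else \<bar>x\<bar> powr (- 3 / 4))" for x :: real
  define gb where "gb x = ennreal (hb x)" for x
  have [measurable]: "ga \<in> borel_measurable borel" "hb \<in> borel_measurable borel" "gb \<in> borel_measurable borel"
    unfolding ga_def[abs_def] gb_def[abs_def] hb_def[abs_def] by measurable
  have g: "majorant x = ga x + gb x" for x by (auto simp: ga_def gb_def hb_def majorant_def indicator_def)
  have gb: "gb x \<le> majorant x" for x by (auto simp: g)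
  define A where "A = resolvent majorant 0"
  have A: "A < \<infinity>" unfolding A_def by (rule resolvent_majorant_finite)
  have ga_int: "(\<integral>\<^sup>+x. ga x \<partial>lborel) < \<infinity>"
    unfolding ga_def using nn_integral_majorant_ball[of 1] le_less_trans by fastforce
  have ga_A: "(\<integral>\<^sup>+x. ga x * h x \<partial>lborel) < \<infinity>" if "\<And>x. h x \<le> A" for h
  proof -
    have "(\<integral>\<^sup>+x. ga x * h x \<partial>lborel) \<le> (\<integral>\<^sup>+x. ga x * A \<partial>lborel)"
      by (intro nn_integral_mono mult_left_mono that) simp
    also have "\<dots> < \<infinity>" using ga_int A by (simp add: nn_integral_multc ennreal_mult_less_top)
    finally show ?thesis .
  qed
  have "(\<integral>\<^sup>+x. majorant x * resolvent majorant x \<partial>lborel)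
     = (\<integral>\<^sup>+x. ga x * resolvent majorant x + (gb x * resolvent ga x + gb x * resolvent gb x) \<partial>lborel)"
  proof (intro nn_integral_cong)
    fix x
    have "resolvent majorant x = resolvent ga x + resolvent gb x"
      unfolding g[abs_def] by (rule resolvent_add) auto
    then have "gb x * resolvent majorant x = gb x * resolvent ga x + gb x * resolvent gb x"
      by (simp add: distrib_left)
    then show "majorant x * resolvent majorant x = ga x * resolvent majorant x + (gb x * resolvent ga x + gb x * resolvent gb x)"
      by (simp add: g[of x] distrib_right)
  qed
  also have "\<dots> = (\<integral>\<^sup>+x. ga x * resolvent majorant x \<partial>lborel) + ((\<integral>\<^sup>+x. gb x * resolvent ga x \<partial>lborel) + (\<integral>\<^sup>+x. gb x * resolvent gb x \<partial>lborel))"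
    by (simp add: nn_integral_add)
  also have "\<dots> < \<infinity>"
  proof -
    have "(\<integral>\<^sup>+x. ga x * resolvent majorant x \<partial>lborel) < \<infinity>"
      by (rule ga_A) (simp add: A_def resolvent_majorant_le)
    moreover have "(\<integral>\<^sup>+x. gb x * resolvent ga x \<partial>lborel) < \<infinity>"
    proof -
      have "resolvent gb x \<le> A" for x
        unfolding A_def using resolvent_mono[of gb majorant x] gb resolvent_majorant_le[of x] by (blast intro: order_trans)
      from ga_A[OF this] show ?thesis by (subst nn_integral_mult_resolvent) auto
    qed
    moreover have "(\<integral>\<^sup>+x. gb x * resolvent gb x \<partial>lborel) < \<infinity>"
    proof -
      have hb0: "0 \<le> hb x" for x by (simp add: hb_def)
      have "(\<integral>\<^sup>+x. indicator {0..} x * ennreal ((hb x)\<^sup>2) \<partial>lborel) \<le> (\<integral>\<^sup>+x. ennreal (indicator {1..} x * x powr (- 3 / 2)) \<partial>lborel)"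
        by (intro nn_integral_mono) (auto simp: indicator_def hb_def powr_power)
      also have "\<dots> = ennreal (- (1 powr (- 3 / 2 + 1) / (- 3 / 2 + 1)))"
       using has_integral_powr_to_inf[of "- 3 / 2" 1] by (intro nn_integral_has_integral_lebesgue) auto
      finally have "(\<integral>\<^sup>+x. indicator {0..} x * ennreal ((hb x)\<^sup>2) \<partial>lborel) < \<infinity>"
        using le_less_trans by fastforce
      then have fin: "(\<integral>\<^sup>+x. ennreal ((hb x)\<^sup>2) \<partial>lborel) < \<infinity>"
        using nn_integral_even_le[of "\<lambda>x. ennreal ((hb x)\<^sup>2)"] le_less_trans
        by (fastforce simp: hb_def ennreal_mult_less_top)
      have "(\<integral>\<^sup>+x. gb x * resolvent gb x \<partial>lborel) \<le> (\<integral>\<^sup>+x. 2 * (gb x * resolvent gb x) \<partial>lborel)"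
        by (intro nn_integral_mono) (simp add: mult_2)
      also have "\<dots> \<le> (\<integral>\<^sup>+x. ennreal ((hb x)\<^sup>2) + resolvent (\<lambda>y. ennreal ((hb y)\<^sup>2)) x \<partial>lborel)"
        unfolding gb_def by (intro nn_integral_mono resolvent_young hb0) simp
      also have "\<dots> = (\<integral>\<^sup>+x. ennreal ((hb x)\<^sup>2) \<partial>lborel) + (\<integral>\<^sup>+x. ennreal ((hb x)\<^sup>2) \<partial>lborel)"
        by (simp add: nn_integral_add nn_integral_resolvent)
      also have "\<dots> < \<infinity>" using fin by simp
      finally show ?thesis .
    qed
    ultimately show ?thesis by simp
  qed
  finally show ?thesis .
qed

section \<open>Compactness of decreasing profiles\<close>

text \<open>The value at 0 is left free, since it may be infinite for a limit of such functions.\<close>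

definition profile_ball :: "(real \<Rightarrow> real) set" where
  "profile_ball = {f \<in> borel_measurable borel. (\<forall>x. 0 \<le> f x) \<and> (\<forall>x y. x \<noteq> 0 \<longrightarrow> \<bar>x\<bar> \<le> \<bar>y\<bar> \<longrightarrow> f y \<le> f x)
     \<and> (\<integral>\<^sup>+x. ennreal (f x powr (4 / 3)) \<partial>lborel) \<le> 1}"

lemma profile_ballD:
  assumes "f \<in> profile_ball"
  shows "f \<in> borel_measurable borel" "0 \<le> f x" "x \<noteq> 0 \<Longrightarrow> \<bar>x\<bar> \<le> \<bar>y\<bar> \<Longrightarrow> f y \<le> f x"
    "(\<integral>\<^sup>+x. ennreal (f x powr (4 / 3)) \<partial>lborel) \<le> 1"
  using assms by (auto simp: profile_ball_def)

lemma profile_ball_le: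
  assumes f: "f \<in> profile_ball" and x: "x \<noteq> 0"
  shows "f x \<le> \<bar>x\<bar> powr (- 3 / 4)"
proof -
  note fD = profile_ballD[OF f]
  have [measurable]: "f \<in> borel_measurable borel" by (rule fD)
  have "ennreal (f x powr (4 / 3) * \<bar>x\<bar>) = (\<integral>\<^sup>+y. ennreal (f x powr (4 / 3)) * indicator {0<..\<bar>x\<bar>} y \<partial>lborel)"
    by (subst nn_integral_cmult) (auto simp: ennreal_mult)
  also have "\<dots> \<le> (\<integral>\<^sup>+y. ennreal (f y powr (4 / 3)) \<partial>lborel)"
    using fD(2,3) by (intro nn_integral_mono) (auto simp: indicator_def intro!: ennreal_leI powr_mono2)
  also have "\<dots> \<le> 1" by (rule fD)
  finally have "f x powr (4 / 3) * \<bar>x\<bar> \<le> 1" by (simp flip: ennreal_1)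
  then have le: "f x powr (4 / 3) \<le> inverse \<bar>x\<bar>" using x by (simp add: field_simps)
  have "f x = (f x powr (4 / 3)) powr (3 / 4)" using fD(2) by (simp add: powr_powr)
  also have "\<dots> \<le> (inverse \<bar>x\<bar>) powr (3 / 4)" using le by (intro powr_mono2) auto
  also have "\<dots> = \<bar>x\<bar> powr (- 3 / 4)" by (simp add: inverse_powr powr_minus)
  finally show ?thesis .
qed

lemma profile_ball_majorant:
  assumes "f \<in> profile_ball"
  shows "AE x in lborel. ennreal (f x) \<le> majorant x"
proof -
  have "AE x in lborel. x \<noteq> (0::real)" by (rule AE_lborel_singleton)
  then show ?thesis
    by eventually_elim (unfold majorant_def, intro ennreal_leI profile_ball_le[OF assms])
qed

lemma convergent_subsequence_on_countable:
  fixes f :: "nat \<Rightarrow> 'a::countable \<Rightarrow> real"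
  assumes "\<And>q. bounded (range (\<lambda>n. f n q))"
  obtains r where "strict_mono r" "\<And>q. convergent (\<lambda>n. f (r n) q)"
proof -
  interpret subseqs "\<lambda>n s. convergent (\<lambda>i. f (s i) (from_nat n :: 'a))"
  proof
    fix n and s :: "nat \<Rightarrow> nat"
    have "bounded (range (\<lambda>i. f (s i) (from_nat n)))"
      by (rule bounded_subset[OF assms[of "from_nat n"]]) auto
    then obtain l r where "strict_mono r" "((\<lambda>i. f (s i) (from_nat n)) \<circ> r) \<longlonglongrightarrow> l"
      using bounded_imp_convergent_subsequence by blast
    then show "\<exists>r'. strict_mono r' \<and> convergent (\<lambda>i. f ((s \<circ> r') i) (from_nat n))"
      by (auto simp: convergent_def o_def)
  qed
  have conv: "convergent (\<lambda>i. f (diagseq i) (from_nat n :: 'a))" for n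
  proof -
    \<comment> \<open>Only from index \<open>Suc n\<close> on is the diagonal sequence known to
      refine the stage that settles the n-th point; dropping an initial segment does not affect
      convergence.\<close>
    have "convergent (\<lambda>i. f ((diagseq \<circ> (+) (Suc n)) i) (from_nat n :: 'a))"
    proof (rule diagseq_holds)
      fix r s :: "nat \<Rightarrow> nat" and k
      assume "strict_mono r" "convergent (\<lambda>i. f (s i) (from_nat k :: 'a))"
      then show "convergent (\<lambda>i. f ((s \<circ> r) i) (from_nat k :: 'a))"
        using LIMSEQ_subseq_LIMSEQ[of "\<lambda>i. f (s i) (from_nat k)" _ r] by (auto simp: convergent_def o_def)
    qed
    then have "convergent (\<lambda>i. f (diagseq (i + Suc n)) (from_nat n :: 'a))" by (simp add: o_def add.commute)
    then show ?thesis using convergent_ignore_initial_segment[of "\<lambda>i. f (diagseq i) (from_nat n)" "Suc n"] by simp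
  qed
  have "convergent (\<lambda>i. f (diagseq i) q)" for q :: 'a
    using conv[of "to_nat q"] by simp
  then show ?thesis by (rule that[OF subseq_diagseq])
qed

text \<open>A monotone function has countably many discontinuities on the positive half-line.
  Stating continuity at |x| reduces both half-lines to that one, f being even off 0.\<close>

lemma AE_isCont_decreasing:
  fixes f :: "real \<Rightarrow> real"
  assumes dec: "\<And>x y. x \<noteq> 0 \<Longrightarrow> \<bar>x\<bar> \<le> \<bar>y\<bar> \<Longrightarrow> f y \<le> f x"
  shows "AE x in lborel. x \<noteq> 0 \<and> isCont f \<bar>x\<bar>"
proof (rule AE_I')
  define D where "D = {a \<in> {0<..}. \<not> isCont f a}"
  have "countable {a \<in> {0<..}. \<not> isCont (\<lambda>x. - f x) a}"
    by (rule mono_on_ctble_discont_open) (auto intro!: mono_onI dec)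
  moreover have "isCont (\<lambda>x. - f x) a = isCont f a" for a
    using continuous_minus[of "at a" f] continuous_minus[of "at a" "\<lambda>x. - f x"] by auto
  ultimately have "countable D" by (simp add: D_def)
  then have "countable (insert 0 (D \<union> uminus ` D))" by auto
  then show "insert 0 (D \<union> uminus ` D) \<in> null_sets lborel" by (rule countable_imp_null_set_lborel)
  show "{x \<in> space lborel. \<not> (x \<noteq> 0 \<and> isCont f \<bar>x\<bar>)} \<subseteq> insert 0 (D \<union> uminus ` D)"
  proof
    fix x assume "x \<in> {x \<in> space lborel. \<not> (x \<noteq> 0 \<and> isCont f \<bar>x\<bar>)}"
    then have "x = 0 \<or> \<bar>x\<bar> \<in> D" by (auto simp: D_def)
    then show "x \<in> insert 0 (D \<union> uminus ` D)"
      by (cases "x \<ge> 0") (auto intro: image_eqI[of x uminus "- x"])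
  qed
qed

text \<open>Helly's selection principle: off the countably many discontinuities of the upper limit, monotonicity
  squeezes the sequence between its limits at rational points.\<close>

lemma profile_ball_compact:
  fixes F :: "nat \<Rightarrow> real \<Rightarrow> real"
  assumes F: "\<And>n. F n \<in> profile_ball"
  obtains r f where "strict_mono r" "f \<in> profile_ball" "AE x in lborel. (\<lambda>n. F (r n) x) \<longlonglongrightarrow> f x"
proof -
  note FD = profile_ballD[OF F]
  have [measurable]: "F n \<in> borel_measurable borel" for n by (rule FD)
  have F0: "0 \<le> F n x" for n x by (rule FD)
  \<comment> \<open>The values at 0 have no uniform bound, so they are replaced by 0 before
    diagonalizing.\<close>
  have "bounded (range (\<lambda>n. if q = 0 then 0 else F n (of_rat q)))" for q
  proof (cases "q = 0")
    case False
    then show ?thesis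
      unfolding bounded_real using F0 profile_ball_le[OF F, of "of_rat q"]
      by (intro exI[of _ "\<bar>of_rat q\<bar> powr (- 3 / 4)"]) auto
  qed simp
  from convergent_subsequence_on_countable[of "\<lambda>n q. if q = 0 then 0 else F n (of_rat q)", OF this]
  obtain r where r: "strict_mono r" and rc: "\<And>q. convergent (\<lambda>n. if q = 0 then 0 else F (r n) (of_rat q))" by blast
  have conv: "convergent (\<lambda>n. F (r n) (of_rat q))" if "q \<noteq> 0" for q using rc[of q] that by simp
  \<comment> \<open>The limsup is defined at every point and inherits monotonicity and
    measurability, unlike a limit known only almost everywhere. Off 0 the pointwise bound makes it
    real; at 0 the value is a mere default.\<close>
  define f where "f x = (if x = 0 then 0 else real_of_ereal (limsup (\<lambda>n. ereal (F (r n) x))))" for x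
  have fe: "ereal (f x) = limsup (\<lambda>n. ereal (F (r n) x))" if "x \<noteq> 0" for x
  proof -
    have "limsup (\<lambda>n. ereal (F (r n) x)) \<le> ereal (\<bar>x\<bar> powr (- 3 / 4))"
      using profile_ball_le[OF F that] by (intro Limsup_bounded) auto
    moreover have "0 \<le> limsup (\<lambda>n. ereal (F (r n) x))"
      using F0 by (intro le_Limsup) auto
    ultimately show ?thesis using that by (cases "limsup (\<lambda>n. ereal (F (r n) x))") (auto simp: f_def)
  qed
  have f0: "0 \<le> f x" for x
  proof (cases "x = 0")
    case False
    have "0 \<le> limsup (\<lambda>n. ereal (F (r n) x))" using F0 by (intro le_Limsup) auto
    then show ?thesis unfolding fe[OF False, symmetric] by simp
  qed (simp add: f_def)
  have fdec: "f y \<le> f x" if "x \<noteq> 0" "\<bar>x\<bar> \<le> \<bar>y\<bar>" for x y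
  proof -
    have "y \<noteq> 0" using that by auto
    have "ereal (f y) \<le> ereal (f x)"
      unfolding fe[OF \<open>x \<noteq> 0\<close>] fe[OF \<open>y \<noteq> 0\<close>] using FD(3)[OF that] by (intro Limsup_mono) auto
    then show ?thesis by simp
  qed
  have fm [measurable]: "f \<in> borel_measurable borel" unfolding f_def[abs_def] by measurable
  have lim_pos: "(\<lambda>n. F (r n) x) \<longlonglongrightarrow> f x" if "x > 0" "isCont f x" for x
  proof (rule LIMSEQ_I)
    fix e :: real assume e: "e > 0"
    \<comment> \<open>The upper half of convergence is free from the limsup. The lower half uses
      continuity through a rational point just right of x, where the sequence converges and lies
      below its values at x.\<close>
    have "limsup (\<lambda>n. ereal (F (r n) x)) < ereal (f x + e)" using fe[of x] that e by (simp flip: fe)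
    then have up: "eventually (\<lambda>n. ereal (F (r n) x) < ereal (f x + e)) sequentially" by (rule Limsup_lessD)
    obtain d where d: "d > 0" "\<And>y. dist y x < d \<Longrightarrow> dist (f y) (f x) < e / 2"
      using \<open>isCont f x\<close> e unfolding continuous_at_eps_delta by (meson half_gt_zero)
    obtain q where q: "x < of_rat q" "of_rat q < x + d" using of_rat_dense[of x "x + d"] d by auto
    then have q0: "q \<noteq> 0" and q1: "(of_rat q :: real) \<noteq> 0" using that by auto
    have fq: "f (of_rat q) > f x - e / 2" 
    proof -
      have "\<bar>f (of_rat q) - f x\<bar> < e / 2" using d(2)[of "of_rat q"] q by (simp add: dist_real_def)
      then show ?thesis by linarith
    qed
    obtain l where l: "(\<lambda>n. F (r n) (of_rat q)) \<longlonglongrightarrow> l" using conv[OF q0] by (auto simp: convergent_def)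
    then have "limsup (\<lambda>n. ereal (F (r n) (of_rat q))) = ereal l"
      by (intro lim_imp_Limsup) auto
    then have "l = f (of_rat q)" using fe[OF q1] by simp
    then have "eventually (\<lambda>n. F (r n) (of_rat q) > f x - e / 2) sequentially"
      using order_tendstoD(1)[OF l] fq by simp
    with up have "eventually (\<lambda>n. norm (F (r n) x - f x) < e) sequentially"
    proof eventually_elim
      fix n assume *: "ereal (F (r n) x) < ereal (f x + e)" "F (r n) (of_rat q) > f x - e / 2"
      have "\<bar>x\<bar> \<le> \<bar>of_rat q\<bar>" "x \<noteq> 0" using that q by linarith+
      then have "F (r n) (of_rat q) \<le> F (r n) x" by (intro FD(3))
      with * e show "norm (F (r n) x - f x) < e" by (simp add: abs_less_iff)
    qed
    then show "\<exists>no. \<forall>n\<ge>no. norm (F (r n) x - f x) < e" by (simp add: eventually_sequentially)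
  qed
  have "AE x in lborel. x \<noteq> 0 \<and> isCont f \<bar>x\<bar>"
    by (rule AE_isCont_decreasing) (rule fdec)
  then have AEc: "AE x in lborel. (\<lambda>n. F (r n) x) \<longlonglongrightarrow> f x"
  proof eventually_elim
    fix x assume x: "x \<noteq> 0 \<and> isCont f \<bar>x\<bar>"
    then have "(\<lambda>n. F (r n) \<bar>x\<bar>) \<longlonglongrightarrow> f \<bar>x\<bar>" by (intro lim_pos) auto
    moreover have "F n \<bar>x\<bar> = F n x" for n using FD(3)[of x "\<bar>x\<bar>" n] FD(3)[of "\<bar>x\<bar>" x n] x by force
    moreover have "f \<bar>x\<bar> = f x" using fdec[of x "\<bar>x\<bar>"] fdec[of "\<bar>x\<bar>" x] x by force
    ultimately show "(\<lambda>n. F (r n) x) \<longlonglongrightarrow> f x" by simp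
  qed
  \<comment> \<open>Fatou: mass may be lost in the limit, so only the bound by 1 survives. This is
    why the constraint set is a ball and not a sphere.\<close>
  have "(\<integral>\<^sup>+x. ennreal (f x powr (4 / 3)) \<partial>lborel) = (\<integral>\<^sup>+x. liminf (\<lambda>n. ennreal (F (r n) x powr (4 / 3))) \<partial>lborel)"
  proof (rule nn_integral_cong_AE)
    show "AE x in lborel. ennreal (f x powr (4 / 3)) = liminf (\<lambda>n. ennreal (F (r n) x powr (4 / 3)))"
      using AEc
    proof eventually_elim
      fix x assume "(\<lambda>n. F (r n) x) \<longlonglongrightarrow> f x"
      then have "(\<lambda>n. F (r n) x powr (4 / 3)) \<longlonglongrightarrow> f x powr (4 / 3)"
        using F0 by (intro tendsto_powr') auto
      then have "(\<lambda>n. ennreal (F (r n) x powr (4 / 3))) \<longlonglongrightarrow> ennreal (f x powr (4 / 3))" by (rule tendsto_ennrealI)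
      then show "ennreal (f x powr (4 / 3)) = liminf (\<lambda>n. ennreal (F (r n) x powr (4 / 3)))"
        by (rule lim_imp_Liminf[OF sequentially_bot, symmetric])
    qed
  qed
  also have "\<dots> \<le> liminf (\<lambda>n. \<integral>\<^sup>+x. ennreal (F (r n) x powr (4 / 3)) \<partial>lborel)"
    by (rule nn_integral_liminf) measurable
  also have "\<dots> \<le> liminf (\<lambda>n. 1)" using FD(4) by (intro Liminf_mono) auto
  also have "\<dots> = 1" by (simp add: Liminf_const)
  finally have "f \<in> profile_ball" using fm f0 fdec by (auto simp: profile_ball_def)
  with r AEc show ?thesis by (intro that)
qed

section \<open>The variational problem for the quadratic form of (1 + |D|)^-1\<close>

definition energy :: "(real \<Rightarrow> real) \<Rightarrow> (real \<Rightarrow> real) \<Rightarrow> ennreal" where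
  "energy f g = (\<integral>\<^sup>+x. ennreal (f x) * resolvent (\<lambda>y. ennreal (g y)) x \<partial>lborel)"

lemma resolvent_profile_le:
  assumes "f \<in> profile_ball"
  shows "resolvent (\<lambda>y. ennreal (f y)) x \<le> resolvent majorant x"
  by (rule resolvent_mono_AE[OF profile_ball_majorant[OF assms]])

lemma resolvent_profile_finite:
  assumes "f \<in> profile_ball"
  shows "resolvent (\<lambda>y. ennreal (f y)) x < \<infinity>"
  by (rule le_less_trans[OF order_trans[OF resolvent_profile_le[OF assms] resolvent_majorant_le] resolvent_majorant_finite])

lemma energy_finite:
  assumes "f \<in> profile_ball" "g \<in> profile_ball"
  shows "energy f g \<le> (\<integral>\<^sup>+x. majorant x * resolvent majorant x \<partial>lborel)" "energy f g < \<infinity>"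
proof -
  show le: "energy f g \<le> (\<integral>\<^sup>+x. majorant x * resolvent majorant x \<partial>lborel)"
    unfolding energy_def
  proof (rule nn_integral_mono_AE)
    show "AE x in lborel. ennreal (f x) * resolvent (\<lambda>y. ennreal (g y)) x \<le> majorant x * resolvent majorant x"
      using profile_ball_majorant[OF assms(1)]
      by eventually_elim (intro mult_mono resolvent_profile_le assms, auto)
  qed
  show "energy f g < \<infinity>" using le nn_integral_majorant_resolvent by (rule le_less_trans)
qed

text \<open>Dominated convergence twice: against \<open>res_kernel (x - y) * majorant y\<close> for
  the inner integral at each x, then against
  \<open>majorant x * resolvent majorant x\<close>.\<close>

lemma energy_convergence:
  fixes F :: "nat \<Rightarrow> real \<Rightarrow> real"
  assumes F: "\<And>n. F n \<in> profile_ball" and f: "f \<in> profile_ball"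
    and lim: "AE x in lborel. (\<lambda>n. F n x) \<longlonglongrightarrow> f x"
  shows "(\<lambda>n. energy (F n) (F n)) \<longlonglongrightarrow> energy f f"
proof -
  have [measurable]: "F n \<in> borel_measurable borel" "f \<in> borel_measurable borel" for n
    using profile_ballD(1)[OF F] profile_ballD(1)[OF f] by auto
  have R: "(\<lambda>n. resolvent (\<lambda>y. ennreal (F n y)) x) \<longlonglongrightarrow> resolvent (\<lambda>y. ennreal (f y)) x" for x
    unfolding resolvent_def
  proof (rule nn_integral_dominated_convergence[where w="\<lambda>y. res_kernel (x - y) * majorant y"])
    show "AE y in lborel. res_kernel (x - y) * ennreal (F n y) \<le> res_kernel (x - y) * majorant y" for n
      using profile_ball_majorant[OF F[of n]] by eventually_elim (auto intro: mult_left_mono)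
    show "(\<integral>\<^sup>+y. res_kernel (x - y) * majorant y \<partial>lborel) < \<infinity>"
      using le_less_trans[OF resolvent_majorant_le[of x] resolvent_majorant_finite] by (simp add: resolvent_def)
    \<comment> \<open>The kernel is infinite on the diagonal, and multiplication by an infinite
      constant does not preserve limits.\<close>
    have "AE y in lborel. y \<noteq> x" by (rule AE_lborel_singleton)
    with lim show "AE y in lborel. (\<lambda>n. res_kernel (x - y) * ennreal (F n y)) \<longlonglongrightarrow> res_kernel (x - y) * ennreal (f y)"
    proof eventually_elim
      fix y assume "(\<lambda>n. F n y) \<longlonglongrightarrow> f y" "y \<noteq> x"
      have "res_kernel (x - y) < \<infinity>"
        using res_kernel_finite[of "x - y"] \<open>y \<noteq> x\<close> by simp
      then show "(\<lambda>n. res_kernel (x - y) * ennreal (F n y)) \<longlonglongrightarrow> res_kernel (x - y) * ennreal (f y)"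
        using \<open>(\<lambda>n. F n y) \<longlonglongrightarrow> f y\<close> by (intro ennreal_tendsto_cmult tendsto_ennrealI) (auto simp: less_top)
    qed
  qed measurable
  show ?thesis
    unfolding energy_def
  proof (rule nn_integral_dominated_convergence[where w="\<lambda>x. majorant x * resolvent majorant x"])
    show "AE x in lborel. ennreal (F n x) * resolvent (\<lambda>y. ennreal (F n y)) x \<le> majorant x * resolvent majorant x" for n
      using profile_ball_majorant[OF F[of n]]
      by eventually_elim (intro mult_mono resolvent_profile_le F, auto)
    show "AE x in lborel. (\<lambda>n. ennreal (F n x) * resolvent (\<lambda>y. ennreal (F n y)) x) \<longlonglongrightarrow> ennreal (f x) * resolvent (\<lambda>y. ennreal (f y)) x"
      using lim
    proof eventually_elim
      fix x assume "(\<lambda>n. F n x) \<longlonglongrightarrow> f x"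
      then show "(\<lambda>n. ennreal (F n x) * resolvent (\<lambda>y. ennreal (F n y)) x) \<longlonglongrightarrow> ennreal (f x) * resolvent (\<lambda>y. ennreal (f y)) x"
        using resolvent_profile_finite[OF f, of x] by (intro tendsto_mult_ennreal tendsto_ennrealI R) (auto simp: less_top)
    qed
  qed (use nn_integral_majorant_resolvent in auto)
qed

lemma energy_maximizer:
  obtains f where "f \<in> profile_ball" "\<And>g. g \<in> profile_ball \<Longrightarrow> energy g g \<le> energy f f"
proof -
  have "(\<lambda>_. 0) \<in> profile_ball" by (simp add: profile_ball_def)
  then have "(\<lambda>f. energy f f) ` profile_ball \<noteq> {}" by blast
  from ennreal_Sup_countable_SUP[OF this]
  obtain m where m: "incseq m" "range m \<subseteq> (\<lambda>f. energy f f) ` profile_ball"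
    "Sup ((\<lambda>f. energy f f) ` profile_ball) = (SUP i. m i)" by blast
  have "\<exists>F. F \<in> profile_ball \<and> m n = energy F F" for n using m(2) by blast
  then obtain F where F: "\<And>n. F n \<in> profile_ball" "\<And>n. m n = energy (F n) (F n)" by metis
  obtain r f where r: "strict_mono r" and f: "f \<in> profile_ball" and lim: "AE x in lborel. (\<lambda>n. F (r n) x) \<longlonglongrightarrow> f x"
    by (rule profile_ball_compact[OF F(1)])
  have "(\<lambda>n. m (r n)) \<longlonglongrightarrow> energy f f"
    unfolding F(2) using F(1) f lim by (rule energy_convergence)
  moreover have "(\<lambda>n. m (r n)) \<longlonglongrightarrow> (SUP i. m i)"
    using LIMSEQ_subseq_LIMSEQ[OF LIMSEQ_SUP[OF m(1)] r] by (simp add: o_def)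
  ultimately have "energy f f = (SUP f\<in>profile_ball. energy f f)" unfolding m(3) by (rule LIMSEQ_unique)
  then have "energy g g \<le> energy f f" if "g \<in> profile_ball" for g
    using SUP_upper[OF that, of "\<lambda>f. energy f f"] by simp
  then show ?thesis by (rule that[OF f])
qed

section \<open>Existence of a ground state\<close>

text \<open>Extends convexity from positive arguments to the boundary: if one argument is 0, the
  claim reduces to \<open>s powr p \<le> s\<close> on [0, 1].\<close>

lemma powr_convex_nonneg:
  fixes a b t p :: real
  assumes "0 \<le> a" "0 \<le> b" "0 \<le> t" "t \<le> 1" "1 \<le> p"
  shows "((1 - t) * a + t * b) powr p \<le> (1 - t) * a powr p + t * b powr p"
proof -
  have le: "s powr p \<le> s" if "0 \<le> s" "s \<le> 1" for s
    using powr_mono'[OF assms(5) that] that by (cases "s = 0") auto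
  consider "a = 0" | "b = 0" | "a > 0" "b > 0" using assms by linarith
  then show ?thesis
  proof cases
    case 1
    then show ?thesis using le[of t] assms by (simp add: powr_mult mult_right_mono)
  next
    case 2
    then show ?thesis using le[of "1 - t"] assms by (simp add: powr_mult mult_right_mono)
  next
    case 3
    then show ?thesis using convex_onD[OF powr_convex[OF assms(5)], of t a b] assms by simp
  qed
qed

lemma profile_ball_convex:
  assumes f: "f \<in> profile_ball" and g: "g \<in> profile_ball" and t: "0 \<le> t" "t \<le> 1"
  shows "(\<lambda>x. (1 - t) * f x + t * g x) \<in> profile_ball"
proof -
  note fD = profile_ballD[OF f] and gD = profile_ballD[OF g]
  have [measurable]: "f \<in> borel_measurable borel" "g \<in> borel_measurable borel" by (rule fD gD)+
  have "(\<integral>\<^sup>+x. ennreal (((1 - t) * f x + t * g x) powr (4 / 3)) \<partial>lborel)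
      \<le> (\<integral>\<^sup>+x. ennreal (1 - t) * ennreal (f x powr (4 / 3)) + ennreal t * ennreal (g x powr (4 / 3)) \<partial>lborel)"
  proof (rule nn_integral_mono)
    fix x
    have "((1 - t) * f x + t * g x) powr (4 / 3) \<le> (1 - t) * f x powr (4 / 3) + t * g x powr (4 / 3)"
      using t fD(2) gD(2) by (intro powr_convex_nonneg) auto
    also have "ennreal \<dots> = ennreal (1 - t) * ennreal (f x powr (4 / 3)) + ennreal t * ennreal (g x powr (4 / 3))"
      using t by (simp add: ennreal_mult ennreal_plus)
    finally show "ennreal (((1 - t) * f x + t * g x) powr (4 / 3)) \<le> ennreal (1 - t) * ennreal (f x powr (4 / 3)) + ennreal t * ennreal (g x powr (4 / 3))"
      by (simp add: ennreal_leI)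
  qed
  also have "\<dots> = ennreal (1 - t) * (\<integral>\<^sup>+x. ennreal (f x powr (4 / 3)) \<partial>lborel) + ennreal t * (\<integral>\<^sup>+x. ennreal (g x powr (4 / 3)) \<partial>lborel)"
    by (simp add: nn_integral_add nn_integral_cmult)
  also have "\<dots> \<le> ennreal (1 - t) * 1 + ennreal t * 1"
    by (intro add_mono mult_left_mono fD gD) auto
  also have "\<dots> = 1" using t by (simp flip: ennreal_plus)
  finally show ?thesis
    using fD(2,3) gD(2,3) t by (auto simp: profile_ball_def intro!: add_mono mult_left_mono)
qed

lemma energy_commute:
  assumes [measurable]: "f \<in> borel_measurable borel" "g \<in> borel_measurable borel"
  shows "energy f g = energy g f"
  unfolding energy_def by (rule nn_integral_mult_resolvent) auto

lemma energy_combination: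
  assumes [measurable]: "f \<in> borel_measurable borel" "g \<in> borel_measurable borel" "k \<in> borel_measurable borel"
    and "\<And>x. 0 \<le> f x" "\<And>x. 0 \<le> g x" "0 \<le> c" "0 \<le> d"
  shows "energy (\<lambda>x. c * f x + d * g x) k = ennreal c * energy f k + ennreal d * energy g k"
  unfolding energy_def using assms(4-)
  by (simp add: ennreal_mult ennreal_plus distrib_right nn_integral_add mult.assoc nn_integral_cmult)

text \<open>First variation: moving from f towards g inside the convex ball, maximality bounds the
  term linear in t. Thus f also maximizes the linear functional \<open>energy g f\<close> of g,
  which is what the Hoelder argument exploits.\<close>

lemma energy_maximizer_le:
  assumes f: "f \<in> profile_ball" and max: "\<And>g. g \<in> profile_ball \<Longrightarrow> energy g g \<le> energy f f"
    and g: "g \<in> profile_ball"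
  shows "energy g f \<le> energy f f"
proof -
  note fD = profile_ballD[OF f] and gD = profile_ballD[OF g]
  have [measurable]: "f \<in> borel_measurable borel" "g \<in> borel_measurable borel" by (rule fD gD)+
  obtain m where m: "energy f f = ennreal m" "0 \<le> m" using energy_finite(2)[OF f f] by (cases "energy f f") auto
  obtain b where b: "energy g f = ennreal b" "0 \<le> b" using energy_finite(2)[OF g f] by (cases "energy g f") auto
  obtain j where j: "energy g g = ennreal j" "0 \<le> j" using energy_finite(2)[OF g g] by (cases "energy g g") auto
  have ineq: "2 * (1 - t) * b \<le> (2 - t) * m" if t: "0 < t" "t < 1" for t
  proof -
    define h where "h = (\<lambda>x. (1 - t) * f x + t * g x)"
    have hm: "h \<in> borel_measurable borel" unfolding h_def by measurable
    have comb: "energy h k = ennreal (1 - t) * energy f k + ennreal t * energy g k" if "k \<in> borel_measurable borel" for k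
      unfolding h_def using t that fD(2) gD(2) by (intro energy_combination) auto
    have "energy h h = ennreal (1 - t) * (ennreal (1 - t) * energy f f + ennreal t * energy g f)
        + ennreal t * (ennreal (1 - t) * energy g f + ennreal t * energy g g)"
      unfolding comb[OF hm] energy_commute[OF fD(1) hm] energy_commute[OF gD(1) hm]
        comb[OF fD(1)] comb[OF gD(1)] energy_commute[OF fD(1) gD(1)] by simp
    also have "\<dots> = ennreal ((1 - t) * ((1 - t) * m + t * b) + t * ((1 - t) * b + t * j))"
      using t m b j by (simp add: ennreal_mult ennreal_plus)
    finally have "ennreal ((1 - t) * ((1 - t) * m + t * b) + t * ((1 - t) * b + t * j)) \<le> ennreal m"
      using max[OF profile_ball_convex[OF f g, of t]] t m by (simp add: h_def)
    then have "(1 - t) * ((1 - t) * m + t * b) + t * ((1 - t) * b + t * j) \<le> m" using m by simp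
    \<comment> \<open>Dropping this nonnegative quadratic term keeps the inequality, and what
      remains is divisible by t.\<close>
    moreover have "0 \<le> t * (t * j)" using t j by simp
    ultimately have "t * (2 * (1 - t) * b) \<le> t * ((2 - t) * m)" by (simp add: algebra_simps)
    then show ?thesis using t by simp
  qed
  have "b \<le> m"
  proof (rule ccontr)
    assume "\<not> b \<le> m"
    then have bm: "m < b" "0 < b" using m by auto
    \<comment> \<open>Solves \<open>2 * (1 - t) * b = b + m\<close>, which exceeds
      \<open>2 * m\<close> when m < b and so contradicts \<open>ineq\<close>.\<close>
    define t where "t = (b - m) / (2 * b)"
    have t: "0 < t" "t < 1" using bm m by (auto simp: t_def field_simps)
    have "0 \<le> t * m" "(2 - t) * m = 2 * m - t * m" using m t by (auto simp: algebra_simps)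
    then have "2 * (1 - t) * b \<le> 2 * m" using ineq[OF t] by linarith
    moreover have "2 * (1 - t) * b = b + m" using bm by (simp add: t_def field_simps)
    ultimately show False using bm by simp
  qed
  then show ?thesis using m b by (simp add: ennreal_leI)
qed

text \<open>Rules out a maximizer of zero energy. The indicator of an interval of length 1 has norm
  1, and any two of its points are at distance at most 1, so its energy is at least
  \<open>res_kernel 1\<close>.\<close>

lemma energy_pos: "\<exists>g\<in>profile_ball. 0 < energy g g"
proof
  define S where "S = {-(1/2)..1/2::real}"
  have [measurable]: "S \<in> sets borel" by (simp add: S_def)
  have S: "emeasure lborel S = 1" by (simp add: S_def)
  define g where "g x = indicat_real S x" for x :: real
  have [measurable]: "g \<in> borel_measurable borel" unfolding g_def[abs_def] by measurable
  have "(\<integral>\<^sup>+x. ennreal (g x powr (4 / 3)) \<partial>lborel) = (\<integral>\<^sup>+x. indicator S x \<partial>lborel)"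
    by (intro nn_integral_cong) (auto simp: g_def indicator_def)
  then have "(\<integral>\<^sup>+x. ennreal (g x powr (4 / 3)) \<partial>lborel) = 1" by (simp add: S)
  moreover have "g y \<le> g x" if "\<bar>x\<bar> \<le> \<bar>y\<bar>" for x y using that by (auto simp: g_def S_def indicator_def)
  moreover have "0 \<le> g x" for x by (simp add: g_def)
  ultimately show "g \<in> profile_ball" by (simp add: profile_ball_def)
  \<comment> \<open>A lower bound from s in [1, 2] alone: there \<open>exp (- s)\<close> is at least
    \<open>exp (-2)\<close>, and \<open>s / (s^2 + 1)\<close> is at least 1/5.\<close>
  define c where "c = exp (-2) * (1 / 5 / pi)"
  have K: "ennreal c \<le> res_kernel 1"
  proof -
    have "ennreal c = (\<integral>\<^sup>+s. ennreal c * indicator {1..2} s \<partial>(lborel :: real measure))"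
      by (subst nn_integral_cmult) auto
    also have "\<dots> \<le> res_kernel 1"
      unfolding res_kernel_def
    proof (rule nn_integral_mono)
      fix s :: real
      have "c \<le> exp (- s) * poisson s 1" if s: "s \<in> {1..2}"
        unfolding c_def
      proof (intro mult_mono)
        have "s\<^sup>2 \<le> 2\<^sup>2" using s by (intro power_mono) auto
        then have "1 / 5 \<le> s / (s\<^sup>2 + 1\<^sup>2)" using s by (intro frac_le) (auto intro: add_nonneg_pos)
        then show "1 / 5 / pi \<le> poisson s 1" unfolding poisson_def by (rule divide_right_mono) simp
      qed (use s in auto)
      then show "ennreal c * indicator {1..2} s \<le> indicator {0<..} s * ennreal (exp (- s) * poisson s 1)"
        by (auto simp: indicator_def intro!: ennreal_leI)
    qed
    finally show ?thesis .
  qed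
  have "0 < ennreal c" by (simp add: c_def)
  also have "ennreal c \<le> res_kernel 1" by (rule K)
  also have "\<dots> = (\<integral>\<^sup>+x. indicator S x * (\<integral>\<^sup>+y. res_kernel 1 * indicator S y \<partial>lborel) \<partial>lborel)"
    by (simp add: nn_integral_cmult nn_integral_multc S)
  also have "\<dots> \<le> energy g g"
    unfolding energy_def resolvent_def
  proof (intro nn_integral_mono)
    fix x
    have "(\<integral>\<^sup>+y. res_kernel 1 * indicator S y \<partial>lborel) \<le> (\<integral>\<^sup>+y. res_kernel (x - y) * ennreal (g y) \<partial>lborel)" if "x \<in> S"
      using that by (intro nn_integral_mono) (auto simp: g_def S_def indicator_def intro!: res_kernel_antimono)
    then show "indicator S x * (\<integral>\<^sup>+y. res_kernel 1 * indicator S y \<partial>lborel) \<le> ennreal (g x) * (\<integral>\<^sup>+y. res_kernel (x - y) * ennreal (g y) \<partial>lborel)"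
      by (auto simp: g_def indicator_def)
  qed
  finally show "0 < energy g g" .
qed

text \<open>Young's inequality for the exponents 4 and 4/3, with c in the role of a cube root. The
  factorization also yields the equality case, which identifies the maximizer.\<close>

lemma young_quartic:
  fixes a c :: real
  shows "0 \<le> a^4 + 3 * c^4 - 4 * (a * c^3)" "a^4 + 3 * c^4 - 4 * (a * c^3) = 0 \<Longrightarrow> a = c"
proof -
  have eq: "a^4 + 3 * c^4 - 4 * (a * c^3) = (a - c)\<^sup>2 * ((a + c)\<^sup>2 + 2 * c\<^sup>2)"
    by (simp add: power2_eq_square power3_eq_cube power4_eq_xxxx algebra_simps)
  show "0 \<le> a^4 + 3 * c^4 - 4 * (a * c^3)" unfolding eq by simp
  assume "a^4 + 3 * c^4 - 4 * (a * c^3) = 0"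
  then have "(a - c)\<^sup>2 = 0 \<or> (a + c)\<^sup>2 + 2 * c\<^sup>2 = 0" unfolding eq by simp
  then show "a = c" by (auto simp: add_nonneg_eq_0_iff)
qed

text \<open>The resolvent of the maximizer \<open>f\<close> again decreases in \<open>|x|\<close>, so its cube is an admissible competitor. It is also the
  unconstrained extremizer in Hoelder's inequality, which forces \<open>f\<close> to be proportional to that cube.\<close>

lemma ground_state_exists:
  obtains R :: "real \<Rightarrow> real" where "R \<in> borel_measurable borel" "\<And>x. 0 \<le> R x" "\<And>x y. \<bar>x\<bar> \<le> \<bar>y\<bar> \<Longrightarrow> R y \<le> R x"
    "integrable lborel R" "0 < R 0" "\<And>x. ennreal (R x) = resolvent (\<lambda>y. ennreal (R y ^ 3)) x"
proof -
  obtain f where f: "f \<in> profile_ball" and max: "\<And>g. g \<in> profile_ball \<Longrightarrow> energy g g \<le> energy f f"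
    using energy_maximizer by blast
  note fD = profile_ballD[OF f]
  have [measurable]: "f \<in> borel_measurable borel" by (rule fD)
  obtain m where m: "energy f f = ennreal m" and "0 \<le> m" using energy_finite(2)[OF f f] by (cases "energy f f") auto
  have "0 < energy f f" using energy_pos max by (meson less_le_trans)
  then have m0: "0 < m" using m by simp
  define q where "q x = enn2real (resolvent (\<lambda>y. ennreal (f y)) x)" for x
  have q: "ennreal (q x) = resolvent (\<lambda>y. ennreal (f y)) x" for x
    using resolvent_profile_finite[OF f, of x] by (simp add: q_def)
  have q_m [measurable]: "q \<in> borel_measurable borel" unfolding q_def[abs_def] by measurable
  have q0: "0 \<le> q x" for x by (simp add: q_def)
  have q_dec: "q y \<le> q x" if "\<bar>x\<bar> \<le> \<bar>y\<bar>" for x y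
  proof -
    have "ennreal (q y) \<le> ennreal (q x)"
      unfolding q by (rule resolvent_antimono[OF _ _ that]) (use fD in \<open>auto intro: ennreal_leI\<close>)
    then show ?thesis using q0 by simp
  qed
  have q_le: "q x \<le> q 0" for x by (rule q_dec) simp
  have test: "(\<integral>\<^sup>+x. ennreal (g x) * ennreal (q x) \<partial>lborel) \<le> ennreal m" if "g \<in> profile_ball" for g
    using energy_maximizer_le[OF f max that] unfolding m by (simp add: energy_def q)
  \<comment> \<open>Finiteness of the L^4 norm of q is not yet known, so the competitor is the cube
    of q cut off to [-n, n]; the bound is uniform in n and passes to the limit by Fatou.\<close>
  have I: "(\<integral>\<^sup>+x. ennreal (indicator {- real n..real n} x * q x ^ 4) \<partial>lborel) \<le> ennreal (m ^ 4)" for n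
  proof -
    let ?I = "\<integral>\<^sup>+x. ennreal (indicator {- real n..real n} x * q x ^ 4) \<partial>lborel"
    have "?I \<le> (\<integral>\<^sup>+x. ennreal (q 0 ^ 4) * indicator {- real n..real n} x \<partial>lborel)"
      using q_le q0 by (intro nn_integral_mono) (auto simp: indicator_def intro!: ennreal_leI power_mono)
    also have "\<dots> < \<infinity>" by (subst nn_integral_cmult) (auto simp: ennreal_mult_less_top)
    finally obtain i where i: "?I = ennreal i" "0 \<le> i" by (cases ?I) auto
    show ?thesis
    proof (cases "i = 0")
      case False
      then have i0: "0 < i" using i by simp
      \<comment> \<open>Normalizes the competitor, \<open>c powr (4 / 3) * i = 1\<close>. Testing
        with it then gives \<open>c * i = i powr (1 / 4) \<le> m\<close>.\<close>
      define c where "c = i powr (- 3 / 4)"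
      define g where "g x = c * (q x ^ 3 * indicat_real {- real n..real n} x)" for x
      have c: "0 < c" using i0 by (simp add: c_def)
      have "c powr (4 / 3) = i powr (-1)" using i0 by (simp add: c_def powr_powr)
      then have c': "c powr (4 / 3) = 1 / i" using i0 by (simp add: powr_minus_divide)
      have q34: "(q x ^ 3) powr (4 / 3) = q x ^ 4" for x
      proof (cases "q x = 0")
        case False
        then have "0 < q x" using q0[of x] by simp
        then have "(q x ^ 3) powr (4 / 3) = (q x powr 3) powr (4 / 3)" by simp
        also have "\<dots> = q x powr 4" unfolding powr_powr by simp
        finally show ?thesis using \<open>0 < q x\<close> by simp
      qed simp
      have [measurable]: "g \<in> borel_measurable borel" unfolding g_def[abs_def] by measurable
      have "(\<integral>\<^sup>+x. ennreal (g x powr (4 / 3)) \<partial>lborel) = (\<integral>\<^sup>+x. ennreal (1 / i) * ennreal (indicator {- real n..real n} x * q x ^ 4) \<partial>lborel)"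
        using c q0 i0 by (intro nn_integral_cong) (auto simp: g_def indicator_def powr_mult c' q34 simp flip: ennreal_mult)
      also have "\<dots> = ennreal (1 / i) * ennreal i" unfolding i(1)[symmetric] by (rule nn_integral_cmult) simp
      also have "\<dots> = 1" using i0 by (simp flip: ennreal_mult)
      finally have "(\<integral>\<^sup>+x. ennreal (g x powr (4 / 3)) \<partial>lborel) = 1" .
      moreover have "g y \<le> g x" if "\<bar>x\<bar> \<le> \<bar>y\<bar>" for x y
        unfolding g_def using c that q0 q_dec[OF that]
        by (intro mult_left_mono mult_mono power_mono) (auto simp: indicator_def)
      ultimately have "g \<in> profile_ball" using c q0 by (auto simp: profile_ball_def g_def)
      then have "(\<integral>\<^sup>+x. ennreal (g x) * ennreal (q x) \<partial>lborel) \<le> ennreal m" by (rule test)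
      also have "(\<integral>\<^sup>+x. ennreal (g x) * ennreal (q x) \<partial>lborel) = (\<integral>\<^sup>+x. ennreal c * ennreal (indicator {- real n..real n} x * q x ^ 4) \<partial>lborel)"
        using c q0 by (intro nn_integral_cong) (auto simp: g_def indicator_def power4_eq_xxxx power3_eq_cube mult.assoc simp flip: ennreal_mult)
      also have "\<dots> = ennreal c * ennreal i" unfolding i(1)[symmetric] by (rule nn_integral_cmult) simp
      also have "\<dots> = ennreal (c * i)" using c i by (simp add: ennreal_mult)
      also have "c * i = i powr (1 / 4)"
        using i0 powr_add[of i "- 3 / 4" 1] by (simp add: c_def)
      finally have "i powr (1 / 4) \<le> m" using m0 by simp
      then have "(i powr (1 / 4)) ^ 4 \<le> m ^ 4" by (intro power_mono) auto
      moreover have "(i powr (1 / 4)) ^ 4 = i" using i0 by (simp add: powr_power)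
      ultimately show ?thesis using i by (simp add: ennreal_leI)
    qed (use i in simp)
  qed
  have q4: "(\<integral>\<^sup>+x. ennreal (q x ^ 4) \<partial>lborel) \<le> ennreal (m ^ 4)"
  proof -
    have "(\<integral>\<^sup>+x. ennreal (q x ^ 4) \<partial>lborel) = (\<integral>\<^sup>+x. liminf (\<lambda>n. ennreal (indicator {- real n..real n} x * q x ^ 4)) \<partial>lborel)"
    proof (rule nn_integral_cong)
      fix x :: real
      obtain N where N: "\<bar>x\<bar> < real N" using reals_Archimedean2 by blast
      have "eventually (\<lambda>n. ennreal (indicator {- real n..real n} x * q x ^ 4) = ennreal (q x ^ 4)) sequentially"
        using eventually_ge_at_top[of N]
      proof eventually_elim
        fix n assume "N \<le> n"
        then have "\<bar>x\<bar> \<le> real n" using N by linarith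
        then have "x \<in> {- real n..real n}" by auto
        then show "ennreal (indicator {- real n..real n} x * q x ^ 4) = ennreal (q x ^ 4)" by simp
      qed
      then have "(\<lambda>n. ennreal (indicator {- real n..real n} x * q x ^ 4)) \<longlonglongrightarrow> ennreal (q x ^ 4)"
        by (rule tendsto_eventually)
      then show "ennreal (q x ^ 4) = liminf (\<lambda>n. ennreal (indicator {- real n..real n} x * q x ^ 4))"
        by (rule lim_imp_Liminf[OF sequentially_bot, symmetric])
    qed
    also have "\<dots> \<le> liminf (\<lambda>n. \<integral>\<^sup>+x. ennreal (indicator {- real n..real n} x * q x ^ 4) \<partial>lborel)"
      by (rule nn_integral_liminf) measurable
    also have "\<dots> \<le> liminf (\<lambda>n. ennreal (m ^ 4))" using I by (intro Liminf_mono) auto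
    finally show ?thesis by (simp add: Liminf_const)
  qed
  have q4i: "integrable lborel (\<lambda>x. q x ^ 4)" "(LINT x|lborel. q x ^ 4) \<le> m ^ 4"
  proof -
    show i: "integrable lborel (\<lambda>x. q x ^ 4)"
      using q4 by (intro integrableI_bounded) (auto intro: le_less_trans)
    show "(LINT x|lborel. q x ^ 4) \<le> m ^ 4"
      using q4 nn_integral_eq_integral[OF i] m0 by simp
  qed
  have f43: "integrable lborel (\<lambda>x. f x powr (4 / 3))" "(LINT x|lborel. f x powr (4 / 3)) \<le> 1"
  proof -
    show i: "integrable lborel (\<lambda>x. f x powr (4 / 3))"
      using fD(4) by (intro integrableI_bounded) (auto intro: le_less_trans)
    show "(LINT x|lborel. f x powr (4 / 3)) \<le> 1"
      using fD(4) nn_integral_eq_integral[OF i] by simp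
  qed
  have fq: "integrable lborel (\<lambda>x. f x * q x)" "(LINT x|lborel. f x * q x) = m"
  proof -
    have e: "(\<integral>\<^sup>+x. ennreal (f x * q x) \<partial>lborel) = ennreal m"
      using m fD(2) q0 by (simp add: energy_def q[symmetric] ennreal_mult)
    show i: "integrable lborel (\<lambda>x. f x * q x)"
      using e fD(2) q0 by (intro integrableI_bounded) auto
    show "(LINT x|lborel. f x * q x) = m"
      using e nn_integral_eq_integral[OF i] fD(2) q0 m0 by (simp add: integral_nonneg_AE)
  qed
  define p where "p x = (q x / m) ^ 3" for x
  have [measurable]: "p \<in> borel_measurable borel" unfolding p_def[abs_def] by measurable
  have p0: "0 \<le> p x" for x using q0 m0 by (simp add: p_def)
  have fp: "AE x in lborel. f x = p x"
  proof -
    define c where "c x = f x powr (1 / 3)" for x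
    have c3: "c x ^ 3 = f x" for x using fD(2) by (cases "f x = 0") (auto simp: c_def powr_power)
    have c4: "c x ^ 4 = f x powr (4 / 3)" for x using fD(2) by (cases "f x = 0") (auto simp: c_def powr_power)
    \<comment> \<open>The defect in Young's inequality for \<open>q x / m\<close> and the cube root
      of \<open>f x\<close>. The three integrals above bound its integral by 1 + 3 - 4 = 0, so it
      vanishes almost everywhere.\<close>
    define D where "D x = (q x / m) ^ 4 + 3 * c x ^ 4 - 4 * (q x / m * c x ^ 3)" for x
    have D': "D x = (1 / m ^ 4) * q x ^ 4 + 3 * f x powr (4 / 3) - (4 / m) * (f x * q x)" for x
      unfolding D_def c3 c4 by (simp add: power_divide)
    have Di: "integrable lborel D" unfolding D'[abs_def] using q4i f43 fq by auto
    have "(LINT x|lborel. D x) = (1 / m ^ 4) * (LINT x|lborel. q x ^ 4) + 3 * (LINT x|lborel. f x powr (4 / 3)) - (4 / m) * (LINT x|lborel. f x * q x)"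
      unfolding D' using q4i f43 fq by simp
    also have "\<dots> \<le> (1 / m ^ 4) * m ^ 4 + 3 * 1 - (4 / m) * m"
      unfolding fq(2) using q4i(2) f43(2) m0 by (intro diff_mono add_mono mult_left_mono) auto
    also have "\<dots> = 0" using m0 by simp
    finally have "(LINT x|lborel. D x) \<le> 0" .
    moreover have Dn: "0 \<le> D x" for x unfolding D_def by (rule young_quartic)
    then have "0 \<le> (LINT x|lborel. D x)" by (intro integral_nonneg_AE) simp
    ultimately have "(LINT x|lborel. D x) = 0" by simp
    then have "AE x in lborel. D x = 0"
      using integral_nonneg_eq_0_iff_AE[OF Di] Dn by auto
    then show ?thesis
    proof eventually_elim
      fix x assume "D x = 0"
      then have "q x / m = c x" unfolding D_def by (rule young_quartic)
      then show "f x = p x" using c3[of x] by (simp add: p_def)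
    qed
  qed
  \<comment> \<open>The resolvent ignores null sets, so this equation holds at every point, 0
    included.\<close>
  have qp: "ennreal (q x) = resolvent (\<lambda>y. ennreal (p y)) x" for x
    unfolding q using fp by (intro resolvent_cong_AE) (auto elim!: eventually_mono)
  \<comment> \<open>Bootstrap to integrability: q in L^4 gives p in L^2, hence q in L^2, hence p in
    L^1, hence q in L^1. Surplus powers of q are absorbed by the bound \<open>q 0\<close>.\<close>
  have p2: "(\<integral>\<^sup>+x. ennreal ((p x)\<^sup>2) \<partial>lborel) < \<infinity>"
  proof -
    have "(p x)\<^sup>2 \<le> (q 0)\<^sup>2 / m ^ 6 * q x ^ 4" for x
    proof -
      have "(p x)\<^sup>2 = (q x)\<^sup>2 * q x ^ 4 / m ^ 6" by (simp add: p_def power_divide flip: power_mult power_add)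
      also have "\<dots> \<le> (q 0)\<^sup>2 * q x ^ 4 / m ^ 6"
        using q_le q0 m0 by (intro divide_right_mono mult_right_mono power_mono) auto
      finally show ?thesis by simp
    qed
    then have "(\<integral>\<^sup>+x. ennreal ((p x)\<^sup>2) \<partial>lborel) \<le> (\<integral>\<^sup>+x. ennreal ((q 0)\<^sup>2 / m ^ 6) * ennreal (q x ^ 4) \<partial>lborel)"
      using m0 by (intro nn_integral_mono) (auto simp flip: ennreal_mult intro!: ennreal_leI)
    also have "\<dots> < \<infinity>" using q4 by (subst nn_integral_cmult) (auto simp: ennreal_mult_less_top intro: le_less_trans)
    finally show ?thesis .
  qed
  have q2: "(\<integral>\<^sup>+x. ennreal ((q x)\<^sup>2) \<partial>lborel) < \<infinity>"
  proof -
    have "ennreal ((q x)\<^sup>2) \<le> resolvent (\<lambda>y. ennreal ((p y)\<^sup>2)) x" for x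
    proof -
      have "2 * (ennreal (q x) * ennreal (q x)) \<le> ennreal ((q x)\<^sup>2) + resolvent (\<lambda>y. ennreal ((p y)\<^sup>2)) x"
        using resolvent_young[of p "q x" x] p0 q0 by (simp add: qp[symmetric])
      also have "2 * (ennreal (q x) * ennreal (q x)) = ennreal ((q x)\<^sup>2) + ennreal ((q x)\<^sup>2)"
        using q0 by (simp add: mult_2 power2_eq_square flip: ennreal_mult)
      finally show ?thesis by (simp add: ennreal_add_left_cancel_le)
    qed
    then have "(\<integral>\<^sup>+x. ennreal ((q x)\<^sup>2) \<partial>lborel) \<le> (\<integral>\<^sup>+x. resolvent (\<lambda>y. ennreal ((p y)\<^sup>2)) x \<partial>lborel)"
      by (intro nn_integral_mono)
    also have "\<dots> < \<infinity>" using p2 by (subst nn_integral_resolvent) auto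
    finally show ?thesis .
  qed
  have q1: "(\<integral>\<^sup>+x. ennreal (q x) \<partial>lborel) < \<infinity>"
  proof -
    have "p x \<le> q 0 / m ^ 3 * (q x)\<^sup>2" for x
    proof -
      have "p x = q x * (q x)\<^sup>2 / m ^ 3" by (simp add: p_def power_divide power3_eq_cube power2_eq_square)
      also have "\<dots> \<le> q 0 * (q x)\<^sup>2 / m ^ 3"
        using q_le m0 by (intro divide_right_mono mult_right_mono) auto
      finally show ?thesis by simp
    qed
    then have "(\<integral>\<^sup>+x. ennreal (p x) \<partial>lborel) \<le> (\<integral>\<^sup>+x. ennreal (q 0 / m ^ 3) * ennreal ((q x)\<^sup>2) \<partial>lborel)"
      using m0 q0 by (intro nn_integral_mono) (auto simp flip: ennreal_mult intro!: ennreal_leI)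
    also have "\<dots> < \<infinity>" using q2 by (subst nn_integral_cmult) (auto simp: ennreal_mult_less_top)
    finally have "(\<integral>\<^sup>+x. ennreal (p x) \<partial>lborel) < \<infinity>" .
    then show ?thesis unfolding qp by (subst nn_integral_resolvent) auto
  qed
  \<comment> \<open>Chosen with \<open>k^2 = m^3\<close>, the condition under which
    \<open>q / k\<close> solves the cubic equation with coefficient 1.\<close>
  define k where "k = m powr (3 / 2)"
  have k: "0 < k" "k\<^sup>2 = m ^ 3" using m0 by (auto simp: k_def powr_power)
  define R where "R x = q x / k" for x
  show ?thesis
  proof
    show "R \<in> borel_measurable borel" unfolding R_def[abs_def] by measurable
    show "0 \<le> R x" for x using q0 k by (simp add: R_def)
    show "R y \<le> R x" if "\<bar>x\<bar> \<le> \<bar>y\<bar>" for x y using q_dec[OF that] k by (simp add: R_def divide_right_mono)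
    have "integrable lborel q" using q1 q0 by (intro integrableI_bounded) auto
    then show "integrable lborel R" unfolding R_def[abs_def] by auto
    have "q 0 \<noteq> 0"
    proof
      assume "q 0 = 0"
      then have "q x = 0" for x using q_le[of x] q0[of x] by simp
      then show False using fq m0 by simp
    qed
    then show "0 < R 0" using q0[of 0] k by (simp add: R_def)
    fix x
    have "R y ^ 3 = (1 / k) * p y" for y
    proof -
      have "R y ^ 3 = q y ^ 3 / (k * k\<^sup>2)" by (simp add: R_def power_divide power3_eq_cube power2_eq_square)
      then show ?thesis using k by (simp add: p_def power_divide)
    qed
    then have "resolvent (\<lambda>y. ennreal (R y ^ 3)) x = resolvent (\<lambda>y. ennreal (1 / k) * ennreal (p y)) x"
      using k p0 by (simp flip: ennreal_mult)
    also have "\<dots> = ennreal (1 / k) * ennreal (q x)" by (simp add: resolvent_cmult qp)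
    also have "\<dots> = ennreal (R x)" using k q0 by (simp add: R_def flip: ennreal_mult)
    finally show "ennreal (R x) = resolvent (\<lambda>y. ennreal (R y ^ 3)) x" ..
  qed
qed

section \<open>Standing waves\<close>

text \<open>Valid at 0 too, where the kernel is infinite: \<open>enn2real\<close> and the Bochner
  integral both default to 0.\<close>

lemma res_kernel_real_integral:
  "enn2real (res_kernel x) = (LINT s|lborel. indicator {0<..} s * (exp (- s) * poisson s x))"
proof -
  have "res_kernel x = (\<integral>\<^sup>+s. ennreal (indicator {0<..} s * (exp (- s) * poisson s x)) \<partial>lborel)"
    unfolding res_kernel_def by (intro nn_integral_cong) (auto simp: indicator_def)
  then show ?thesis
    by (subst integral_eq_nn_integral) (auto simp: indicator_def poisson_nonneg)
qed

lemma res_kernel_ennreal: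
  assumes "x \<noteq> 0"
  shows "ennreal (enn2real (res_kernel x)) = res_kernel x"
  using res_kernel_finite[OF assms] by simp

lemma integrable_res_kernel: "integrable lborel (\<lambda>x. enn2real (res_kernel x))"
  "(LINT x|lborel. enn2real (res_kernel x)) = 1"
proof -
  have "AE x in lborel. x \<noteq> (0::real)" by (rule AE_lborel_singleton)
  then have "AE x in lborel. ennreal (enn2real (res_kernel x)) = res_kernel x"
    by eventually_elim (rule res_kernel_ennreal)
  then have 1: "(\<integral>\<^sup>+x. ennreal (enn2real (res_kernel x)) \<partial>lborel) = 1"
    unfolding nn_integral_res_kernel[symmetric] by (rule nn_integral_cong_AE)
  show "integrable lborel (\<lambda>x. enn2real (res_kernel x))"
    using 1 by (intro integrableI_bounded) auto
  show "(LINT x|lborel. enn2real (res_kernel x)) = 1"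
    using 1 by (subst integral_eq_nn_integral) auto
qed

text \<open>Fubini applies because the integrand has modulus \<open>exp (- s) * poisson s x\<close>,
  of total mass 1 over s > 0. The inner transform is \<open>exp (- s * |\<xi>|)\<close>, and
  integration over s produces the symbol.\<close>

lemma fourier_res_kernel:
  "fourier (\<lambda>x. of_real (enn2real (res_kernel x))) \<xi> = 1 / of_real (1 + \<bar>\<xi>\<bar>)"
proof -
  define g where "g s x = exp (- \<i> * of_real (x * \<xi>)) * complex_of_real (indicator {0<..} s * (exp (- s) * poisson s x))" for s x
  have ng: "norm (g s x) = indicator {0<..} s * (exp (- s) * poisson s x)" for s x
    by (auto simp: g_def norm_mult norm_exp_i_real indicator_def poisson_nonneg simp del: of_real_mult)
  have [measurable]: "(\<lambda>(s, x). g s x) \<in> borel_measurable (borel \<Otimes>\<^sub>M borel)" "g s \<in> borel_measurable borel" for s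
    unfolding g_def by measurable
  have e: "integrable lborel (\<lambda>s. indicator {0<..} s *\<^sub>R exp (- s) :: real)"
    using nn_integral_exp by (intro integrableI_bounded) (auto simp: ennreal_mult ennreal_indicator)
  have P: "integrable lborel (poisson s)" "(LINT x|lborel. poisson s x) = 1" if "s > 0" for s
    using poisson_has_integral[OF that] by (auto simp: has_bochner_integral_iff)
  have gi: "integrable lborel (\<lambda>x. g s x)" for s
  proof (cases "s > 0")
    case True
    have "integrable lborel (\<lambda>x. indicator {0<..} s * (exp (- s) * poisson s x))" using P[OF True] by auto
    then show ?thesis
      by (rule Bochner_Integration.integrable_bound) (auto simp: ng poisson_nonneg indicator_def)
  qed (simp add: g_def)
  have "integrable (lborel \<Otimes>\<^sub>M lborel) (\<lambda>(s, x). g s x)"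
  proof (rule lborel_pair.Fubini_integrable)
    have "(LINT x|lborel. norm (case (s, x) of (s, x) \<Rightarrow> g s x)) = indicator {0<..} s *\<^sub>R exp (- s)" for s
      by (cases "s > 0") (auto simp: ng P)
    then show "integrable lborel (\<lambda>s. LINT x|lborel. norm (case (s, x) of (s, x) \<Rightarrow> g s x))" using e by simp
  qed (use gi in auto)
  then have fub: "(LINT x|lborel. LINT s|lborel. g s x) = (LINT s|lborel. LINT x|lborel. g s x)"
    by (rule lborel_pair.Fubini_integral)
  have "fourier (\<lambda>x. of_real (enn2real (res_kernel x))) \<xi> = (LINT x|lborel. LINT s|lborel. g s x)"
    by (subst fourier_lborel) (auto simp: res_kernel_real_integral g_def simp del: of_real_mult simp flip: integral_complex_of_real)
  also have "\<dots> = (LINT s|lborel. LINT x|lborel. g s x)" by (rule fub)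
  also have "\<dots> = (LINT s|lborel. indicator {0<..} s *\<^sub>R exp (- of_real (1 + \<bar>\<xi>\<bar>) * complex_of_real s))"
  proof (intro Bochner_Integration.integral_cong refl)
    fix s :: real
    show "(LINT x|lborel. g s x) = indicator {0<..} s *\<^sub>R exp (- of_real (1 + \<bar>\<xi>\<bar>) * complex_of_real s)"
    proof (cases "s > 0")
      case True
      have "(LINT x|lborel. g s x) = (LINT x|lborel. of_real (exp (- s)) * (exp (- \<i> * of_real (x * \<xi>)) * complex_of_real (poisson s x)))"
        using True by (intro Bochner_Integration.integral_cong) (auto simp: g_def)
      also have "\<dots> = of_real (exp (- s)) * fourier (\<lambda>x. of_real (poisson s x)) \<xi>"
        by (subst fourier_lborel) auto
      also have "\<dots> = of_real (exp (- s) * exp (- s * \<bar>\<xi>\<bar>))"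
        unfolding fourier_poisson[OF True] by simp
      also have "exp (- s) * exp (- s * \<bar>\<xi>\<bar>) = exp (- (1 + \<bar>\<xi>\<bar>) * s)"
        unfolding exp_add[symmetric] by (simp add: algebra_simps)
      also have "complex_of_real \<dots> = exp (- of_real (1 + \<bar>\<xi>\<bar>) * complex_of_real s)"
        unfolding exp_of_real[symmetric] by simp
      finally show ?thesis using True by simp
    qed (simp add: g_def)
  qed
  also have "\<dots> = 1 / of_real (1 + \<bar>\<xi>\<bar>)"
    using exp_halfline_integral[of "of_real (1 + \<bar>\<xi>\<bar>)"] by (simp add: has_bochner_integral_iff add_pos_nonneg)
  finally show ?thesis .
qed

text \<open>The convolution theorem for the resolvent kernel. It turns the pointwise integral
  equation into the symbol equation behind the weak formulation and the Sobolev bound.\<close>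

lemma fourier_resolvent:
  fixes R p :: "real \<Rightarrow> real"
  assumes p: "integrable lborel p" "\<And>x. 0 \<le> p x" and R: "\<And>x. 0 \<le> R x"
    and eq: "\<And>x. ennreal (R x) = resolvent (\<lambda>y. ennreal (p y)) x"
  shows "of_real (1 + \<bar>\<xi>\<bar>) * fourier (\<lambda>x. of_real (R x)) \<xi> = fourier (\<lambda>x. of_real (p x)) \<xi>"
proof -
  define k where "k x = enn2real (res_kernel x)" for x
  have [measurable]: "p \<in> borel_measurable borel" "k \<in> borel_measurable borel" using p unfolding k_def[abs_def] by auto
  have k0: "0 \<le> k x" for x by (simp add: k_def)
  have ki: "integrable lborel k" "(LINT x|lborel. k x) = 1" using integrable_res_kernel by (auto simp: k_def[abs_def])
  have R_eq: "R x = (LINT y|lborel. k (x - y) * p y)" for x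
  proof -
    have "resolvent (\<lambda>y. ennreal (p y)) x = (\<integral>\<^sup>+y. ennreal (k (x - y) * p y) \<partial>lborel)"
      unfolding resolvent_def
    proof (rule nn_integral_cong_AE)
      have "AE y in lborel. y \<noteq> x" by (rule AE_lborel_singleton)
      then show "AE y in lborel. res_kernel (x - y) * ennreal (p y) = ennreal (k (x - y) * p y)"
        by eventually_elim (use p in \<open>auto simp: k_def res_kernel_ennreal ennreal_mult\<close>)
    qed
    moreover have "(LINT y|lborel. k (x - y) * p y) = enn2real (\<integral>\<^sup>+y. ennreal (k (x - y) * p y) \<partial>lborel)"
      using p k0 by (intro integral_eq_nn_integral) auto
    ultimately have "(LINT y|lborel. k (x - y) * p y) = enn2real (ennreal (R x))" by (simp add: eq)
    then show ?thesis using R by simp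
  qed
  have [measurable]: "R \<in> borel_measurable borel" unfolding R_eq[abs_def] by measurable
  define g where "g y x = exp (- \<i> * of_real (x * \<xi>)) * complex_of_real (k (x - y) * p y)" for y x
  have ng: "norm (g y x) = k (x - y) * p y" for y x
    using k0 p by (auto simp: g_def norm_mult norm_exp_i_real abs_mult simp del: of_real_mult)
  have [measurable]: "(\<lambda>(y, x). g y x) \<in> borel_measurable (borel \<Otimes>\<^sub>M borel)" "g y \<in> borel_measurable borel" for y
    unfolding g_def by measurable
  have ks: "integrable lborel (\<lambda>x. k (x - y))" "(LINT x|lborel. k (x - y)) = 1" for y
    using ki lborel_integrable_real_affine[OF ki(1), of 1 "-y"] lborel_integral_real_affine[of 1 k "-y"] by auto
  have gi: "integrable lborel (\<lambda>x. g y x)" for y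
  proof -
    have "integrable lborel (\<lambda>x. k (x - y) * p y)" using ks by auto
    then show ?thesis by (rule Bochner_Integration.integrable_bound) (auto simp: ng k0 p)
  qed
  have "integrable (lborel \<Otimes>\<^sub>M lborel) (\<lambda>(y, x). g y x)"
  proof (rule lborel_pair.Fubini_integrable)
    show "integrable lborel (\<lambda>y. LINT x|lborel. norm (case (y, x) of (y, x) \<Rightarrow> g y x))"
      using p by (simp add: ng ks)
  qed (use gi in auto)
  then have fub: "(LINT x|lborel. LINT y|lborel. g y x) = (LINT y|lborel. LINT x|lborel. g y x)"
    by (rule lborel_pair.Fubini_integral)
  have "fourier (\<lambda>x. of_real (R x)) \<xi> = (LINT x|lborel. exp (- \<i> * of_real (x * \<xi>)) * of_real (LINT y|lborel. k (x - y) * p y))"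
    by (subst fourier_lborel) (auto simp flip: R_eq)
  also have "\<dots> = (LINT x|lborel. LINT y|lborel. g y x)"
    by (simp only: integral_complex_of_real[symmetric] integral_mult_right_zero[symmetric] g_def)
  also have "\<dots> = (LINT y|lborel. LINT x|lborel. g y x)" by (rule fub)
  also have "\<dots> = (LINT y|lborel. fourier (\<lambda>x. of_real (k x)) \<xi> * (exp (- \<i> * of_real (y * \<xi>)) * of_real (p y)))"
  proof (intro Bochner_Integration.integral_cong refl)
    fix y
    have "(LINT x|lborel. g y x) = (LINT x|lborel. g y (y + x))"
      using lborel_integral_real_affine[of 1 "g y" y] by simp
    also have "\<dots> = (LINT x|lborel. exp (- \<i> * of_real (x * \<xi>)) * of_real (k x) * (exp (- \<i> * of_real (y * \<xi>)) * of_real (p y)))"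
    proof (intro Bochner_Integration.integral_cong refl)
      fix x
      have "exp (- \<i> * of_real ((y + x) * \<xi>)) = exp (- \<i> * of_real (x * \<xi>)) * exp (- \<i> * of_real (y * \<xi>))"
        unfolding exp_add[symmetric] by (simp add: algebra_simps)
      then show "g y (y + x) = exp (- \<i> * of_real (x * \<xi>)) * of_real (k x) * (exp (- \<i> * of_real (y * \<xi>)) * of_real (p y))"
        unfolding g_def by simp
    qed
    also have "\<dots> = fourier (\<lambda>x. of_real (k x)) \<xi> * (exp (- \<i> * of_real (y * \<xi>)) * of_real (p y))"
      by (subst fourier_lborel) auto
    finally show "(LINT x|lborel. g y x) = fourier (\<lambda>x. of_real (k x)) \<xi> * (exp (- \<i> * of_real (y * \<xi>)) * of_real (p y))" .
  qed
  also have "\<dots> = fourier (\<lambda>x. of_real (k x)) \<xi> * fourier (\<lambda>x. of_real (p x)) \<xi>"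
    by (simp add: fourier_lborel[of "\<lambda>x. of_real (p x)"])
  also have "fourier (\<lambda>x. of_real (k x)) \<xi> = 1 / of_real (1 + \<bar>\<xi>\<bar>)"
    unfolding k_def by (rule fourier_res_kernel)
  finally have "fourier (\<lambda>x. of_real (R x)) \<xi> = 1 / of_real (1 + \<bar>\<xi>\<bar>) * fourier (\<lambda>x. of_real (p x)) \<xi>" .
  moreover have "complex_of_real (1 + \<bar>\<xi>\<bar>) \<noteq> 0" unfolding of_real_eq_0_iff by (simp add: add_nonneg_eq_0_iff)
  ultimately show ?thesis by (simp del: of_real_add)
qed

text \<open>Only the phase moves, so continuity in time and the time derivative reduce to those of
  \<open>exp (\<i> * l * t)\<close>. Membership in H^(1/2) comes from the equation: the transform of
  Q is that of Q^3 divided by l + |\<xi>|, and Q^3 lies in L^1 and L^2.\<close>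

lemma bound_state_solution:
  fixes Q :: "real \<Rightarrow> real"
  assumes l: "0 < l" and Q: "integrable lborel Q" and B: "\<And>x. \<bar>Q x\<bar> \<le> B"
    and eq: "\<And>\<xi>. of_real (l + \<bar>\<xi>\<bar>) * fourier (\<lambda>x. of_real (Q x)) \<xi> = fourier (\<lambda>x. of_real (Q x ^ 3)) \<xi>"
  shows "halfwave_solution (\<lambda>t x. exp (\<i> * of_real (l * t)) * of_real (Q x))"
proof -
  let ?c = "\<lambda>t. exp (\<i> * complex_of_real (l * t))"
  define F where "F = fourier (\<lambda>x. complex_of_real (Q x))"
  define G where "G = fourier (\<lambda>x. complex_of_real (Q x ^ 3))"
  have [measurable]: "Q \<in> borel_measurable borel" using Q by auto
  have [measurable]: "F \<in> borel_measurable borel" "G \<in> borel_measurable borel" unfolding F_def G_def by measurable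
  have pow: "integrable lborel (\<lambda>x. Q x ^ Suc n)" for n
  proof (rule Bochner_Integration.integrable_bound[where f="\<lambda>x. B ^ n * \<bar>Q x\<bar>"])
    show "integrable lborel (\<lambda>x. B ^ n * \<bar>Q x\<bar>)" using Q by auto
    have "norm (Q x ^ Suc n) \<le> norm (B ^ n * \<bar>Q x\<bar>)" for x
    proof -
      have "norm (Q x ^ Suc n) = \<bar>Q x\<bar> ^ Suc n" unfolding real_norm_def by (rule power_abs)
      also have "\<dots> \<le> B ^ n * \<bar>Q x\<bar>"
        using mult_right_mono[OF power_mono[OF B[of x] abs_ge_zero, of n], of "\<bar>Q x\<bar>"] by (simp add: mult.commute)
      also have "\<dots> \<le> norm (B ^ n * \<bar>Q x\<bar>)" unfolding real_norm_def by (rule abs_ge_self)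
      finally show ?thesis .
    qed
    then show "AE x in lborel. norm (Q x ^ Suc n) \<le> norm (B ^ n * \<bar>Q x\<bar>)" by simp
  qed simp
  \<comment> \<open>The sixth power is the square of the cube and serves the L^2 bound on the
    transform of Q^3.\<close>
  have Q2: "integrable lborel (\<lambda>x. (Q x)\<^sup>2)" and Q3: "integrable lborel (\<lambda>x. Q x ^ 3)" and Q6: "integrable lborel (\<lambda>x. Q x ^ 6)"
    using pow[of 1] pow[of 2] pow[of 5] by (simp_all add: numeral_eq_Suc)
  have Qc: "integrable lborel (\<lambda>x. complex_of_real (Q x))" and Q3c: "integrable lborel (\<lambda>x. complex_of_real (Q x ^ 3))"
    using Q Q3 by (auto intro: integrable_of_real simp del: of_real_power)
  have G2: "integrable lborel (\<lambda>\<xi>. (norm (G \<xi>))\<^sup>2)"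
    unfolding G_def
  proof (rule fourier_square_integrable[OF Q3c])
    have "(cmod (of_real (Q x ^ 3)))\<^sup>2 = Q x ^ 6" for x
      unfolding norm_of_real power2_abs by (simp flip: power_mult)
    then show "integrable lborel (\<lambda>x. (cmod (of_real (Q x ^ 3)))\<^sup>2)" using Q6 by (simp only:)
  qed
  have FG: "norm (F \<xi>) = norm (G \<xi>) / (l + \<bar>\<xi>\<bar>)" for \<xi>
  proof -
    have "norm (complex_of_real (l + \<bar>\<xi>\<bar>) * F \<xi>) = norm (G \<xi>)" using eq by (simp add: F_def G_def)
    then show ?thesis using l by (simp add: norm_mult field_simps del: of_real_add)
  qed
  have F2: "integrable lborel (\<lambda>\<xi>. sqrt (1 + \<xi>\<^sup>2) * (norm (F \<xi>))\<^sup>2)"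
  proof (rule Bochner_Integration.integrable_bound[where f="\<lambda>\<xi>. (1 + 1 / l) * (1 / l) * (norm (G \<xi>))\<^sup>2"])
    \<comment> \<open>One factor \<open>1 / (l + |\<xi>|)\<close> absorbs the Sobolev weight, the
      other is bounded by 1/l.\<close>
    have "sqrt (1 + \<xi>\<^sup>2) * (norm (F \<xi>))\<^sup>2 \<le> (1 + 1 / l) * (1 / l) * (norm (G \<xi>))\<^sup>2" for \<xi>
    proof -
      have "sqrt (1 + \<xi>\<^sup>2) \<le> 1 + \<bar>\<xi>\<bar>" by (rule real_le_lsqrt) (auto simp: power2_eq_square algebra_simps)
      also have "\<dots> \<le> (1 + 1 / l) * (l + \<bar>\<xi>\<bar>)" using l by (simp add: field_simps)
      finally have 1: "sqrt (1 + \<xi>\<^sup>2) / (l + \<bar>\<xi>\<bar>) \<le> 1 + 1 / l" using l by (simp add: pos_divide_le_eq add_pos_nonneg)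
      have 2: "1 / (l + \<bar>\<xi>\<bar>) \<le> 1 / l" using l by (simp add: frac_le)
      have "sqrt (1 + \<xi>\<^sup>2) * (norm (F \<xi>))\<^sup>2 = sqrt (1 + \<xi>\<^sup>2) / (l + \<bar>\<xi>\<bar>) * (1 / (l + \<bar>\<xi>\<bar>)) * (norm (G \<xi>))\<^sup>2"
        unfolding FG by (simp add: power_divide power2_eq_square)
      also have "\<dots> \<le> (1 + 1 / l) * (1 / l) * (norm (G \<xi>))\<^sup>2"
        using l 1 2 by (intro mult_right_mono mult_mono) auto
      finally show ?thesis .
    qed
    then show "AE \<xi> in lborel. norm (sqrt (1 + \<xi>\<^sup>2) * (norm (F \<xi>))\<^sup>2) \<le> norm ((1 + 1 / l) * (1 / l) * (norm (G \<xi>))\<^sup>2)"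
      using l by (simp add: abs_mult)
  qed (use G2 in auto)
  have F2': "integrable lebesgue (\<lambda>\<xi>. sqrt (1 + \<xi>\<^sup>2) * (norm (F \<xi>))\<^sup>2)"
    using F2 by (subst integrable_completion) auto
  have isF: "is_fourier (\<lambda>x. c * of_real (Q x)) (\<lambda>\<xi>. c * F \<xi>)" for c
  proof -
    have "is_fourier (\<lambda>x. c * of_real (Q x)) (fourier (\<lambda>x. c * of_real (Q x)))"
      using Qc by (intro is_fourier_fourier) auto
    moreover have "fourier (\<lambda>x. c * of_real (Q x)) = (\<lambda>\<xi>. c * F \<xi>)"
      unfolding F_def by (auto simp: fourier_lborel mult.left_commute[of _ c])
    ultimately show ?thesis by simp
  qed
  have H12: "H12 (\<lambda>x. c * of_real (Q x))" for c
    unfolding H12_def L2_def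
  proof (intro conjI exI)
    show "(\<lambda>x. c * of_real (Q x)) \<in> borel_measurable lebesgue" by (intro measurable_completion) simp
    show "integrable lebesgue (\<lambda>x. (cmod (c * of_real (Q x)))\<^sup>2)"
      using Q2 by (subst integrable_completion) (auto simp: norm_mult power_mult_distrib)
    show "is_fourier (\<lambda>x. c * of_real (Q x)) (\<lambda>\<xi>. c * F \<xi>)" by (rule isF)
    have "integrable lebesgue (\<lambda>\<xi>. (norm c)\<^sup>2 * (sqrt (1 + \<xi>\<^sup>2) * (norm (F \<xi>))\<^sup>2))" using F2' by auto
    then show "integrable lebesgue (\<lambda>\<xi>. sqrt (1 + \<xi>\<^sup>2) * (cmod (c * F \<xi>))\<^sup>2)"
      by (simp add: norm_mult power_mult_distrib mult.left_commute)
  qed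
  have H12n: "H12_norm (\<lambda>x. c * of_real (Q x)) = norm c * sqrt (LINT \<xi>|lebesgue. sqrt (1 + \<xi>\<^sup>2) * (norm (F \<xi>))\<^sup>2)" for c
    unfolding H12_norm_eq[OF isF]
    by (simp add: norm_mult power_mult_distrib mult.left_commute[of _ "(norm c)\<^sup>2"] real_sqrt_mult)
  have weak: "(LINT x|lebesgue. of_real (Q x) * absD (\<lambda>y. of_real (\<psi> y)) x)
      = (LINT x|lebesgue. of_real (Q x ^ 3) * of_real (\<psi> x)) - of_real l * (LINT x|lebesgue. of_real (Q x) * of_real (\<psi> x))"
    if t: "test_fun \<psi>" for \<psi>
  proof -
    have [measurable]: "\<psi> \<in> borel_measurable borel" by (rule test_fun_integrable[OF t])
    have [measurable]: "(\<lambda>x. absD (\<lambda>y. of_real (\<psi> y)) x) \<in> borel_measurable borel"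
      unfolding absD_def by (subst lebesgue_integral_lborel) measurable
    show ?thesis
      using absD_weak[OF Qc Q3c eq t] by (simp add: lebesgue_integral_lborel del: of_real_power)
  qed
  show ?thesis
    unfolding halfwave_solution_def
  proof (intro conjI allI impI)
    fix t
    show "H12 (\<lambda>x. ?c t * of_real (Q x))" by (rule H12)
    have "((\<lambda>s. norm (?c s - ?c t) * sqrt (LINT \<xi>|lebesgue. sqrt (1 + \<xi>\<^sup>2) * (norm (F \<xi>))\<^sup>2))
        \<longlongrightarrow> norm (?c t - ?c t) * sqrt (LINT \<xi>|lebesgue. sqrt (1 + \<xi>\<^sup>2) * (norm (F \<xi>))\<^sup>2)) (at t)"
      by (intro tendsto_intros)
    then show "((\<lambda>s. H12_norm (\<lambda>x. ?c s * of_real (Q x) - ?c t * of_real (Q x))) \<longlongrightarrow> 0) (at t)"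
      by (simp only: left_diff_distrib[symmetric] H12n) simp
    fix \<psi> assume \<psi>: "test_fun \<psi>"
    define a where "a = (LINT x|lebesgue. of_real (Q x) * complex_of_real (\<psi> x))"
    define b where "b = (LINT x|lebesgue. of_real (Q x) * absD (\<lambda>y. of_real (\<psi> y)) x)"
    define d where "d = (LINT x|lebesgue. of_real (Q x ^ 3) * complex_of_real (\<psi> x))"
    have bd: "b = d - of_real l * a" using weak[OF \<psi>] by (simp add: a_def b_def d_def)
    have n1: "norm (?c t) = 1" by (rule norm_exp_i_real)
    have "((\<lambda>z. exp (\<i> * (of_real l * z)) * a) has_field_derivative (\<i> * of_real l * exp (\<i> * (of_real l * of_real t))) * a) (at (of_real t))"
      by (auto intro!: derivative_eq_intros)
    from has_vector_derivative_real_field[OF this]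
    have der: "((\<lambda>s. ?c s * a) has_vector_derivative (\<i> * of_real l * ?c t) * a) (at t)" by simp
    have 1: "(LINT x|lebesgue. ?c s * of_real (Q x) * of_real (\<psi> x)) = ?c s * a" for s
      unfolding a_def by (simp add: mult.assoc)
    have 2: "(LINT x|lebesgue. ?c t * of_real (Q x) * absD (\<lambda>y. of_real (\<psi> y)) x) = ?c t * b"
      unfolding b_def by (simp add: mult.assoc)
    have 3: "(LINT x|lebesgue. of_real ((cmod (?c t * of_real (Q x)))\<^sup>2) * (?c t * of_real (Q x)) * of_real (\<psi> x)) = ?c t * d"
    proof -
      have "of_real ((cmod (?c t * of_real (Q x)))\<^sup>2) * (?c t * of_real (Q x)) * of_real (\<psi> x) = ?c t * (of_real (Q x ^ 3) * of_real (\<psi> x))" for x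
        unfolding norm_mult n1 by (simp add: power3_eq_cube power2_eq_square)
      then show ?thesis unfolding d_def by (simp only: integral_mult_right_zero)
    qed
    have "- \<i> * (?c t * b - ?c t * d) = (\<i> * of_real l * ?c t) * a" unfolding bd by (simp add: algebra_simps)
    then show "((\<lambda>s. LINT x|lebesgue. ?c s * of_real (Q x) * of_real (\<psi> x)) has_vector_derivative
        - \<i> * ((LINT x|lebesgue. ?c t * of_real (Q x) * absD (\<lambda>y. of_real (\<psi> y)) x)
          - (LINT x|lebesgue. of_real ((cmod (?c t * of_real (Q x)))\<^sup>2) * (?c t * of_real (Q x)) * of_real (\<psi> x)))) (at t)"
      unfolding 1 2 3 using der by simp
  qed
qed

section \<open>Scaling and the two waves\<close>

lemma fourier_dilation:
  fixes g :: "real \<Rightarrow> real"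
  assumes [measurable]: "g \<in> borel_measurable borel" and l: "0 < l"
  shows "fourier (\<lambda>x. of_real (c * g (l * x))) \<xi> = of_real (c / l) * fourier (\<lambda>x. of_real (g x)) (\<xi> / l)"
proof -
  have "fourier (\<lambda>x. of_real (g x)) (\<xi> / l) = (LINT x|lborel. exp (- \<i> * of_real (x * (\<xi> / l))) * of_real (g x))"
    by (rule fourier_lborel) measurable
  also have "\<dots> = l *\<^sub>R (LINT x|lborel. exp (- \<i> * of_real (x * \<xi>)) * of_real (g (l * x)))"
    using l by (subst lborel_integral_real_affine[where c=l and t=0]) auto
  finally have 1: "fourier (\<lambda>x. of_real (g x)) (\<xi> / l) = l *\<^sub>R (LINT x|lborel. exp (- \<i> * of_real (x * \<xi>)) * of_real (g (l * x)))" .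
  have "fourier (\<lambda>x. of_real (c * g (l * x))) \<xi> = (LINT x|lborel. of_real c * (exp (- \<i> * of_real (x * \<xi>)) * of_real (g (l * x))))"
    by (subst fourier_lborel) (auto simp: mult.left_commute)
  then show ?thesis unfolding 1 using l by (simp add: scaleR_conv_of_real)
qed

text \<open>Cubing \<open>sqrt l * R (l * x)\<close> produces the factor \<open>l * sqrt l\<close>,
  and the symbol \<open>1 + |\<xi> / l|\<close> equals \<open>(l + |\<xi>|) / l\<close>, so the
  powers of l match.\<close>

lemma rescaled_solution:
  fixes R :: "real \<Rightarrow> real"
  assumes R: "integrable lborel R" and B: "\<And>x. \<bar>R x\<bar> \<le> B" and l: "0 < l"
    and eq: "\<And>\<xi>. of_real (1 + \<bar>\<xi>\<bar>) * fourier (\<lambda>x. of_real (R x)) \<xi> = fourier (\<lambda>x. of_real (R x ^ 3)) \<xi>"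
  shows "halfwave_solution (\<lambda>t x. exp (\<i> * of_real (l * t)) * of_real (sqrt l * R (l * x)))"
proof (rule bound_state_solution[OF l])
  have [measurable]: "R \<in> borel_measurable borel" using R by auto
  show "integrable lborel (\<lambda>x. sqrt l * R (l * x))"
    using lborel_integrable_real_affine[OF R, of l 0] l by auto
  show "\<bar>sqrt l * R (l * x)\<bar> \<le> sqrt l * B" for x
    using B l by (simp add: abs_mult mult_left_mono)
  fix \<xi>
  have "(sqrt l * R (l * x)) ^ 3 = l * sqrt l * R (l * x) ^ 3" for x
    using l by (simp add: power_mult_distrib power3_eq_cube)
  then have "fourier (\<lambda>x. of_real ((sqrt l * R (l * x)) ^ 3)) \<xi> = of_real (l * sqrt l / l) * fourier (\<lambda>x. of_real (R x ^ 3)) (\<xi> / l)"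
    using fourier_dilation[of "\<lambda>x. R x ^ 3" l "l * sqrt l" \<xi>] l by (simp only:) simp
  also have "\<dots> = of_real (sqrt l) * (of_real (1 + \<bar>\<xi> / l\<bar>) * fourier (\<lambda>x. of_real (R x)) (\<xi> / l))"
    unfolding eq using l by simp
  also have "\<dots> = of_real (l + \<bar>\<xi>\<bar>) * (of_real (sqrt l / l) * fourier (\<lambda>x. of_real (R x)) (\<xi> / l))"
  proof -
    have "sqrt l * (1 + \<bar>\<xi> / l\<bar>) = (l + \<bar>\<xi>\<bar>) * (sqrt l / l)" using l by (simp add: field_simps)
    then show ?thesis by (simp only: mult.assoc[symmetric] of_real_mult[symmetric])
  qed
  also have "of_real (sqrt l / l) * fourier (\<lambda>x. of_real (R x)) (\<xi> / l) = fourier (\<lambda>x. of_real (sqrt l * R (l * x))) \<xi>"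
    by (rule fourier_dilation[symmetric, OF _ l]) measurable
  finally show "of_real (l + \<bar>\<xi>\<bar>) * fourier (\<lambda>x. of_real (sqrt l * R (l * x))) \<xi> = fourier (\<lambda>x. of_real ((sqrt l * R (l * x)) ^ 3)) \<xi>" ..
qed

text \<open>Monotonicity serves twice: R is continuous off a null set, which gives pointwise
  convergence, and \<open>R ((1 + e) * x) \<le> R x\<close> for e > 0 gives the dominating function.
  The latter is why the limit is one-sided.\<close>

lemma dilation_continuity:
  fixes R :: "real \<Rightarrow> real"
  assumes [measurable]: "R \<in> borel_measurable borel" and R0: "\<And>x. 0 \<le> R x"
    and dec: "\<And>x y. \<bar>x\<bar> \<le> \<bar>y\<bar> \<Longrightarrow> R y \<le> R x" and R2: "integrable lborel (\<lambda>x. (R x)\<^sup>2)"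
  shows "((\<lambda>e. LINT x|lborel. (R x - sqrt (1 + e) * R ((1 + e) * x))\<^sup>2) \<longlongrightarrow> 0) (at_right 0)"
  unfolding tendsto_at_iff_sequentially
proof (intro allI impI)
  fix X :: "nat \<Rightarrow> real" assume X: "\<forall>i. X i \<in> {0<..} - {0}" "X \<longlonglongrightarrow> 0"
  then have X0: "0 < X i" for i by auto
  obtain E where "\<And>i. norm (X i) \<le> E" using convergent_imp_Bseq[of X] X(2) by (auto simp: convergent_def Bseq_def)
  then have E: "X i \<le> E" for i using abs_le_D1 by fastforce
  have "(\<lambda>i. LINT x|lborel. (R x - sqrt (1 + X i) * R ((1 + X i) * x))\<^sup>2) \<longlonglongrightarrow> integral\<^sup>L lborel (\<lambda>x::real. 0::real)"
  proof (rule integral_dominated_convergence[where w="\<lambda>x. (1 + E)\<^sup>2 * (R x)\<^sup>2"])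
    have even: "R \<bar>x\<bar> = R x" for x using dec[of x "\<bar>x\<bar>"] dec[of "\<bar>x\<bar>" x] by auto
    have "AE x in lborel. x \<noteq> 0 \<and> isCont R \<bar>x\<bar>" by (rule AE_isCont_decreasing) (rule dec)
    then show "AE x in lborel. (\<lambda>i. (R x - sqrt (1 + X i) * R ((1 + X i) * x))\<^sup>2) \<longlonglongrightarrow> 0"
    proof eventually_elim
      fix x assume x: "x \<noteq> 0 \<and> isCont R \<bar>x\<bar>"
      have "(\<lambda>i. (1 + X i) * \<bar>x\<bar>) \<longlonglongrightarrow> (1 + 0) * \<bar>x\<bar>" by (intro tendsto_intros X)
      then have "(\<lambda>i. R ((1 + X i) * \<bar>x\<bar>)) \<longlonglongrightarrow> R \<bar>x\<bar>" using x by (intro isCont_tendsto_compose[of _ R]) auto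
      moreover have "R ((1 + X i) * \<bar>x\<bar>) = R ((1 + X i) * x)" for i
        using even[of "(1 + X i) * x"] X0[of i] by (simp add: abs_mult)
      ultimately have "(\<lambda>i. R ((1 + X i) * x)) \<longlonglongrightarrow> R x" by (simp add: even)
      then have "(\<lambda>i. (R x - sqrt (1 + X i) * R ((1 + X i) * x))\<^sup>2) \<longlonglongrightarrow> (R x - sqrt (1 + 0) * R x)\<^sup>2"
        by (intro tendsto_intros X)
      then show "(\<lambda>i. (R x - sqrt (1 + X i) * R ((1 + X i) * x))\<^sup>2) \<longlonglongrightarrow> 0" by simp
    qed
    show "AE x in lborel. norm ((R x - sqrt (1 + X i) * R ((1 + X i) * x))\<^sup>2) \<le> (1 + E)\<^sup>2 * (R x)\<^sup>2" for i
    proof (intro always_eventually allI)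
      fix x
      have "1 * \<bar>x\<bar> \<le> (1 + X i) * \<bar>x\<bar>" using X0[of i] by (intro mult_right_mono) auto
      then have "\<bar>x\<bar> \<le> \<bar>(1 + X i) * x\<bar>" using X0[of i] by (simp add: abs_mult)
      then have "R ((1 + X i) * x) \<le> R x" by (rule dec)
      moreover have "sqrt (1 + X i) \<le> 1 + E"
      proof -
        have "sqrt (1 + X i) \<le> 1 + X i" using X0[of i] by (intro real_le_lsqrt) (auto simp: power2_eq_square algebra_simps)
        then show ?thesis using E[of i] by simp
      qed
      ultimately have "sqrt (1 + X i) * R ((1 + X i) * x) \<le> (1 + E) * R x"
        using R0 X0[of i] E[of i] by (intro mult_mono) auto
      moreover have "R x \<le> (1 + E) * R x" using R0[of x] X0[of i] E[of i] by (simp add: algebra_simps)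
      moreover have "0 \<le> sqrt (1 + X i) * R ((1 + X i) * x)" using R0 X0[of i] by simp
      ultimately have "\<bar>R x - sqrt (1 + X i) * R ((1 + X i) * x)\<bar> \<le> (1 + E) * R x" using R0[of x] by linarith
      then have "\<bar>R x - sqrt (1 + X i) * R ((1 + X i) * x)\<bar>\<^sup>2 \<le> ((1 + E) * R x)\<^sup>2" by (intro power_mono) auto
      then show "norm ((R x - sqrt (1 + X i) * R ((1 + X i) * x))\<^sup>2) \<le> (1 + E)\<^sup>2 * (R x)\<^sup>2"
        by (simp add: power_mult_distrib)
    qed
  qed (use R2 in auto)
  then show "((\<lambda>e. LINT x|lborel. (R x - sqrt (1 + e) * R ((1 + e) * x))\<^sup>2) \<circ> X) \<longlonglongrightarrow> 0" by (simp add: o_def)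
qed

lemma L2_norm_lborel:
  assumes [measurable]: "f \<in> borel_measurable borel"
  shows "L2_norm f = sqrt (LINT x|lborel. (cmod (f x))\<^sup>2)"
  unfolding L2_norm_def by (subst lebesgue_integral_lborel) auto

theorem theorem1p2:
  shows "\<exists>\<epsilon>0 > 0. \<exists>C c. c > 0 \<and> (\<exists>u1 u2 :: real \<Rightarrow> real \<Rightarrow> real \<Rightarrow> complex.
     (\<forall>\<epsilon>. 0 < \<epsilon> \<and> \<epsilon> < \<epsilon>0 \<longrightarrow>
        halfwave_solution (u1 \<epsilon>) \<and> halfwave_solution (u2 \<epsilon>) \<and>
        L2_norm (u1 \<epsilon> 0) \<le> C \<and> L2_norm (u2 \<epsilon> 0) \<le> C) \<and>
     ((\<lambda>\<epsilon>. L2_norm (\<lambda>x. u1 \<epsilon> 0 x - u2 \<epsilon> 0 x)) \<longlongrightarrow> 0) (at_right 0) \<and>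
     (\<forall>T > 0. ereal c \<le> Liminf (at_right 0)
        (\<lambda>\<epsilon>. SUP t\<in>{0..T}. ereal (L2_norm (\<lambda>x. u1 \<epsilon> t x - u2 \<epsilon> t x)))))"
proof (rule ground_state_exists)
  fix R :: "real \<Rightarrow> real" assume [measurable]: "R \<in> borel_measurable borel" and R0: "\<And>x. 0 \<le> R x"
    and dec: "\<And>x y. \<bar>x\<bar> \<le> \<bar>y\<bar> \<Longrightarrow> R y \<le> R x" and R1: "integrable lborel R" and R_pos: "0 < R 0"
    and R_eq: "\<And>x. ennreal (R x) = resolvent (\<lambda>y. ennreal (R y ^ 3)) x"
  have R_le: "R x \<le> R 0" for x by (rule dec) simp
  have R3: "integrable lborel (\<lambda>x. R x ^ 3)"
  proof (rule Bochner_Integration.integrable_bound[where f="\<lambda>x. (R 0)\<^sup>2 * R x"])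
    have "R x ^ 3 \<le> (R 0)\<^sup>2 * R x" for x
      using mult_right_mono[OF power_mono[OF R_le[of x] R0, of 2] R0[of x]] by (simp add: power3_eq_cube power2_eq_square)
    then show "AE x in lborel. norm (R x ^ 3) \<le> norm ((R 0)\<^sup>2 * R x)" using R0 by (simp add: abs_mult)
  qed (use R1 in auto)
  have R2: "integrable lborel (\<lambda>x. (R x)\<^sup>2)"
  proof (rule Bochner_Integration.integrable_bound[where f="\<lambda>x. R 0 * R x"])
    show "AE x in lborel. norm ((R x)\<^sup>2) \<le> norm (R 0 * R x)"
      using R0 R_le by (auto simp: abs_mult power2_eq_square intro: mult_right_mono)
  qed (use R1 in auto)
  have eq: "of_real (1 + \<bar>\<xi>\<bar>) * fourier (\<lambda>x. of_real (R x)) \<xi> = fourier (\<lambda>x. of_real (R x ^ 3)) \<xi>" for \<xi>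
    by (rule fourier_resolvent[OF R3 _ R0 R_eq]) (simp add: R0)
  define N where "N = sqrt (LINT x|lborel. (R x)\<^sup>2)"
  \<comment> \<open>Positivity at the single point 0 does not suffice; the equation does it, since a
    profile that is 0 almost everywhere has a resolvent that is 0 everywhere.\<close>
  have "(LINT x|lborel. (R x)\<^sup>2) \<noteq> 0"
  proof
    assume "(LINT x|lborel. (R x)\<^sup>2) = 0"
    then have "AE x in lborel. (R x)\<^sup>2 = 0" using integral_nonneg_eq_0_iff_AE[OF R2] by simp
    then have "AE x in lborel. ennreal (R x ^ 3) = 0" by eventually_elim simp
    then have "resolvent (\<lambda>y. ennreal (R y ^ 3)) 0 = resolvent (\<lambda>_. 0) 0" by (rule resolvent_cong_AE)
    then have "ennreal (R 0) = 0" by (simp add: R_eq resolvent_def)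
    then show False using R_pos by simp
  qed
  then have N: "0 < N" unfolding N_def by (simp add: order_less_le)
  define U where "U l t x = exp (\<i> * of_real (l * t)) * complex_of_real (sqrt l * R (l * x))" for l t x
  have [measurable]: "U l t \<in> borel_measurable borel" for l t unfolding U_def[abs_def] by measurable
  have U_sol: "halfwave_solution (U l)" if "0 < l" for l
    unfolding U_def[abs_def] by (rule rescaled_solution[where B="R 0", OF R1 _ that eq]) (use R0 R_le in auto)
  have nU: "cmod (U l t x) = sqrt l * R (l * x)" if "0 < l" for l t x
    using that R0 unfolding U_def norm_mult norm_exp_i_real norm_of_real by simp
  have dil: "(LINT x|lborel. l * g (l * x)) = (LINT x|lborel. g x)" if "0 < l" for l and g :: "real \<Rightarrow> real"
    using lborel_integral_real_affine[of l g 0] that by simp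
  have U_norm: "L2_norm (U l t) = N" if l: "0 < l" for l t
  proof -
    have "(LINT x|lborel. (cmod (U l t x))\<^sup>2) = (LINT x|lborel. l * (R (l * x))\<^sup>2)"
      unfolding nU[OF l] using l by (simp add: power_mult_distrib)
    also have "\<dots> = (LINT x|lborel. (R x)\<^sup>2)" by (rule dil[OF l])
    finally show ?thesis unfolding N_def by (simp add: L2_norm_lborel)
  qed
  define l1 l2 where "l1 e = 1 / e\<^sup>2" and "l2 e = 1 / e\<^sup>2 + 1 / e" for e :: real
  have l_pos: "0 < l1 e" "0 < l2 e" if "0 < e" for e using that by (auto simp: l1_def l2_def add_pos_pos)
  have l21: "l2 e = (1 + e) * l1 e" if "0 < e" for e using that by (simp add: l1_def l2_def field_simps power2_eq_square)
  \<comment> \<open>Scale invariance of the L^2 norm reduces the comparison of the two waves to that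
    of R with its dilate by 1 + e, the ratio of the two scales.\<close>
  have diff0: "L2_norm (\<lambda>x. U (l1 e) 0 x - U (l2 e) 0 x) = sqrt (LINT x|lborel. (R x - sqrt (1 + e) * R ((1 + e) * x))\<^sup>2)" if e: "0 < e" for e
  proof -
    have "(cmod (U (l1 e) 0 x - U (l2 e) 0 x))\<^sup>2 = l1 e * (R (l1 e * x) - sqrt (1 + e) * R ((1 + e) * (l1 e * x)))\<^sup>2" for x
    proof -
      have "U (l1 e) 0 x - U (l2 e) 0 x = of_real (sqrt (l1 e) * (R (l1 e * x) - sqrt (1 + e) * R ((1 + e) * (l1 e * x))))"
        unfolding U_def l21[OF e] real_sqrt_mult mult.assoc by (simp add: right_diff_distrib mult.left_commute)
      then show ?thesis using l_pos[OF e] by (simp only: norm_of_real power2_abs power_mult_distrib) simp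
    qed
    then have "(LINT x|lborel. (cmod (U (l1 e) 0 x - U (l2 e) 0 x))\<^sup>2)
        = (LINT x|lborel. l1 e * (R (l1 e * x) - sqrt (1 + e) * R ((1 + e) * (l1 e * x)))\<^sup>2)" by (simp only:)
    also have "\<dots> = (LINT x|lborel. (R x - sqrt (1 + e) * R ((1 + e) * x))\<^sup>2)" by (rule dil[OF l_pos(1)[OF e]])
    finally show ?thesis by (simp add: L2_norm_lborel)
  qed
  have low: "N \<le> L2_norm (\<lambda>x. U (l1 e) (pi * e) x - U (l2 e) (pi * e) x)" if e: "0 < e" for e
  proof -
    define t where "t = pi * e"
    have "l2 e * t = l1 e * t + pi" using e by (simp add: l1_def l2_def t_def field_simps power2_eq_square)
    then have "\<i> * complex_of_real (l2 e * t) = \<i> * of_real (l1 e * t) + \<i> * of_real pi" by (simp add: algebra_simps)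
    then have ph: "exp (\<i> * complex_of_real (l2 e * t)) = - exp (\<i> * of_real (l1 e * t))"
      by (simp only: exp_add) (simp add: exp_pi_i' mult.commute)
    have nd: "cmod (U (l1 e) t x - U (l2 e) t x) = sqrt (l1 e) * R (l1 e * x) + sqrt (l2 e) * R (l2 e * x)" for x
    proof -
      have "U (l1 e) t x - U (l2 e) t x = exp (\<i> * of_real (l1 e * t)) * of_real (sqrt (l1 e) * R (l1 e * x) + sqrt (l2 e) * R (l2 e * x))"
        unfolding U_def ph by (simp add: algebra_simps)
      then show ?thesis using l_pos[OF e] R0
        by (simp only: norm_mult norm_exp_i_real norm_of_real) (simp add: add_nonneg_nonneg)
    qed
    have i: "integrable lborel (\<lambda>x. (sqrt l * R (l * x))\<^sup>2)" if "0 < l" for l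
      using lborel_integrable_real_affine[OF R2, of l 0] that by (simp add: power_mult_distrib)
    have "(LINT x|lborel. (cmod (U (l1 e) t x))\<^sup>2) \<le> (LINT x|lborel. (cmod (U (l1 e) t x - U (l2 e) t x))\<^sup>2)"
    proof (rule integral_mono)
      show "integrable lborel (\<lambda>x. (cmod (U (l1 e) t x))\<^sup>2)" unfolding nU[OF l_pos(1)[OF e]] by (rule i[OF l_pos(1)[OF e]])
      show "integrable lborel (\<lambda>x. (cmod (U (l1 e) t x - U (l2 e) t x))\<^sup>2)"
      proof (rule Bochner_Integration.integrable_bound)
        show "integrable lborel (\<lambda>x. 2 * (sqrt (l1 e) * R (l1 e * x))\<^sup>2 + 2 * (sqrt (l2 e) * R (l2 e * x))\<^sup>2)"
          using i[OF l_pos(1)[OF e]] i[OF l_pos(2)[OF e]] by auto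
        show "AE x in lborel. norm ((cmod (U (l1 e) t x - U (l2 e) t x))\<^sup>2)
            \<le> norm (2 * (sqrt (l1 e) * R (l1 e * x))\<^sup>2 + 2 * (sqrt (l2 e) * R (l2 e * x))\<^sup>2)"
        proof (intro always_eventually allI)
          fix x
          have "(a + b)\<^sup>2 \<le> 2 * a\<^sup>2 + 2 * b\<^sup>2" for a b :: real
            using sum_squares_bound[of a b] by (simp add: power2_sum)
          from this[of "sqrt (l1 e) * R (l1 e * x)" "sqrt (l2 e) * R (l2 e * x)"]
          show "norm ((cmod (U (l1 e) t x - U (l2 e) t x))\<^sup>2)
              \<le> norm (2 * (sqrt (l1 e) * R (l1 e * x))\<^sup>2 + 2 * (sqrt (l2 e) * R (l2 e * x))\<^sup>2)"
            unfolding nd by simp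
        qed
      qed simp
      show "(cmod (U (l1 e) t x))\<^sup>2 \<le> (cmod (U (l1 e) t x - U (l2 e) t x))\<^sup>2" for x
        unfolding nd nU[OF l_pos(1)[OF e]] using R0 l_pos[OF e] by (intro power_mono) auto
    qed
    then have "L2_norm (U (l1 e) t) \<le> L2_norm (\<lambda>x. U (l1 e) t x - U (l2 e) t x)"
      by (simp add: L2_norm_lborel)
    then show ?thesis unfolding U_norm[OF l_pos(1)[OF e]] t_def .
  qed
  show ?thesis
  proof (intro exI conjI allI impI)
    \<comment> \<open>Fixes the threshold as 1. \<open>N\<close> then serves both as
      \<open>C\<close> and as \<open>c\<close>, since every rescaled wave has L^2 norm exactly
      \<open>N\<close>.\<close>
    show "(0::real) < 1" by simp
    show "0 < N" by (rule N)
    fix e :: real assume "0 < e \<and> e < 1"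
    then have l: "0 < l1 e" "0 < l2 e" using l_pos by auto
    show "halfwave_solution (U (l1 e))" "halfwave_solution (U (l2 e))" using l by (auto intro: U_sol)
    show "L2_norm (U (l1 e) 0) \<le> N" "L2_norm (U (l2 e) 0) \<le> N" using l by (auto simp: U_norm)
  next
    have "((\<lambda>e. sqrt (LINT x|lborel. (R x - sqrt (1 + e) * R ((1 + e) * x))\<^sup>2)) \<longlongrightarrow> sqrt 0) (at_right 0)"
      by (intro tendsto_intros dilation_continuity R0 dec R2) auto
    then have "((\<lambda>e. sqrt (LINT x|lborel. (R x - sqrt (1 + e) * R ((1 + e) * x))\<^sup>2)) \<longlongrightarrow> 0) (at_right 0)" by simp
    then show "((\<lambda>e. L2_norm (\<lambda>x. U (l1 e) 0 x - U (l2 e) 0 x)) \<longlongrightarrow> 0) (at_right 0)"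
      by (rule Lim_transform_eventually) (use diff0 in \<open>auto simp: eventually_at_filter\<close>)
  next
    fix T :: real assume T: "0 < T"
    have "eventually (\<lambda>e. e < T / pi) (at_right 0)" using T by (intro order_tendstoD(2)[OF tendsto_ident_at]) simp
    then have "eventually (\<lambda>e. ereal N \<le> (SUP t\<in>{0..T}. ereal (L2_norm (\<lambda>x. U (l1 e) t x - U (l2 e) t x)))) (at_right 0)"
      using eventually_at_right_less[of 0]
    proof eventually_elim
      fix e :: real assume e: "e < T / pi" "0 < e"
      then have "pi * e \<in> {0..T}" by (simp add: field_simps)
      moreover have "ereal N \<le> ereal (L2_norm (\<lambda>x. U (l1 e) (pi * e) x - U (l2 e) (pi * e) x))" using low[OF e(2)] by simp
      ultimately show "ereal N \<le> (SUP t\<in>{0..T}. ereal (L2_norm (\<lambda>x. U (l1 e) t x - U (l2 e) t x)))" by (rule SUP_upper2)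
    qed
    then show "ereal N \<le> Liminf (at_right 0) (\<lambda>e. SUP t\<in>{0..T}. ereal (L2_norm (\<lambda>x. U (l1 e) t x - U (l2 e) t x)))"
      by (rule Liminf_bounded)
  qed
qed


end
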